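(* If $G$ is a planar graph with $n$ vertices and $n\ge 5$, then $\varphi(G)\le 2n-5$. This bound is sharp for $n=8$ and for all $n\ge 10$; that is, for each such $n$ there is a planar $n$-vertex graph $G$ with $\varphi(G)=2n-5$.
   Context: Graphs are finite and simple. Two sets overlap if they intersect but neither contains the other. An overlap representation of a graph $G$ is an assignment $f$ of sets to the vertices of $G$ such that, for distinct vertices $u,v$, $uv\in E(G)$ if and only if $f(u)$ and $f(v)$ overlap. When the assigned sets are finite, the size of $f$ is $\left|\bigcup_{v\in V(G)} f(v)\right|$. The overlap number $\varphi(G)$ is the minimum size of an overlap representation of $G$ by finite sets. *)

theory Defs
  imports "HOL-Analysis.Analysis" "Graph_Theory.Pair_Digraph"
begin

text \<open>
  Finite simple graphs are the \<open>pair_graph\<close>s of \<open>Graph_Theory\<close>: a finite vertex set \<open>pverts G\<close>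
  and a symmetric, irreflexive adjacency relation \<open>parcs G\<close> on it, so that each undirected edge
  \<open>uv\<close> occurs as the two pairs \<open>(u,v)\<close> and \<open>(v,u)\<close>.
\<close>

definition edges :: "'a pair_pre_digraph \<Rightarrow> 'a set set" where
  "edges G = {{u, v} |u v. (u, v) \<in> parcs G}"

text \<open>
  The vertices are drawn as distinct points of the plane and every edge as a simple arc
  between its two ends; the interior of such an arc contains no vertex and no point of any
  other edge. The orientation of the arc \<open>\<gamma> e\<close> is immaterial.
\<close>

definition plane_drawing ::
    "'a pair_pre_digraph \<Rightarrow> ('a \<Rightarrow> complex) \<Rightarrow> ('a set \<Rightarrow> real \<Rightarrow> complex) \<Rightarrow> bool" where
  "plane_drawing G p \<gamma> \<longleftrightarrow>
     inj_on p (pverts G) \<and>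
     (\<forall>e \<in> edges G.
        arc (\<gamma> e) \<and>
        {pathstart (\<gamma> e), pathfinish (\<gamma> e)} = p ` e \<and>
        (path_image (\<gamma> e) - p ` e) \<inter> p ` pverts G = {}) \<and>
     (\<forall>e \<in> edges G. \<forall>e' \<in> edges G. e \<noteq> e' \<longrightarrow>
        (path_image (\<gamma> e) - p ` e) \<inter> path_image (\<gamma> e') = {})"

definition planar :: "'a pair_pre_digraph \<Rightarrow> bool" where
  "planar G \<longleftrightarrow> (\<exists>p \<gamma>. plane_drawing G p \<gamma>)"

definition overlap :: "'b set \<Rightarrow> 'b set \<Rightarrow> bool" where
  "overlap A B \<longleftrightarrow> A \<inter> B \<noteq> {} \<and> \<not> A \<subseteq> B \<and> \<not> B \<subseteq> A"

definition overlap_representation :: "'a pair_pre_digraph \<Rightarrow> ('a \<Rightarrow> 'b set) \<Rightarrow> bool" where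
  "overlap_representation G f \<longleftrightarrow>
     (\<forall>u \<in> pverts G. \<forall>v \<in> pverts G. u \<noteq> v \<longrightarrow>
        ((u, v) \<in> parcs G \<longleftrightarrow> overlap (f u) (f v)))"

definition representation_size :: "'a pair_pre_digraph \<Rightarrow> ('a \<Rightarrow> 'b set) \<Rightarrow> nat" where
  "representation_size G f = card (\<Union>v \<in> pverts G. f v)"

text \<open>
  Only finitely many elements occur in a representation of a finite graph by finite sets, so it
  is no restriction to draw them from \<open>nat\<close>. The minimum is over a nonempty set by
  \<open>finite_overlap_representation_exists\<close> below.
\<close>

definition overlap_number :: "'a pair_pre_digraph \<Rightarrow> nat" where
  "overlap_number G = (LEAST k. \<exists>f :: 'a \<Rightarrow> nat set.
     overlap_representation G f \<and> (\<forall>v \<in> pverts G. finite (f v)) \<and> representation_size G f = k)"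

lemma finite_overlap_representation_exists:
  fixes G :: "'a pair_pre_digraph"
  assumes "pair_graph G"
  shows "\<exists>f :: 'a \<Rightarrow> nat set. overlap_representation G f \<and> (\<forall>v \<in> pverts G. finite (f v))"
proof -
  interpret pair_graph G by fact
  let ?P = "pverts G \<times> pverts G"
  have fin: "finite ?P" by simp
  then obtain h :: "'a \<times> 'a \<Rightarrow> nat" where h: "inj_on h ?P"
    using finite_imp_inj_to_nat_seg by metis
  define S where "S v = insert (v, v) {(a, b) \<in> parcs G. a = v \<or> b = v}" for v
  have wf: "a \<in> pverts G" "b \<in> pverts G" if "(a, b) \<in> parcs G" for a b
    using that wellformed by fastforce+
  have S: "S v \<subseteq> ?P" if "v \<in> pverts G" for v
    using that wf by (auto simp: S_def)
  have "overlap (h ` S u) (h ` S v) \<longleftrightarrow> overlap (S u) (S v)" if "u \<in> pverts G" "v \<in> pverts G" for u v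
    using S[OF that(1)] S[OF that(2)] h unfolding overlap_def
    by (metis inj_on_image_Int inj_on_image_subset_iff image_is_empty)
  moreover have "(u, v) \<in> parcs G \<longleftrightarrow> overlap (S u) (S v)" if "u \<noteq> v" for u v
  proof -
    have "(v, v) \<notin> S u" "(u, u) \<notin> S v"
      using that pair_no_loops by (auto simp: S_def)
    moreover have "S u \<inter> S v \<noteq> {} \<longleftrightarrow> (u, v) \<in> parcs G"
      using that arcs_symmetric by (auto simp: S_def)
    ultimately show ?thesis by (auto simp: overlap_def S_def)
  qed
  ultimately have "overlap_representation G (\<lambda>v. h ` S v)"
    by (simp add: overlap_representation_def)
  moreover have "\<forall>v \<in> pverts G. finite (h ` S v)"
    using S fin finite_subset by blast
  ultimately show ?thesis by blast
qed

end

theory Submission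
  imports Defs
begin

text \<open>
  The upper bound comes from covering edges by cliques. Let \<open>Q\<close> be a family of cliques such
  that every edge lies in exactly one member and every vertex in at least two; singletons are
  allowed as members. The sets \<open>f v = {q \<in> Q. v \<in> q}\<close> represent the graph, because adjacent
  vertices share exactly one member and each of them has another one, while non-adjacent vertices
  share none. One element can be saved: fix a member \<open>q\<close>, replace \<open>f v\<close> by its complement for
  all \<open>v \<in> q\<close>, and drop \<open>q\<close> itself, which is then in no set. This fails only if some edge meets
  every member of \<open>Q\<close>, a situation so special that \<open>Q\<close> is small or can be made smaller by hand
  (\<open>represented_saving_one\<close>). It therefore suffices to find \<open>Q\<close> with at most \<open>2n - 4\<close> members.

  For a planar graph with \<open>n\<close> vertices, \<open>m\<close> edges and \<open>s\<close> triangular faces, Euler's inequality and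
  the count of incidences between edges and faces give \<open>2m \<le> 4n - 8 + s\<close>. Each triangular
  face shares an edge with at most three others, so at least \<open>s/4\<close> of them have pairwise disjoint
  edge sets. These triangles and the remaining edges number at most \<open>m - s/2 \<le> 2n - 4\<close>
  (\<open>triangle_packing\<close>). What is left is to give every vertex a second clique. Where all degrees
  are at least three this is automatic. Other graphs are peeled: each vertex of degree at most two
  in what remains costs two members, an edge and either another edge or a private singleton, until
  only a subgraph of minimum degree three remains (\<open>clique_system_with_core\<close>). If nothing remains,
  the graph is so sparse that its edges, the private singletons and at most one triangle suffice
  (\<open>clique_system_degenerate\<close>), provided that there are no isolated vertices, no isolated edges and
  no two leaves at the same vertex; the induction of \<open>represented_if_packed\<close> first removes those.

  Euler's inequality is derived from the Jordan curve theorem, by which an edge closing a cycle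
  creates a new face, and from Janiszewski's theorem, by which an edge borders at most two faces
  and a bridge does not separate its surroundings (\<open>Euler_inequality\<close>, \<open>no_three_faces_at_edge\<close>).

  For the lower bound let the graph be triangle-free, without two vertices that have the same
  neighbours, and such that deleting a vertex and its neighbours never disconnects it. If \<open>f v\<close> contains the set of one non-neighbour of \<open>v\<close>, it
  contains the sets of all of them. The vertices \<open>v\<close> of this kind are pairwise adjacent, so there
  are at most two, and all edges but at most one can be given distinct elements of the union
  (\<open>card_edges_le_representation\<close>). A quadrangulation has \<open>2n - 4\<close> edges. For even \<open>n\<close> the
  pseudo-double wheels qualify: an even cycle with two further vertices, one joined to all even and the
  other to all odd vertices of the cycle. For odd \<open>n\<close> one of the two hubs is split in two.
\<close>

section \<open>Faces of a plane drawing\<close>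

text \<open>
  Both the number of faces and the number of connected pieces of a drawing are compared before and
  after an edge is added by mapping the finer partition onto the coarser one.
\<close>
lemma card_less_of_surj_not_inj:
  assumes "finite B" "h ` B = C" "\<not> inj_on h B"
  shows "card C < card B"
  using assms card_image_le[of B h] eq_card_imp_inj_on[of B h] by fastforce

text \<open>
  Vertices and edges appear as sets, so that subgraphs are given by sets of edges \<open>A \<subseteq> E\<close> drawn
  by the same arcs.
\<close>
locale drawing =
  fixes p :: "'a \<Rightarrow> complex" and \<gamma> :: "'a set \<Rightarrow> real \<Rightarrow> complex"
    and V :: "'a set" and E :: "'a set set"
  assumes finite_V: "finite V" and inj_p: "inj_on p V"
    and edge: "e \<in> E \<Longrightarrow> \<exists>u\<in>V. \<exists>v\<in>V. u \<noteq> v \<and> e = {u, v}"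
    and arc_edge: "e \<in> E \<Longrightarrow> arc (\<gamma> e)"
    and ends_edge: "e \<in> E \<Longrightarrow> {pathstart (\<gamma> e), pathfinish (\<gamma> e)} = p ` e"
    and inner_avoids_vertices: "e \<in> E \<Longrightarrow> (path_image (\<gamma> e) - p ` e) \<inter> p ` V = {}"
    and inner_avoids_edges:
      "\<lbrakk>e \<in> E; e' \<in> E; e \<noteq> e'\<rbrakk> \<Longrightarrow> (path_image (\<gamma> e) - p ` e) \<inter> path_image (\<gamma> e') = {}"
begin

definition inner :: "'a set \<Rightarrow> complex set" where
  "inner e = path_image (\<gamma> e) - p ` e"

definition drawn :: "'a set set \<Rightarrow> complex set" where
  "drawn A = (\<Union>e\<in>A. path_image (\<gamma> e))"

definition faces :: "'a set set \<Rightarrow> complex set set" where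
  "faces A = components (- drawn A)"

text \<open>
  The boundary edges of a face are read off from inner points of arcs, since an end of an arc may
  lie in the closure of a face that the arc does not border.
\<close>
definition boundary :: "'a set set \<Rightarrow> complex set \<Rightarrow> 'a set set" where
  "boundary A U = {e\<in>A. closure U \<inter> inner e \<noteq> {}}"

lemma finite_E: "finite E"
proof -
  have "E \<subseteq> Pow V" using edge by fastforce
  then show ?thesis using finite_V by (simp add: finite_subset)
qed

lemma finite_sub: "A \<subseteq> E \<Longrightarrow> finite A"
  using finite_E finite_subset by blast

lemma compact_drawn: "A \<subseteq> E \<Longrightarrow> compact (drawn A)"
  unfolding drawn_def using finite_sub arc_edge by (intro compact_UN) (auto intro: compact_arc_image)

lemma closed_drawn: "A \<subseteq> E \<Longrightarrow> closed (drawn A)"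
  using compact_drawn compact_imp_closed by blast

lemma drawn_mono: "A \<subseteq> B \<Longrightarrow> drawn A \<subseteq> drawn B"
  by (auto simp: drawn_def)

lemma drawn_insert: "drawn (insert e A) = path_image (\<gamma> e) \<union> drawn A"
  by (auto simp: drawn_def)

lemma ends_in_image: "e \<in> E \<Longrightarrow> p ` e \<subseteq> path_image (\<gamma> e)"
  using ends_edge[of e] by (metis pathfinish_in_path_image pathstart_in_path_image empty_subsetI insert_subset)

lemma image_eq: "e \<in> E \<Longrightarrow> path_image (\<gamma> e) = inner e \<union> p ` e"
  using ends_in_image unfolding inner_def by blast

lemma connected_inner: "e \<in> E \<Longrightarrow> connected (inner e)"
  and inner_nonempty: "e \<in> E \<Longrightarrow> inner e \<noteq> {}"
  using connected_simple_path_endless nonempty_simple_path_endless arc_imp_simple_path[OF arc_edge] ends_edge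
  unfolding inner_def by metis+

lemma inner_disjoint: "\<lbrakk>A \<subseteq> E; e \<in> E; e \<notin> A\<rbrakk> \<Longrightarrow> inner e \<inter> drawn A = {}"
  using inner_avoids_edges unfolding inner_def drawn_def by fastforce

lemma image_Int_drawn: "\<lbrakk>A \<subseteq> E; e \<in> E; e \<notin> A\<rbrakk> \<Longrightarrow> path_image (\<gamma> e) \<inter> drawn A \<subseteq> p ` e"
  using inner_disjoint unfolding inner_def by blast

lemma vertex_in_drawn:
  assumes "A \<subseteq> E" "v \<in> V" "p v \<in> drawn A"
  obtains e where "e \<in> A" "v \<in> e"
proof -
  obtain e where e: "e \<in> A" "p v \<in> path_image (\<gamma> e)" using assms(3) by (auto simp: drawn_def)
  then have "p v \<in> p ` e" using inner_avoids_vertices[of e] assms by blast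
  moreover have "e \<subseteq> V" using e assms(1) edge by blast
  ultimately show thesis using that e(1) assms(2) inj_p by (metis inj_on_image_mem_iff)
qed

lemma face_basics:
  assumes "A \<subseteq> E" "U \<in> faces A"
  shows "open U" "connected U" "U \<noteq> {}" "U \<subseteq> - drawn A"
proof -
  show "open U" using assms closed_drawn open_components[of "- drawn A"] unfolding faces_def by (simp add: open_Compl)
qed (use assms in_components_connected in_components_nonempty in_components_subset in \<open>unfold faces_def; blast\<close>)+

lemma face_eqI:
  assumes "U \<in> faces A" "U' \<in> faces A" "x \<in> U" "y \<in> U'" "connected_component (- drawn A) x y"
  shows "U = U'"
proof -
  have "U = connected_component_set (- drawn A) x" "U' = connected_component_set (- drawn A) y"
    using assms unfolding faces_def by (metis components_iff connected_component_eq)+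
  then show ?thesis using assms(5) connected_component_eq_eq by (metis connected_component_eq mem_Collect_eq)
qed

text \<open>
  A bridge separates no two points. Its arc meets the part of the drawing that is joined to \<open>u\<close>
  in at most the point \<open>p u\<close>, and it meets the rest in at most \<open>p v\<close>. An arc alone does
  not separate the plane, so Janiszewski's theorem adds first one part and then the other.
\<close>
lemma connected_component_bridge:
  assumes A: "A \<subseteq> E" and e: "e \<in> E" "e \<notin> A" "e = {u, v}"
    and sep: "\<not> path_component (drawn A) (p u) (p v)"
    and xy: "connected_component (- drawn A) x y"
    and out: "x \<notin> path_image (\<gamma> e)" "y \<notin> path_image (\<gamma> e)"
  shows "connected_component (- drawn (insert e A)) x y"
proof -
  define A1 where "A1 = {e'\<in>A. \<exists>z\<in>path_image (\<gamma> e'). path_component (drawn A) (p u) z}"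
  define A2 where "A2 = A - A1"
  have sub: "A1 \<subseteq> A" "A2 \<subseteq> A" "A1 \<subseteq> E" "A2 \<subseteq> E" and AA: "A = A1 \<union> A2" "e \<notin> A1" "e \<notin> A2"
    using A e by (auto simp: A1_def A2_def)
  have A1: "path_component (drawn A) (p u) z" if z: "z \<in> drawn A1" for z
  proof -
    obtain e' where e': "e' \<in> A1" "z \<in> path_image (\<gamma> e')" using z by (auto simp: drawn_def)
    then obtain w where w: "w \<in> path_image (\<gamma> e')" "path_component (drawn A) (p u) w"
      by (auto simp: A1_def)
    have "path_connected (path_image (\<gamma> e'))"
      using e' sub arc_edge by (intro path_connected_path_image arc_imp_path) auto
    then have "path_component (path_image (\<gamma> e')) w z"
      using w e' by (simp add: path_connected_component)
    then have "path_component (drawn A) w z"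
      using e' sub by (elim path_component_of_subset[rotated]) (auto simp: drawn_def)
    then show ?thesis using w path_component_trans by blast
  qed
  have A2: "\<not> path_component (drawn A) (p u) z" if "z \<in> drawn A2" for z
    using that by (auto simp: A2_def A1_def drawn_def)
  have disj: "drawn A1 \<inter> drawn A2 = {}" using A1 A2 by blast
  have vA1: "p v \<notin> drawn A1" using A1 sep by blast
  have uA2: "p u \<notin> drawn A2"
  proof
    assume "p u \<in> drawn A2"
    then have "path_component (drawn A) (p u) (p u)"
      using sub drawn_mono by (intro path_component_refl) blast
    then show False using A2 \<open>p u \<in> drawn A2\<close> by blast
  qed
  have cmpt: "compact (path_image (\<gamma> e))" using e arc_edge by (simp add: compact_arc_image)
  have c1: "path_image (\<gamma> e) \<inter> drawn A1 \<subseteq> {p u}"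
    using image_Int_drawn[of A1 e] sub AA e vA1 by auto
  have c2: "(path_image (\<gamma> e) \<union> drawn A1) \<inter> drawn A2 \<subseteq> {p v}"
    using image_Int_drawn[of A2 e] sub AA e uA2 disj by auto
  have single: "connected S" if "S \<subseteq> {c}" for S :: "complex set" and c
    using that by (metis connected_empty connected_sing subset_singletonD)
  have arcc: "connected_component (- path_image (\<gamma> e)) x y"
    using connected_arc_complement[OF arc_edge[OF e(1)]] out by (simp add: connected_iff_connected_component)
  have on: "connected_component (- drawn A1) x y" "connected_component (- drawn A2) x y"
    using xy sub(1,2) drawn_mono by (meson Compl_anti_mono connected_component_of_subset)+
  have "connected_component (- (path_image (\<gamma> e) \<union> drawn A1)) x y"
    by (rule Janiszewski[OF cmpt _ single[OF c1] arcc on(1)]) (use closed_drawn sub in auto)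
  then have "connected_component (- ((path_image (\<gamma> e) \<union> drawn A1) \<union> drawn A2)) x y"
    by (intro Janiszewski[OF _ _ single[OF c2] _ on(2)]) (use closed_drawn compact_drawn cmpt sub in auto)
  moreover have "drawn (insert e A) = (path_image (\<gamma> e) \<union> drawn A1) \<union> drawn A2"
    using AA by (auto simp: drawn_def)
  ultimately show ?thesis by simp
qed

lemma cycle_through_edge:
  assumes A: "A \<subseteq> E" and e: "e \<in> E" "e \<notin> A" "e = {u, v}"
    and pc: "path_component (drawn A) (p u) (p v)"
  obtains c Q where "simple_path c" "pathfinish c = pathstart c"
    "path_image c = path_image (\<gamma> e) \<union> Q" "Q \<subseteq> drawn A" "connected Q" "p ` e \<subseteq> Q"
proof -
  let ?a = "pathstart (\<gamma> e)" and ?b = "pathfinish (\<gamma> e)"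
  have ab: "{?a, ?b} = {p u, p v}" using ends_edge e by auto
  have "?a \<noteq> ?b" using arc_distinct_ends[OF arc_edge[OF e(1)]] by simp
  have "path_component (drawn A) ?b ?a"
    using pc ab by (metis doubleton_eq_iff path_component_sym)
  then obtain g where g: "path g" "path_image g \<subseteq> drawn A" "pathstart g = ?b" "pathfinish g = ?a"
    by (auto simp: path_component_def)
  obtain q where q: "arc q" "path_image q \<subseteq> path_image g" "pathstart q = ?b" "pathfinish q = ?a"
    using path_contains_arc[OF g(1,3,4)] \<open>?a \<noteq> ?b\<close> by metis
  have sub: "path_image (\<gamma> e) \<inter> path_image q \<subseteq> p ` e"
    using image_Int_drawn[OF A e(1,2)] g q by blast
  show thesis
  proof (rule that[of "\<gamma> e +++ q" "path_image q"])
    show "simple_path (\<gamma> e +++ q)"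
      using q arc_edge[OF e(1)] sub ends_edge[OF e(1)] by (intro simple_path_join_loop) auto
    show "path_image (\<gamma> e +++ q) = path_image (\<gamma> e) \<union> path_image q"
      using q by (simp add: path_image_join)
    show "p ` e \<subseteq> path_image q"
      using q pathstart_in_path_image[of q] pathfinish_in_path_image[of q]
      unfolding ends_edge[OF e(1), symmetric] by simp
  qed (use q g in \<open>auto intro: connected_arc_image\<close>)
qed

text \<open>
  An inner point of \<open>e\<close> lies in one face of the drawing of \<open>A\<close>, and close to it there are points
  inside and outside of the Jordan curve through \<open>e\<close>: adding \<open>e\<close> splits that face.
\<close>
lemma more_faces_if_cycle:
  assumes A: "A \<subseteq> E" and e: "e \<in> E" "e \<notin> A" "e = {u, v}"
    and pc: "path_component (drawn A) (p u) (p v)"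
    and fin: "finite (faces (insert e A))"
  shows "card (faces A) < card (faces (insert e A))"
proof -
  obtain c Q where c: "simple_path c" "pathfinish c = pathstart c"
    "path_image c = path_image (\<gamma> e) \<union> Q" "Q \<subseteq> drawn A" "connected Q" "p ` e \<subseteq> Q"
    by (rule cycle_through_edge[OF A e pc])
  note J = Jordan_inside_outside[OF c(1,2)]
  have cyc_avoids: "inside (path_image c) \<inter> path_image (\<gamma> e) = {}" "outside (path_image c) \<inter> path_image (\<gamma> e) = {}"
    using c(3) inside_no_overlap[of "path_image c"] outside_no_overlap[of "path_image c"] by blast+
  have iA: "insert e A \<subseteq> E" using A e by auto
  (* Each face of the larger drawing lies in exactly one face of the smaller one. *)
  define h where "h U = connected_component_set (- drawn A) (SOME x. x \<in> U)" for U
  have h: "h U \<in> faces A \<and> U \<subseteq> h U" if U: "U \<in> faces (insert e A)" for U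
  proof -
    note b = face_basics[OF iA U]
    have s: "(SOME x. x \<in> U) \<in> U" using b(3) by (simp add: some_in_eq)
    have sub: "U \<subseteq> - drawn A" using b(4) by (auto simp: drawn_insert)
    then have "h U \<in> faces A" using s by (auto simp: h_def faces_def components_def)
    moreover have "U \<subseteq> h U" unfolding h_def using b s sub by (intro connected_component_maximal) auto
    ultimately show ?thesis by blast
  qed
  have uniq: "W = h U" if "U \<in> faces (insert e A)" "W \<in> faces A" "x \<in> U" "x \<in> W" for U W x
    using h[OF that(1)] that unfolding faces_def by (metis IntI components_nonoverlap empty_iff subsetD)
  have inc: "connected_component_set (- drawn (insert e A)) x \<in> faces (insert e A)" if "x \<notin> drawn (insert e A)" for x
    using that by (auto simp: faces_def components_def)
  have surj: "h ` faces (insert e A) = faces A"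
  proof
    show "faces A \<subseteq> h ` faces (insert e A)"
    proof
      fix W assume W: "W \<in> faces A"
      note b = face_basics[OF A W]
      obtain x where x: "x \<in> W" "x \<notin> path_image (\<gamma> e)"
      proof (rule ccontr)
        assume "\<not> thesis"
        then have "W \<subseteq> frontier (inside (path_image c))" using that J c(3) by auto
        then have "W \<inter> inside (path_image c) \<noteq> {}"
          using b(1,3) by (metis all_not_in_conv frontier_def inf.orderE Diff_subset open_Int_closure_eq_empty subset_trans)
        then show False using \<open>W \<subseteq> frontier (inside (path_image c))\<close> J by (metis Diff_disjoint frontier_def interior_open subset_iff disjoint_iff)
      qed
      then have x': "x \<notin> drawn (insert e A)" using b by (auto simp: drawn_insert)
      show "W \<in> h ` faces (insert e A)"
        using uniq[OF inc[OF x'] W _ x(1)] inc[OF x'] x' by auto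
    qed
  qed (use h in blast)
  have "\<not> inj_on h (faces (insert e A))"
  proof -
    obtain z where z: "z \<in> inner e" using inner_nonempty e by blast
    then have zA: "z \<in> - drawn A" using inner_disjoint[OF A e(1,2)] by blast
    then obtain r where r: "r > 0" "ball z r \<subseteq> - drawn A"
      using closed_drawn[OF A] open_contains_ball by (metis open_Compl)
    have zc: "z \<in> frontier (inside (path_image c))" "z \<in> frontier (outside (path_image c))"
      using J c(3) z image_eq[OF e(1)] by auto
    obtain x where x: "x \<in> inside (path_image c)" "x \<in> ball z r"
      using zc(1) r(1) by (meson centre_in_ball disjoint_iff frontier_straddle mem_ball)
    obtain y where y: "y \<in> outside (path_image c)" "y \<in> ball z r"
      using zc(2) r(1) by (meson centre_in_ball disjoint_iff frontier_straddle mem_ball)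
    have nx: "x \<notin> drawn (insert e A)" "y \<notin> drawn (insert e A)"
      using x y r cyc_avoids by (auto simp: drawn_insert)
    let ?X = "connected_component_set (- drawn (insert e A)) x"
    let ?Y = "connected_component_set (- drawn (insert e A)) y"
    have xx: "x \<in> ?X" "y \<in> ?Y" using nx by auto
    have "h ?X = connected_component_set (- drawn A) x"
      using uniq[OF inc[OF nx(1)], of "connected_component_set (- drawn A) x" x] nx xx
      by (simp add: faces_def components_def drawn_insert)
    moreover have "h ?Y = connected_component_set (- drawn A) y"
      using uniq[OF inc[OF nx(2)], of "connected_component_set (- drawn A) y" y] nx xx
      by (simp add: faces_def components_def drawn_insert)
    moreover have "connected_component (- drawn A) x y"
      unfolding connected_component_def using r x y by (intro exI[of _ "ball z r"]) auto
    ultimately have "h ?X = h ?Y" by (metis connected_component_eq mem_Collect_eq)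
    moreover have "?X \<noteq> ?Y"
    proof
      assume "?X = ?Y"
      then have "y \<in> ?X" using xx by simp
      then obtain T where T: "connected T" "T \<subseteq> - drawn (insert e A)" "x \<in> T" "y \<in> T"
        by (auto simp: connected_component_def)
      have "T \<inter> path_image c = {}" using T(2) c(3,4) by (auto simp: drawn_insert)
      then have "T \<inter> frontier (inside (path_image c)) = {}" using J by simp
      moreover have "T \<inter> inside (path_image c) \<noteq> {}" "T - inside (path_image c) \<noteq> {}"
        using T x y inside_Int_outside[of "path_image c"] by blast+
      ultimately show False using connected_Int_frontier[OF T(1)] by blast
    qed
    ultimately show ?thesis using inc[OF nx(1)] inc[OF nx(2)] by (auto simp: inj_on_def)
  qed
  then show ?thesis using card_less_of_surj_not_inj[OF fin surj] by blast
qed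

text \<open>
  Removing \<open>e\<close> merges all faces that have \<open>e\<close> on their boundary.
\<close>
lemma connected_boundary_points:
  assumes A: "A \<subseteq> E" and e: "e \<in> E" "e \<notin> A"
    and U: "U \<in> faces (insert e A)" "e \<in> boundary (insert e A) U" "x \<in> U"
    and W: "W \<in> faces (insert e A)" "e \<in> boundary (insert e A) W" "y \<in> W"
  shows "connected_component (- drawn A) x y"
proof -
  have iA: "insert e A \<subseteq> E" using A e by auto
  have *: "connected (U \<union> inner e) \<and> U \<union> inner e \<subseteq> - drawn A"
    if U: "U \<in> faces (insert e A)" "e \<in> boundary (insert e A) U" for U
  proof
    note b = face_basics[OF iA U(1)]
    obtain z where z: "z \<in> closure U" "z \<in> inner e" using U(2) by (auto simp: boundary_def)
    have "connected (insert z U)"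
      using connected_intermediate_closure[OF b(2), of "insert z U"] z closure_subset by blast
    then have "connected (insert z U \<union> inner e)"
      using connected_inner[OF e(1)] z by (intro connected_Un) auto
    moreover have "insert z U \<union> inner e = U \<union> inner e" using z by auto
    ultimately show "connected (U \<union> inner e)" by simp
    show "U \<union> inner e \<subseteq> - drawn A"
      using b(4) inner_disjoint[OF A e] by (auto simp: drawn_insert)
  qed
  have "connected ((U \<union> inner e) \<union> (W \<union> inner e))"
    using *[OF U(1,2)] *[OF W(1,2)] inner_nonempty[OF e(1)] by (intro connected_Un[of "U \<union> inner e" "W \<union> inner e"]) auto
  then show ?thesis unfolding connected_component_def
    using *[OF U(1,2)] *[OF W(1,2)] U(3) W(3) by (intro exI[of _ "(U \<union> inner e) \<union> (W \<union> inner e)"]) auto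
qed

text \<open>
  If \<open>e\<close> is a bridge, removing it merges the faces at \<open>e\<close> but separates nothing when it is put
  back, so there is only one such face. Otherwise \<open>e\<close> lies on a Jordan curve, two of the three
  faces are on the same side of it, and Janiszewski's theorem shows that these two coincide.
\<close>
lemma no_three_faces_at_edge:
  assumes A: "A \<subseteq> E" and e: "e \<in> A"
    and U: "U1 \<in> faces A" "U2 \<in> faces A" "U3 \<in> faces A"
    and ne: "U1 \<noteq> U2" "U1 \<noteq> U3" "U2 \<noteq> U3"
    and bd: "e \<in> boundary A U1" "e \<in> boundary A U2" "e \<in> boundary A U3"
  shows False
proof -
  define B where "B = A - {e}"
  have B: "B \<subseteq> E" "e \<notin> B" "A = insert e B" and eE: "e \<in> E" using A e by (auto simp: B_def)
  obtain u v where uv: "e = {u, v}" using edge[OF eE] by blast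
  have pts: "\<exists>x. x \<in> U \<and> x \<notin> drawn A" if "U \<in> faces A" for U
    using face_basics[OF A that] by blast
  show False
  proof (cases "path_component (drawn B) (p u) (p v)")
    case False
    obtain x y where x: "x \<in> U1" "x \<notin> drawn A" and y: "y \<in> U2" "y \<notin> drawn A" using pts U by blast
    have "connected_component (- drawn B) x y"
      using connected_boundary_points[OF B(1) eE B(2)] U bd x y B(3) by blast
    then have "connected_component (- drawn A) x y"
      using connected_component_bridge[OF B(1) eE B(2) uv False] x y B(3) by (auto simp: drawn_insert)
    then show False using face_eqI[OF U(1,2)] x y ne by blast
  next
    case True
    obtain c Q where c: "simple_path c" "pathfinish c = pathstart c"
      "path_image c = path_image (\<gamma> e) \<union> Q" "Q \<subseteq> drawn B" "connected Q" "p ` e \<subseteq> Q"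
      by (rule cycle_through_edge[OF B(1) eE B(2) uv True])
    note J = Jordan_inside_outside[OF c(1,2)]
    let ?C = "path_image c"
    (* The curve and the other arcs meet in the connected set Q. *)
    have same: "U = W" if UW: "U \<in> faces A" "W \<in> faces A" "e \<in> boundary A U" "e \<in> boundary A W"
      and side: "S = inside ?C \<or> S = outside ?C" "U \<inter> S \<noteq> {}" "W \<inter> S \<noteq> {}" for U W S
    proof -
      obtain x y where x: "x \<in> U" "x \<in> S" and y: "y \<in> W" "y \<in> S" using side by blast
      have "connected S" "S \<subseteq> - ?C"
        using side(1) J inside_no_overlap[of ?C] outside_no_overlap[of ?C] by blast+
      then have 1: "connected_component (- ?C) x y"
        unfolding connected_component_def using x y by (intro exI[of _ S]) auto
      have 2: "connected_component (- drawn B) x y"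
        using connected_boundary_points[OF B(1) eE B(2)] UW x y B(3) by blast
      have "?C \<inter> drawn B = Q"
        using c(3,4,6) image_Int_drawn[OF B(1) eE B(2)] by blast
      then have "connected_component (- (?C \<union> drawn B)) x y"
        using c(5) closed_drawn[OF B(1)] compact_simple_path_image[OF c(1)]
        by (intro Janiszewski[OF _ _ _ 1 2]) simp_all
      moreover have "?C \<union> drawn B = drawn A" using c(3,4) B(3) by (auto simp: drawn_insert)
      ultimately show ?thesis using face_eqI[OF UW(1,2) x(1) y(1)] by simp
    qed
    have some_side: "U \<inter> inside ?C \<noteq> {} \<or> U \<inter> outside ?C \<noteq> {}" if "U \<in> faces A" for U
    proof -
      obtain x where "x \<in> U" "x \<notin> drawn A" using pts[OF \<open>U \<in> faces A\<close>] by blast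
      moreover have "?C \<subseteq> drawn A" using c(3,4) B(3) by (auto simp: drawn_insert)
      ultimately have "x \<in> U" "x \<in> inside ?C \<union> outside ?C" by (auto simp: inside_Un_outside)
      then show ?thesis by blast
    qed
    have side: "U1 \<inter> inside ?C \<noteq> {} \<or> U1 \<inter> outside ?C \<noteq> {}"
      "U2 \<inter> inside ?C \<noteq> {} \<or> U2 \<inter> outside ?C \<noteq> {}"
      "U3 \<inter> inside ?C \<noteq> {} \<or> U3 \<inter> outside ?C \<noteq> {}"
      by (rule some_side[OF U(1)], rule some_side[OF U(2)], rule some_side[OF U(3)])
    have diff: "U1 \<inter> S = {} \<or> U2 \<inter> S = {}" "U1 \<inter> S = {} \<or> U3 \<inter> S = {}" "U2 \<inter> S = {} \<or> U3 \<inter> S = {}"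
      if "S = inside ?C \<or> S = outside ?C" for S
      using same[OF U(1,2) bd(1,2) that] same[OF U(1,3) bd(1,3) that] same[OF U(2,3) bd(2,3) that] ne by argo+
    show False
      using side diff[of "inside ?C"] diff[of "outside ?C"] by argo
  qed
qed

lemma faces_at_edge:
  assumes "A \<subseteq> E" "e \<in> A"
  shows "finite {U\<in>faces A. e \<in> boundary A U}" "card {U\<in>faces A. e \<in> boundary A U} \<le> 2"
proof -
  let ?S = "{U\<in>faces A. e \<in> boundary A U}"
  have *: False if T: "T \<subseteq> ?S" "card T = 3" for T
  proof -
    obtain U1 U2 U3 where "T = {U1, U2, U3}" "U1 \<noteq> U2" "U1 \<noteq> U3" "U2 \<noteq> U3"
      using T(2) by (auto simp: card_3_iff)
    then show False using no_three_faces_at_edge[OF assms, of U1 U2 U3] T(1) by blast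
  qed
  show "finite ?S" using * infinite_arbitrarily_large[of ?S 3] by blast
  show "card ?S \<le> 2"
  proof (rule ccontr)
    assume "\<not> card ?S \<le> 2"
    then have "3 \<le> card ?S" by simp
    then show False using * obtain_subset_with_card_n[of 3 ?S] by metis
  qed
qed

text \<open>
  A smallest separating set of edges has no bridge, because removing a bridge leaves it separating.
\<close>
lemma separating_contains_bridgeless:
  assumes A: "A \<subseteq> E" and sep: "\<not> connected (- drawn A)"
  obtains Y where "Y \<subseteq> A" "Y \<noteq> {}"
    "\<And>e u v. \<lbrakk>e \<in> Y; e = {u, v}\<rbrakk> \<Longrightarrow> path_component (drawn (Y - {e})) (p u) (p v)"
proof -
  let ?P = "\<lambda>Y. Y \<subseteq> A \<and> \<not> connected (- drawn Y)"
  obtain Y where Y: "?P Y" and min: "\<And>Z. ?P Z \<Longrightarrow> card Y \<le> card Z"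
    using ex_has_least_nat[of ?P A card] sep by blast
  have finY: "finite Y" using Y A finite_sub by blast
  show thesis
  proof (rule that[of Y])
    show "Y \<noteq> {}" using Y by (auto simp: drawn_def)
    fix e u v assume e: "e \<in> Y" "e = {u, v}"
    show "path_component (drawn (Y - {e})) (p u) (p v)"
    proof (rule ccontr)
      assume br: "\<not> path_component (drawn (Y - {e})) (p u) (p v)"
      have "card (Y - {e}) < card Y" using finY e by (meson card_Diff1_less)
      then have "connected (- drawn (Y - {e}))" using min[of "Y - {e}"] Y by force
      then have cc: "connected_component (- drawn (Y - {e})) x y" if "x \<in> - drawn Y" "y \<in> - drawn Y" for x y
        using that drawn_mono[of "Y - {e}" Y] by (auto simp: connected_iff_connected_component)
      have eE: "e \<in> E" "Y - {e} \<subseteq> E" "insert e (Y - {e}) = Y" using e Y A by auto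
      have "connected (- drawn Y)"
        unfolding connected_iff_connected_component
      proof (intro ballI)
        fix x y assume xy: "x \<in> - drawn Y" "y \<in> - drawn Y"
        show "connected_component (- drawn Y) x y"
          using connected_component_bridge[OF eE(2,1) _ e(2) br cc[OF xy]] xy e(1)
          unfolding eE(3) by (auto simp: drawn_def)
      qed
      then show False using Y by blast
    qed
  qed (use Y in blast)
qed

text \<open>
  Without bridges, each end of an edge is touched by a second edge.
\<close>
lemma separating_degrees:
  assumes A: "A \<subseteq> E" and sep: "\<not> connected (- drawn A)"
  obtains Y where "Y \<subseteq> A" "Y \<noteq> {}" "\<And>e u. \<lbrakk>e \<in> Y; u \<in> e\<rbrakk> \<Longrightarrow> \<exists>e'\<in>Y. e' \<noteq> e \<and> u \<in> e'"
proof -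
  obtain Y where Y: "Y \<subseteq> A" "Y \<noteq> {}"
    "\<And>e u v. \<lbrakk>e \<in> Y; e = {u, v}\<rbrakk> \<Longrightarrow> path_component (drawn (Y - {e})) (p u) (p v)"
    using separating_contains_bridgeless[OF A sep] by metis
  have deg: "\<exists>e'\<in>Y. e' \<noteq> e \<and> u \<in> e'" if e: "e \<in> Y" "u \<in> e" for e u
  proof -
    obtain v where v: "e = {u, v}" "u \<in> V" using edge[of e] e Y A by blast
    have "p u \<in> drawn (Y - {e})" using Y(3)[OF e(1) v(1)] path_component_mem by blast
    then obtain e' where "e' \<in> Y - {e}" "u \<in> e'" using vertex_in_drawn[of "Y - {e}" u] v Y(1) A by blast
    then show ?thesis by blast
  qed
  show thesis by (rule that[OF Y(1,2) deg])
qed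

text \<open>
  A graph with minimum degree two has at least three edges, and with exactly three it is a triangle.
  Applied to face boundaries, this replaces the statement that faces are bounded by cycles.
\<close>
lemma separating_ge_3:
  assumes A: "A \<subseteq> E" and sep: "\<not> connected (- drawn A)"
  shows "card A \<ge> 3"
    and "card A = 3 \<Longrightarrow> \<exists>a b c. a \<noteq> b \<and> b \<noteq> c \<and> a \<noteq> c \<and> A = {{a, b}, {b, c}, {a, c}}"
proof -
  obtain Y where Y: "Y \<subseteq> A" "Y \<noteq> {}" "\<And>e u. \<lbrakk>e \<in> Y; u \<in> e\<rbrakk> \<Longrightarrow> \<exists>e'\<in>Y. e' \<noteq> e \<and> u \<in> e'"
    using separating_degrees[OF A sep] by metis
  have two: "\<exists>x\<in>V. \<exists>y\<in>V. x \<noteq> y \<and> e = {x, y}" if "e \<in> Y" for e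
  proof -
    have "e \<in> E" using that Y(1) A by blast
    then show ?thesis by (rule edge)
  qed
  obtain e where e: "e \<in> Y" using Y by blast
  obtain a b where ab: "{a, b} \<in> Y" "a \<noteq> b" using two[OF e] e by blast
  have other: "\<exists>d. {x, d} \<in> Y \<and> d \<noteq> x \<and> d \<noteq> y" if xy: "{x, y} \<in> Y" for x y
  proof -
    obtain e' where e': "e' \<in> Y" "e' \<noteq> {x, y}" "x \<in> e'" using Y(3)[OF xy, of x] by blast
    obtain s t where st: "s \<noteq> t" "e' = {s, t}" using two[OF e'(1)] by blast
    define d where "d = (if s = x then t else s)"
    have d: "e' = {x, d}" "d \<noteq> x" using e'(3) st by (auto simp: d_def)
    then have "d \<noteq> y" using e'(2) by auto
    then show ?thesis using e'(1) d by blast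
  qed
  obtain c where c: "{a, c} \<in> Y" "c \<noteq> b" "c \<noteq> a" using other[OF ab(1)] by blast
  obtain d where d: "{b, d} \<in> Y" "d \<noteq> b" "d \<noteq> a" using other[of b a] ab(1) by (auto simp: insert_commute)
  let ?T = "{{a, b}, {a, c}, {b, d}}"
  have T: "card ?T = 3" "?T \<subseteq> A" using ab c d Y by (auto simp: card_3_iff doubleton_eq_iff)
  have finA: "finite A" using A finite_sub by blast
  then show "card A \<ge> 3" using T card_mono by metis
  show "\<exists>a b c. a \<noteq> b \<and> b \<noteq> c \<and> a \<noteq> c \<and> A = {{a, b}, {b, c}, {a, c}}" if "card A = 3"
  proof -
    have A3: "A = ?T" using T that finA card_subset_eq by metis
    have "c = d" using Y(1) Y(3)[OF c(1), of c] ab c d unfolding A3 by (auto simp: doubleton_eq_iff)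
    then show ?thesis using A3 ab c by (intro exI[of _ a] exI[of _ b] exI[of _ c]) auto
  qed
qed

text \<open>
  Every frontier point of a face is an inner point of a boundary edge or a vertex. Hence the
  boundary edges and the vertices together separate the face from any other face, and the finitely
  many vertices do not matter for separation.
\<close>
lemma boundary_separates:
  assumes A: "A \<subseteq> E" and U: "U \<in> faces A" and W: "W \<in> faces A" "W \<noteq> U"
  shows "\<not> connected (- drawn (boundary A U))"
proof
  assume con: "connected (- drawn (boundary A U))"
  let ?B = "boundary A U"
  have B: "?B \<subseteq> E" using A by (auto simp: boundary_def)
  note bU = face_basics[OF A U] and bW = face_basics[OF A W(1)]
  have fr: "frontier U \<subseteq> drawn ?B \<union> p ` V"
  proof
    fix z assume z: "z \<in> frontier U"
    have "z \<in> drawn A"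
    proof (rule ccontr)
      assume "z \<notin> drawn A"
      moreover have "frontier U \<subseteq> frontier (- drawn A)"
        using frontier_of_components_subset U unfolding faces_def by blast
      moreover have "frontier (- drawn A) \<subseteq> drawn A"
        using frontier_subset_closed[OF closed_drawn[OF A]] by (simp add: frontier_complement)
      ultimately show False using z by blast
    qed
    then obtain e where e: "e \<in> A" "z \<in> path_image (\<gamma> e)" by (auto simp: drawn_def)
    then show "z \<in> drawn ?B \<union> p ` V"
    proof (cases "z \<in> p ` e")
      case True
      moreover have "e \<subseteq> V" using edge[of e] e A by auto
      ultimately show ?thesis by blast
    next
      case False
      then have "e \<in> ?B" using e z by (auto simp: boundary_def inner_def frontier_def)
      then show ?thesis using e by (auto simp: drawn_def)
    qed
  qed
  let ?R = "- drawn ?B - p ` V"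
  have R: "connected ?R"
    using con closed_drawn[OF B] finite_V by (intro connected_open_delete_finite) (auto simp: open_Compl)
  have fin: "finite (p ` V)" using finite_V by simp
  have off: "\<exists>x. x \<in> S \<and> x \<notin> p ` V" if "open S" "S \<noteq> {}" for S :: "complex set"
    using that fin finite_subset[of S "p ` V"] empty_interior_finite[of S] interior_open[of S] by fastforce
  have "drawn ?B \<subseteq> drawn A" by (intro drawn_mono) (auto simp: boundary_def)
  then have "?R \<inter> U \<noteq> {}" "?R - U \<noteq> {}"
  proof -
    assume sub: "drawn ?B \<subseteq> drawn A"
    show "?R \<inter> U \<noteq> {}" using off[OF bU(1,3)] bU(4) sub by blast
    have "W \<inter> U = {}" using U W unfolding faces_def by (metis components_nonoverlap)
    then show "?R - U \<noteq> {}" using off[OF bW(1,3)] bW(4) sub by blast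
  qed
  then have "?R \<inter> frontier U \<noteq> {}" using connected_Int_frontier[OF R] by blast
  then show False using fr by blast
qed

lemma finite_boundary: "A \<subseteq> E \<Longrightarrow> finite (boundary A U)"
  using finite_sub by (auto simp: boundary_def)

text \<open>
  If there is more than one face, every face has a boundary edge, and an edge serves at most two.
\<close>
lemma finite_faces:
  assumes A: "A \<subseteq> E"
  shows "finite (faces A)"
proof (cases "\<exists>U\<in>faces A. \<exists>W\<in>faces A. W \<noteq> U")
  case False
  then have "\<exists>U. faces A \<subseteq> {U}" by blast
  then show ?thesis using finite_subset by fastforce
next
  case True
  have "\<exists>e\<in>A. e \<in> boundary A U" if U: "U \<in> faces A" for U
  proof -
    obtain W where W: "W \<in> faces A" "W \<noteq> U" using True by metis
    have "card (boundary A U) \<ge> 3"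
      using separating_ge_3(1)[OF _ boundary_separates[OF A U W]] A by (auto simp: boundary_def)
    then have "boundary A U \<noteq> {}" by auto
    then show ?thesis by (auto simp: boundary_def)
  qed
  then have "faces A \<subseteq> (\<Union>e\<in>A. {U\<in>faces A. e \<in> boundary A U})" by blast
  then show ?thesis using faces_at_edge(1)[OF A] finite_sub[OF A] finite_subset by (metis (no_types, lifting) finite_UN)
qed

lemma faces_nonempty: "A \<subseteq> E \<Longrightarrow> faces A \<noteq> {}"
  using compact_drawn not_compact_UNIV unfolding faces_def
  by (metis components_eq_empty compl_bot_eq double_complement)

lemma connected_imp_one_face: "A \<subseteq> E \<Longrightarrow> connected (- drawn A) \<Longrightarrow> card (faces A) = 1"
  using faces_nonempty[of A] components_eq_sing_iff[of "- drawn A"] by (auto simp: faces_def)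

text \<open>
  The vertices in the same connected piece of the drawing as \<open>u\<close>; the equation \<open>u = w\<close> takes care of
  vertices that no edge of \<open>A\<close> touches.
\<close>
definition linked :: "'a set set \<Rightarrow> 'a \<Rightarrow> 'a set" where
  "linked A u = {w\<in>V. u = w \<or> path_component (drawn A) (p u) (p w)}"

text \<open>
  A non-separating set of edges is a forest: an edge closing a cycle would create a second face.
  So each of its edges, when added to some of the others, merges two connected pieces.
\<close>
lemma card_nonseparating:
  assumes A: "A \<subseteq> E" and con: "connected (- drawn A)" and V: "V \<noteq> {}"
  shows "card A + 1 \<le> card V"
proof -
  have bridge: "\<not> path_component (drawn B) (p u) (p v)"
    if B: "B \<subseteq> A" and e: "e \<in> A" "e \<notin> B" "e = {u, v}" for B e u v
  proof
    assume pcB: "path_component (drawn B) (p u) (p v)"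
    have "B \<subseteq> A - {e}" using B e(2) by auto
    then have pc: "path_component (drawn (A - {e})) (p u) (p v)"
      using path_component_of_subset[OF drawn_mono pcB] by blast
    have "insert e (A - {e}) = A" using e by auto
    then have "card (faces (A - {e})) < card (faces A)"
      using more_faces_if_cycle[of "A - {e}" e u v] pc A e finite_faces[OF A] by auto
    moreover have "card (faces (A - {e})) > 0"
      using faces_nonempty[of "A - {e}"] finite_faces[of "A - {e}"] A by (auto simp: card_gt_0_iff)
    ultimately show False using connected_imp_one_face[OF A con] by simp
  qed
  have sub: "linked B u \<subseteq> linked B' u" if "B \<subseteq> B'" for B B' u
    using path_component_of_subset[OF drawn_mono[OF that]] unfolding linked_def by blast
  have eqv: "linked B u = linked B w" if "w \<in> linked B u" for B u w
    using that path_component_sym path_component_trans unfolding linked_def by blast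
  have "finite B \<Longrightarrow> B \<subseteq> A \<Longrightarrow> card B + card (linked B ` V) \<le> card V" for B
  proof (induction B rule: finite_induct)
    case empty
    show ?case using card_image_le[OF finite_V] by simp
  next
    case (insert e B)
    have e: "e \<in> E" "insert e B \<subseteq> E" using insert A by auto
    obtain u v where uv: "u \<in> V" "v \<in> V" "e = {u, v}" using edge[OF e(1)] by blast
    let ?B = "insert e B"
    (* The classes after adding e are unions of the classes before. *)
    define h where "h N = linked ?B (SOME w. w \<in> N)" for N
    have h: "h (linked B w) = linked ?B w" if "w \<in> V" for w
    proof -
      have "w \<in> linked B w" using that by (simp add: linked_def)
      then have "(SOME x. x \<in> linked B w) \<in> linked B w" by (rule someI)
      then show ?thesis unfolding h_def using eqv[of _ ?B w] sub[of B ?B w] by blast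
    qed
    have surj: "h ` (linked B ` V) = linked ?B ` V" using h by (force simp: image_image)
    have "path_component (path_image (\<gamma> e)) (p u) (p v)"
      using ends_in_image[OF e(1)] arc_edge[OF e(1)] uv(3)
      by (metis arc_imp_path image_eqI insertI1 insertI2 path_connected_component path_connected_path_image subsetD)
    then have "path_component (drawn ?B) (p u) (p v)"
      by (elim path_component_of_subset[rotated]) (auto simp: drawn_insert)
    then have "linked ?B u = linked ?B v" using eqv uv by (simp add: linked_def)
    moreover have "linked B u \<noteq> linked B v"
    proof
      assume "linked B u = linked B v"
      then have "v \<in> linked B u" using uv by (simp add: linked_def)
      moreover have "u \<noteq> v" using edge[OF e(1)] uv(3) by auto
      ultimately show False using bridge[of B e u v] insert uv by (auto simp: linked_def)
    qed
    ultimately have "\<not> inj_on h (linked B ` V)" using h uv by (metis image_eqI inj_onD)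
    then have "card (linked ?B ` V) < card (linked B ` V)"
      using card_less_of_surj_not_inj[OF _ surj] finite_V by blast
    then show ?case using insert by auto
  qed
  moreover have "card (linked A ` V) \<ge> 1" using V finite_V by (simp add: Suc_leI card_gt_0_iff)
  ultimately show ?thesis using finite_sub[OF A] by fastforce
qed

text \<open>
  Take a largest non-separating set \<open>A\<close> of edges. It has fewer edges than there are vertices, and by
  maximality and \<open>connected_component_bridge\<close> each of the remaining edges has its ends connected in
  the drawing of \<open>A\<close>, so that it adds a face.
\<close>
lemma Euler_inequality:
  assumes V: "V \<noteq> {}"
  shows "card E + 2 \<le> card V + card (faces E)"
proof -
  let ?P = "\<lambda>A. A \<subseteq> E \<and> connected (- drawn A)"
  have P0: "?P {}" by (auto simp: drawn_def)
  have "\<forall>A. ?P A \<longrightarrow> card A < Suc (card E)" using card_mono[OF finite_E] by (simp add: less_Suc_eq_le)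
  from ex_has_greatest_nat[OF P0 this]
  obtain A where A: "?P A" and max: "\<And>B. ?P B \<Longrightarrow> card B \<le> card A" by blast
  have finA: "finite A" using A finite_sub by blast
  have cyc: "path_component (drawn A) (p u) (p v)" if e: "e \<in> E" "e \<notin> A" "e = {u, v}" for e u v
  proof (rule ccontr)
    assume br: "\<not> path_component (drawn A) (p u) (p v)"
    have "connected (- drawn (insert e A))"
      unfolding connected_iff_connected_component
    proof (intro ballI)
      fix x y assume xy: "x \<in> - drawn (insert e A)" "y \<in> - drawn (insert e A)"
      then have "connected_component (- drawn A) x y"
        using A by (auto simp: drawn_insert connected_iff_connected_component)
      then show "connected_component (- drawn (insert e A)) x y"
        using connected_component_bridge[of A e u v x y] e A br xy by (auto simp: drawn_insert)
    qed
    then show False using max[of "insert e A"] e A finA by simp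
  qed
  have "finite B \<Longrightarrow> B \<subseteq> E - A \<Longrightarrow> card (faces (A \<union> B)) \<ge> card B + 1" for B
  proof (induction B rule: finite_induct)
    case empty
    then show ?case using connected_imp_one_face A by simp
  next
    case (insert e B)
    have e: "e \<in> E" "e \<notin> A" using insert by auto
    obtain u v where uv: "e = {u, v}" using edge[OF e(1)] by blast
    have "path_component (drawn (A \<union> B)) (p u) (p v)"
      using cyc[OF e uv] path_component_of_subset[OF drawn_mono[of A "A \<union> B"]] by blast
    then have "card (faces (A \<union> B)) < card (faces (insert e (A \<union> B)))"
      using more_faces_if_cycle[of "A \<union> B" e u v] e uv insert A finite_faces[of "insert e (A \<union> B)"] by auto
    then show ?case using insert by simp
  qed
  from this[of "E - A"] have "card (faces E) \<ge> card (E - A) + 1"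
    using finite_E A by (simp add: Un_absorb1)
  moreover have "card (E - A) = card E - card A" "card A \<le> card E"
    using A finA finite_E card_Diff_subset card_mono by blast+
  moreover have "card A + 1 \<le> card V" using card_nonseparating A V by blast
  ultimately show ?thesis by linarith
qed

end

section \<open>Edge-disjoint triangles in plane graphs\<close>

definition triangle :: "'a set set \<Rightarrow> 'a set \<Rightarrow> bool" where
  "triangle E t \<longleftrightarrow> (\<exists>a b c. a \<noteq> b \<and> b \<noteq> c \<and> a \<noteq> c \<and> t = {a, b, c} \<and>
     {a, b} \<in> E \<and> {b, c} \<in> E \<and> {a, c} \<in> E)"

context drawing begin

text \<open>
  The boundaries of \<open>F\<close> faces of which \<open>s\<close> are triangular contain at least \<open>4F - s\<close> edges, counted
  with multiplicity at most two; with \<open>F \<ge> m - n + 2\<close> this gives \<open>2m \<le> 4n - 8 + s\<close>. A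
  maximal set of triangular faces without common boundary edges contains at least \<open>s/4\<close> of them.
  With at most one face the graph is a forest and needs no triangle.
\<close>
lemma triangle_packing:
  assumes V: "card V \<ge> 3"
  shows "\<exists>T. finite T \<and> (\<forall>t\<in>T. triangle E t) \<and>
    (\<forall>t\<in>T. \<forall>t'\<in>T. \<forall>e\<in>E. e \<subseteq> t \<longrightarrow> e \<subseteq> t' \<longrightarrow> t = t') \<and>
    card E + 4 \<le> 2 * card V + 2 * card T"
proof -
  have V0: "V \<noteq> {}" using V by auto
  note Eu = Euler_inequality[OF V0]
  let ?F = "faces E" and ?bd = "boundary E"
  have finF: "finite ?F" using finite_faces by blast
  show ?thesis
  proof (cases "card ?F \<le> 1")
    case True
    then show ?thesis using Eu V by (intro exI[of _ "{}"]) simp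
  next
    case False
    have sep: "\<not> connected (- drawn (?bd U))" if U: "U \<in> ?F" for U
    proof -
      obtain W where "W \<in> ?F" "W \<noteq> U" using False finF U card_le_Suc0_iff_eq[of ?F] by auto
      then show ?thesis using boundary_separates U by blast
    qed
    have bdE: "?bd U \<subseteq> E" for U by (auto simp: boundary_def)
    have fin_bd: "finite (?bd U)" for U using finite_boundary by blast
    have ge3: "card (?bd U) \<ge> 3" if "U \<in> ?F" for U using separating_ge_3(1)[OF bdE sep[OF that]] .
    define Tri where "Tri = {U\<in>?F. card (?bd U) = 3}"
    have finTri: "finite Tri" using finF by (simp add: Tri_def)
    have "(\<Sum>U\<in>?F. card (?bd U)) = (\<Sum>U\<in>?F. \<Sum>e\<in>E. if e \<in> ?bd U then 1 else 0)"
      using finite_E bdE by (intro sum.cong refl) (simp add: sum.If_cases Int_absorb1)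
    also have "\<dots> = (\<Sum>e\<in>E. \<Sum>U\<in>?F. if e \<in> ?bd U then 1 else 0)" by (rule sum.swap)
    also have "\<dots> = (\<Sum>e\<in>E. card {U\<in>?F. e \<in> ?bd U})"
      using finF by (intro sum.cong refl) (simp add: sum.If_cases Collect_conj_eq)
    also have "\<dots> \<le> (\<Sum>e\<in>E. 2)" by (intro sum_mono faces_at_edge) auto
    finally have inc: "(\<Sum>U\<in>?F. card (?bd U)) \<le> 2 * card E" by simp
    have "4 * card ?F = (\<Sum>U\<in>?F. 4)" by simp
    also have "\<dots> \<le> (\<Sum>U\<in>?F. card (?bd U) + (if U \<in> Tri then 1 else 0))"
    proof (intro sum_mono)
      fix U assume "U \<in> ?F"
      then show "4 \<le> card (?bd U) + (if U \<in> Tri then 1 else 0)" using ge3[of U] by (auto simp: Tri_def)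
    qed
    also have "\<dots> = (\<Sum>U\<in>?F. card (?bd U)) + card Tri"
      using finF by (simp add: sum.distrib sum.If_cases Tri_def Collect_conj_eq)
    finally have count: "4 * card ?F \<le> 2 * card E + card Tri" using inc by linarith
    let ?P = "\<lambda>M. M \<subseteq> Tri \<and> (\<forall>U\<in>M. \<forall>W\<in>M. U \<noteq> W \<longrightarrow> ?bd U \<inter> ?bd W = {})"
    have P0: "?P {}" by simp
    have "\<forall>N. ?P N \<longrightarrow> card N < Suc (card Tri)" using card_mono[OF finTri] by (simp add: less_Suc_eq_le)
    from ex_has_greatest_nat[OF P0 this]
    obtain M where "?P M \<and> (\<forall>N. ?P N \<longrightarrow> card N \<le> card M)" by (rule exE)
    then have M: "?P M" and max: "\<And>N. ?P N \<Longrightarrow> card N \<le> card M" by simp_all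
    have finM: "finite M" by (rule finite_subset[OF conjunct1[OF M] finTri])
    have MF: "M \<subseteq> ?F" using M by (auto simp: Tri_def)
    (* Each of the three edges of a chosen face borders at most one other face. *)
    have cover: "Tri \<subseteq> M \<union> (\<Union>U\<in>M. \<Union>e\<in>?bd U. {W\<in>?F. e \<in> ?bd W} - {U})"
    proof
      fix W assume W: "W \<in> Tri"
      show "W \<in> M \<union> (\<Union>U\<in>M. \<Union>e\<in>?bd U. {W\<in>?F. e \<in> ?bd W} - {U})"
      proof (cases "W \<in> M")
        case False
        have "\<exists>U\<in>M. ?bd U \<inter> ?bd W \<noteq> {}"
        proof (rule ccontr)
          assume "\<not> (\<exists>U\<in>M. ?bd U \<inter> ?bd W \<noteq> {})"
          then have apart: "\<forall>U\<in>M. ?bd U \<inter> ?bd W = {} \<and> ?bd W \<inter> ?bd U = {}" by auto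
          have "?P (insert W M)" using M W apart by simp
          then show False using max[of "insert W M"] False finM by simp
        qed
        then show ?thesis using False W by (auto simp: Tri_def)
      qed simp
    qed
    have one: "card ({W\<in>?F. e \<in> ?bd W} - {U}) \<le> 1" if "U \<in> M" "e \<in> ?bd U" for U e
    proof -
      have "U \<in> {W\<in>?F. e \<in> ?bd W}" using that MF by auto
      moreover have "e \<in> E" using that bdE by blast
      ultimately show ?thesis using faces_at_edge[of E e] by (simp add: card_Diff_singleton)
    qed
    have "card Tri \<le> card (M \<union> (\<Union>U\<in>M. \<Union>e\<in>?bd U. {W\<in>?F. e \<in> ?bd W} - {U}))"
      using cover finM finF fin_bd by (intro card_mono) auto
    also have "\<dots> \<le> card M + card (\<Union>U\<in>M. \<Union>e\<in>?bd U. {W\<in>?F. e \<in> ?bd W} - {U})" by (rule card_Un_le)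
    also have "card (\<Union>U\<in>M. \<Union>e\<in>?bd U. {W\<in>?F. e \<in> ?bd W} - {U})
        \<le> (\<Sum>U\<in>M. card (\<Union>e\<in>?bd U. {W\<in>?F. e \<in> ?bd W} - {U}))" by (rule card_UN_le[OF finM])
    also have "\<dots> \<le> (\<Sum>U\<in>M. 3)"
    proof (intro sum_mono)
      fix U assume U: "U \<in> M"
      have "card (\<Union>e\<in>?bd U. {W\<in>?F. e \<in> ?bd W} - {U}) \<le> (\<Sum>e\<in>?bd U. card ({W\<in>?F. e \<in> ?bd W} - {U}))"
        by (rule card_UN_le[OF fin_bd])
      also have "\<dots> \<le> (\<Sum>e\<in>?bd U. 1)" using one U by (intro sum_mono) blast
      also have "\<dots> = 3" using M U by (auto simp: Tri_def)
      finally show "card (\<Union>e\<in>?bd U. {W\<in>?F. e \<in> ?bd W} - {U}) \<le> 3" .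
    qed
    finally have four: "card Tri \<le> 4 * card M" by simp
    define t where "t U = \<Union>(?bd U)" for U
    have tri: "triangle E (t U) \<and> (\<forall>e\<in>E. e \<subseteq> t U \<longrightarrow> e \<in> ?bd U)" if U: "U \<in> M" for U
    proof -
      have card3: "card (?bd U) = 3" and UF: "U \<in> ?F" using M U by (auto simp: Tri_def)
      from separating_ge_3(2)[OF bdE sep[OF UF] card3]
      obtain a b c where abc: "a \<noteq> b" "b \<noteq> c" "a \<noteq> c" "?bd U = {{a, b}, {b, c}, {a, c}}"
        by (elim exE conjE)
      then have t: "t U = {a, b, c}" by (auto simp: t_def)
      have "{{a, b}, {b, c}, {a, c}} \<subseteq> E" using bdE[of U] unfolding abc(4) .
      then have "triangle E (t U)" unfolding triangle_def t
        using abc(1-3) by (intro exI[of _ a] exI[of _ b] exI[of _ c]) simp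
      moreover have "e \<in> ?bd U" if e: "e \<in> E" "e \<subseteq> t U" for e
      proof -
        obtain x y where xy: "x \<noteq> y" "e = {x, y}" using edge[OF e(1)] by (elim bexE conjE)
        then have "x \<in> {a, b, c}" "y \<in> {a, b, c}" using e(2) t by auto
        then show ?thesis unfolding abc(4) xy(2) using xy(1) by (auto simp: insert_commute)
      qed
      ultimately show ?thesis by blast
    qed
    have disj: "U = W" if "U \<in> M" "W \<in> M" "e \<in> E" "e \<subseteq> t U" "e \<subseteq> t W" for U W e
    proof -
      have "e \<in> ?bd U \<inter> ?bd W" using tri that by simp
      then show ?thesis using M that(1,2) by auto
    qed
    have inj: "inj_on t M"
    proof (rule inj_onI)
      fix U W assume UW: "U \<in> M" "W \<in> M" "t U = t W"
      obtain e where "e \<in> ?bd U" using ge3[of U] UW MF by fastforce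
      then have "e \<in> E" "e \<subseteq> t U" using bdE[of U] by (auto simp: t_def)
      then show "U = W" using disj[of U W e] UW by auto
    qed
    have fam: "s = s'" if st: "s \<in> t ` M" "s' \<in> t ` M" "e \<in> E" "e \<subseteq> s" "e \<subseteq> s'" for s s' e
    proof -
      obtain U W where "U \<in> M" "W \<in> M" "s = t U" "s' = t W" using st(1,2) by (elim imageE)
      then show ?thesis using disj[of U W e] st by simp
    qed
    show ?thesis
    proof (intro exI[of _ "t ` M"] conjI ballI impI)
      show "triangle E s" if "s \<in> t ` M" for s using tri that by auto
      show "card E + 4 \<le> 2 * card V + 2 * card (t ` M)"
        using Eu count four card_image[OF inj] by linarith
    qed (use finM fam in simp_all)
  qed
qed

end

section \<open>Representations from clique systems\<close>

text \<open>
  Edges of \<open>E\<close> that leave \<open>V\<close> are ignored, so that vertices can be deleted from \<open>V\<close> while \<open>E\<close> is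
  kept.
\<close>
definition represented :: "'a set \<Rightarrow> 'a set set \<Rightarrow> nat \<Rightarrow> bool" where
  "represented V E k \<longleftrightarrow> (\<exists>f :: 'a \<Rightarrow> nat set. (\<forall>v\<in>V. finite (f v)) \<and>
     (\<forall>u\<in>V. \<forall>v\<in>V. u \<noteq> v \<longrightarrow> ({u, v} \<in> E \<longleftrightarrow> overlap (f u) (f v))) \<and>
     card (\<Union>v\<in>V. f v) \<le> k)"

lemma representedI:
  fixes f :: "'a \<Rightarrow> 'b set"
  assumes U: "finite U" "\<And>v. v \<in> V \<Longrightarrow> f v \<subseteq> U" "card U \<le> k"
    and adj: "\<And>u v. \<lbrakk>u \<in> V; v \<in> V; u \<noteq> v; {u, v} \<in> E\<rbrakk> \<Longrightarrow> overlap (f u) (f v)"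
    and nonadj: "\<And>u v. \<lbrakk>u \<in> V; v \<in> V; u \<noteq> v; {u, v} \<notin> E\<rbrakk> \<Longrightarrow> \<not> overlap (f u) (f v)"
  shows "represented V E k"
proof -
  obtain h :: "'b \<Rightarrow> nat" where h: "inj_on h U"
    using finite_imp_inj_to_nat_seg[OF U(1)] by metis
  have "overlap (h ` f u) (h ` f v) \<longleftrightarrow> overlap (f u) (f v)" if "u \<in> V" "v \<in> V" for u v
    using U(2)[OF that(1)] U(2)[OF that(2)] h unfolding overlap_def
    by (metis inj_on_image_Int inj_on_image_subset_iff image_is_empty)
  moreover have "card (\<Union>v\<in>V. h ` f v) \<le> k"
  proof -
    have "card (\<Union>v\<in>V. h ` f v) \<le> card (h ` U)" using U(1,2) by (intro card_mono) auto
    also have "\<dots> \<le> k" using card_image_le[OF U(1), of h] U(3) by linarith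
    finally show ?thesis .
  qed
  moreover have "finite (h ` f v)" if "v \<in> V" for v
    using finite_subset[OF U(2)[OF that] U(1)] by simp
  ultimately show ?thesis unfolding represented_def
    using adj nonadj by (intro exI[of _ "\<lambda>v. h ` f v"]) (simp, blast)
qed

lemma represented_mono: "represented V E k \<Longrightarrow> k \<le> l \<Longrightarrow> represented V E l"
  unfolding represented_def using order_trans by blast

definition induced :: "'a set set \<Rightarrow> 'a set \<Rightarrow> 'a set set" where
  "induced E W = {e\<in>E. e \<subseteq> W}"

definition nbrs :: "'a set set \<Rightarrow> 'a set \<Rightarrow> 'a \<Rightarrow> 'a set" where
  "nbrs E W v = {u\<in>W. {u, v} \<in> E}"

locale sgraph =
  fixes V :: "'a set" and E :: "'a set set"
  assumes finite_V: "finite V"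
    and edge: "e \<in> E \<Longrightarrow> \<exists>u\<in>V. \<exists>v\<in>V. u \<noteq> v \<and> e = {u, v}"
begin

lemma edge_cases:
  assumes "e \<in> E"
  obtains u v where "u \<in> V" "v \<in> V" "u \<noteq> v" "e = {u, v}"
  using edge[OF assms] by (elim bexE conjE)

lemma edgeD: "{u, v} \<in> E \<Longrightarrow> u \<in> V \<and> v \<in> V \<and> u \<noteq> v"
  using edge[of "{u, v}"] by (auto simp: doubleton_eq_iff)

lemma finite_E: "finite E"
proof -
  have "E \<subseteq> Pow V" using edge by fastforce
  then show ?thesis using finite_V by (simp add: finite_subset)
qed

lemma card_edge: "e \<in> E \<Longrightarrow> card e = 2"
  by (erule edge_cases) simp

lemma edge_of_subset:
  assumes "e \<in> E" "x \<in> e" "y \<in> e" "x \<noteq> y"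
  shows "e = {x, y}"
  using assms(1) by (rule edge_cases) (use assms(2-4) in auto)

lemma triangle_clique:
  assumes "triangle E t" "x \<in> t" "y \<in> t" "x \<noteq> y"
  shows "{x, y} \<in> E"
  using assms unfolding triangle_def by (auto simp: insert_commute)

lemma finite_nbrs: "W \<subseteq> V \<Longrightarrow> finite (nbrs E W v)"
  using finite_subset[OF _ finite_V] by (auto simp: nbrs_def)

lemma nbrs_mono: "W \<subseteq> W' \<Longrightarrow> nbrs E W v \<subseteq> nbrs E W' v"
  by (auto simp: nbrs_def)

lemma card_nbrs_mono: "W \<subseteq> W' \<Longrightarrow> W' \<subseteq> V \<Longrightarrow> card (nbrs E W v) \<le> card (nbrs E W' v)"
  using card_mono[OF finite_nbrs nbrs_mono] .

lemma induced_V: "induced E V = E"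
  using edge by (fastforce simp: induced_def)

lemma finite_induced: "finite (induced E W)"
  using finite_E by (simp add: induced_def)

lemma sgraph_induced: "W \<subseteq> V \<Longrightarrow> sgraph W (induced E W)"
proof
  show "W \<subseteq> V \<Longrightarrow> finite W" using finite_V finite_subset by metis
  show "\<exists>u\<in>W. \<exists>v\<in>W. u \<noteq> v \<and> e = {u, v}" if "e \<in> induced E W" for e
  proof -
    have e: "e \<in> E" "e \<subseteq> W" using that by (auto simp: induced_def)
    show ?thesis using e(1) by (rule edge_cases) (use e(2) in auto)
  qed
qed

lemma card_induced_remove:
  assumes W: "W \<subseteq> V" and v: "v \<in> W"
  shows "card (induced E W) = card (induced E (W - {v})) + card (nbrs E W v)"
proof -
  let ?N = "(\<lambda>u. {u, v}) ` nbrs E W v"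
  have "induced E W = induced E (W - {v}) \<union> ?N"
  proof (intro equalityI subsetI)
    fix e assume "e \<in> induced E W"
    then have e: "e \<in> E" "e \<subseteq> W" by (auto simp: induced_def)
    show "e \<in> induced E (W - {v}) \<union> ?N"
    proof (cases "v \<in> e")
      case True
      obtain x y where xy: "x \<noteq> y" "e = {x, y}" using e(1) by (rule edge_cases)
      then have "e = {if x = v then y else x, v}" using True by auto
      then show ?thesis using e by (auto simp: nbrs_def)
    qed (use e in \<open>auto simp: induced_def\<close>)
  qed (use v in \<open>auto simp: induced_def nbrs_def\<close>)
  moreover have "induced E (W - {v}) \<inter> ?N = {}" by (auto simp: induced_def)
  moreover have "card ?N = card (nbrs E W v)"
    by (intro card_image inj_onI) (auto simp: doubleton_eq_iff)
  ultimately show ?thesis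
    using finite_induced finite_nbrs[OF W] by (simp add: card_Un_disjoint)
qed

definition clique_system :: "'a set set \<Rightarrow> bool" where
  "clique_system Q \<longleftrightarrow> finite Q \<and>
     (\<forall>q\<in>Q. q \<noteq> {} \<and> q \<subseteq> V \<and> (\<forall>u\<in>q. \<forall>v\<in>q. u \<noteq> v \<longrightarrow> {u, v} \<in> E)) \<and>
     (\<forall>e\<in>E. \<exists>q\<in>Q. e \<subseteq> q) \<and>
     (\<forall>e\<in>E. \<forall>q\<in>Q. \<forall>q'\<in>Q. e \<subseteq> q \<longrightarrow> e \<subseteq> q' \<longrightarrow> q = q') \<and>
     (\<forall>v\<in>V. \<exists>q\<in>Q. \<exists>q'\<in>Q. v \<in> q \<and> v \<in> q' \<and> q \<noteq> q')"

lemma clique_systemD: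
  assumes "clique_system Q"
  shows "finite Q"
    and "\<And>q. q \<in> Q \<Longrightarrow> q \<noteq> {} \<and> q \<subseteq> V"
    and "\<And>q u v. \<lbrakk>q \<in> Q; u \<in> q; v \<in> q; u \<noteq> v\<rbrakk> \<Longrightarrow> {u, v} \<in> E"
    and "\<And>u v. {u, v} \<in> E \<Longrightarrow> \<exists>q\<in>Q. u \<in> q \<and> v \<in> q"
    and "\<And>q q' u v. \<lbrakk>q \<in> Q; q' \<in> Q; u \<in> q; v \<in> q; u \<in> q'; v \<in> q'; u \<noteq> v\<rbrakk> \<Longrightarrow> q = q'"
    and "\<And>v. v \<in> V \<Longrightarrow> \<exists>q\<in>Q. \<exists>q'\<in>Q. v \<in> q \<and> v \<in> q' \<and> q \<noteq> q'"
proof -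
  note C = assms[unfolded clique_system_def]
  show "finite Q" using C by (elim conjE)
  show cl: "{u, v} \<in> E" if "q \<in> Q" "u \<in> q" "v \<in> q" "u \<noteq> v" for q u v using C that by simp
  show "q \<noteq> {} \<and> q \<subseteq> V" if "q \<in> Q" for q using C that by simp
  show "\<exists>q\<in>Q. u \<in> q \<and> v \<in> q" if "{u, v} \<in> E" for u v
  proof -
    have "\<forall>e\<in>E. \<exists>q\<in>Q. e \<subseteq> q" using C by (elim conjE)
    from bspec[OF this that] show ?thesis by simp
  qed
  show "q = q'" if "q \<in> Q" "q' \<in> Q" "u \<in> q" "v \<in> q" "u \<in> q'" "v \<in> q'" "u \<noteq> v" for q q' u v
  proof -
    have e: "{u, v} \<in> E" using cl that by metis
    have "{u, v} \<subseteq> q" "{u, v} \<subseteq> q'" using that by auto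
    moreover have "\<forall>e\<in>E. \<forall>q\<in>Q. \<forall>q'\<in>Q. e \<subseteq> q \<longrightarrow> e \<subseteq> q' \<longrightarrow> q = q'" using C by (elim conjE)
    ultimately show ?thesis using e that(1,2) by metis
  qed
  show "\<exists>q\<in>Q. \<exists>q'\<in>Q. v \<in> q \<and> v \<in> q' \<and> q \<noteq> q'" if "v \<in> V" for v using C that by simp
qed

text \<open>
  Of two members containing \<open>u\<close>, at most one can contain the edge \<open>uv\<close>. This is why every vertex is
  required to lie in two members.
\<close>
lemma clique_system_outside:
  assumes Q: "clique_system Q" and uv: "{u, v} \<in> E"
  shows "\<exists>q\<in>Q. u \<in> q \<and> v \<notin> q"
proof -
  have V: "u \<in> V" "u \<noteq> v" using edgeD[OF uv] by auto
  obtain q q' where "q \<in> Q" "q' \<in> Q" "u \<in> q" "u \<in> q'" "q \<noteq> q'" using clique_systemD(6)[OF Q V(1)] by blast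
  then show ?thesis using clique_systemD(5)[OF Q, of q q' u v] V(2) by blast
qed

lemma represented_by_clique_system:
  assumes Q: "clique_system Q"
  shows "represented V E (card Q)"
proof (rule representedI[of Q V "\<lambda>v. {q\<in>Q. v \<in> q}"])
  show "overlap {q\<in>Q. u \<in> q} {q\<in>Q. v \<in> q}" if "{u, v} \<in> E" for u v
    using clique_systemD(4)[OF Q that] clique_system_outside[OF Q that]
      clique_system_outside[OF Q, of v u] that unfolding overlap_def by (auto simp: insert_commute)
  show "\<not> overlap {q\<in>Q. u \<in> q} {q\<in>Q. v \<in> q}" if "u \<noteq> v" "{u, v} \<notin> E" for u v
    using clique_systemD(3)[OF Q] that unfolding overlap_def by blast
qed (use clique_systemD(1)[OF Q] in auto)

text \<open>
  Complementing one or both of two overlapping sets that do not cover everything leaves them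
  overlapping. A vertex of \<open>q0\<close> and a non-neighbour have disjoint sets, and complementing one of
  them turns disjointness into containment. Within \<open>q0\<close>, two sets sharing only the element
  \<open>q0\<close> would become disjoint when it is dropped, but their complements still meet.
\<close>
lemma represented_by_complements:
  assumes Q: "clique_system Q" and q0: "q0 \<in> Q"
    and free: "\<And>x y. x \<in> q0 \<Longrightarrow> {x, y} \<in> E \<Longrightarrow> \<exists>q\<in>Q. x \<notin> q \<and> y \<notin> q"
  shows "represented V E (card Q - 1)"
proof -
  define g where "g v = (if v \<in> q0 then {q\<in>Q. v \<notin> q} else {q\<in>Q. v \<in> q})" for v
  note D = clique_systemD[OF Q]
  have out: "\<exists>q\<in>Q. u \<in> q \<and> v \<notin> q" "\<exists>q\<in>Q. v \<in> q \<and> u \<notin> q" "\<exists>q\<in>Q. u \<in> q \<and> v \<in> q" if "{u, v} \<in> E" for u v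
    using clique_system_outside[OF Q] D(4) that by (simp_all add: insert_commute)
  have adj: "overlap (g u) (g v)" if e: "{u, v} \<in> E" for u v
  proof -
    have e': "{v, u} \<in> E" using e by (simp add: insert_commute)
    have "u \<in> q0 \<or> v \<in> q0 \<Longrightarrow> \<exists>q\<in>Q. u \<notin> q \<and> v \<notin> q"
      using free[of u v] free[of v u] e e' by blast
    then show ?thesis using out[OF e] unfolding overlap_def g_def by auto
  qed
  have nonadj: "\<not> overlap (g u) (g v)" if uv: "u \<noteq> v" "{u, v} \<notin> E" for u v
  proof -
    have "\<not> (u \<in> q \<and> v \<in> q)" if "q \<in> Q" for q using D(3)[OF that] uv by blast
    then show ?thesis using q0 unfolding overlap_def g_def by auto
  qed
  show ?thesis
  proof (rule representedI[of "Q - {q0}" V g])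
    show "finite (Q - {q0})" "card (Q - {q0}) \<le> card Q - 1" using D(1) q0 by auto
    show "g v \<subseteq> Q - {q0}" for v by (auto simp: g_def)
  qed (use adj nonadj in auto)
qed

lemma edge_pair:
  assumes "e \<in> E"
  obtains u v where "u \<noteq> v" "e = {u, v}"
  using assms by (elim edge_cases) (rule that)

lemma clique_systemI:
  assumes "finite Q"
    and "\<And>q. q \<in> Q \<Longrightarrow> q \<noteq> {} \<and> q \<subseteq> V"
    and "\<And>q u v. \<lbrakk>q \<in> Q; u \<in> q; v \<in> q; u \<noteq> v\<rbrakk> \<Longrightarrow> {u, v} \<in> E"
    and "\<And>u v. {u, v} \<in> E \<Longrightarrow> \<exists>q\<in>Q. u \<in> q \<and> v \<in> q"
    and "\<And>q q' u v. \<lbrakk>q \<in> Q; q' \<in> Q; u \<in> q; v \<in> q; u \<in> q'; v \<in> q'; u \<noteq> v\<rbrakk> \<Longrightarrow> q = q'"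
    and "\<And>v. v \<in> V \<Longrightarrow> \<exists>q\<in>Q. \<exists>q'\<in>Q. v \<in> q \<and> v \<in> q' \<and> q \<noteq> q'"
  shows "clique_system Q"
proof -
  have 1: "\<exists>q\<in>Q. e \<subseteq> q" if e: "e \<in> E" for e
  proof -
    obtain u v where uv: "u \<noteq> v" "e = {u, v}" using e by (rule edge_pair)
    show ?thesis using assms(4)[of u v] e unfolding uv by simp
  qed
  have 2: "q = q'" if e: "e \<in> E" and q: "q \<in> Q" "q' \<in> Q" "e \<subseteq> q" "e \<subseteq> q'" for e q q'
  proof -
    obtain u v where uv: "u \<noteq> v" "e = {u, v}" using e(1) by (rule edge_pair)
    show ?thesis using assms(5)[of q q' u v] q uv by simp
  qed
  show ?thesis unfolding clique_system_def
  proof (intro conjI ballI impI)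
    show "finite Q" by fact
    show "\<And>q. q \<in> Q \<Longrightarrow> q \<noteq> {}" "\<And>q. q \<in> Q \<Longrightarrow> q \<subseteq> V" using assms(2) by simp_all
    show "\<And>q u v. \<lbrakk>q \<in> Q; u \<in> q; v \<in> q; u \<noteq> v\<rbrakk> \<Longrightarrow> {u, v} \<in> E" by fact
    show "\<And>e. e \<in> E \<Longrightarrow> \<exists>q\<in>Q. e \<subseteq> q" by (rule 1)
    show "\<And>e q q'. \<lbrakk>e \<in> E; q \<in> Q; q' \<in> Q; e \<subseteq> q; e \<subseteq> q'\<rbrakk> \<Longrightarrow> q = q'" by (rule 2)
    show "\<And>v. v \<in> V \<Longrightarrow> \<exists>q\<in>Q. \<exists>q'\<in>Q. v \<in> q \<and> v \<in> q' \<and> q \<noteq> q'" by fact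
  qed
qed

definition packing :: "'a set set \<Rightarrow> bool" where
  "packing T \<longleftrightarrow> finite T \<and> (\<forall>t\<in>T. triangle E t) \<and>
     (\<forall>t\<in>T. \<forall>t'\<in>T. \<forall>e\<in>E. e \<subseteq> t \<longrightarrow> e \<subseteq> t' \<longrightarrow> t = t')"

text \<open>
  The vertices in \<open>P\<close> receive a private singleton.
\<close>
definition cliques_of :: "'a set set \<Rightarrow> 'a set \<Rightarrow> 'a set set" where
  "cliques_of T P = T \<union> {e\<in>E. \<forall>t\<in>T. \<not> e \<subseteq> t} \<union> (\<lambda>v. {v}) ` P"

lemma edges_of_triangle:
  assumes "triangle E t"
  shows "card {e\<in>E. e \<subseteq> t} = 3"
proof -
  obtain a b c where abc: "a \<noteq> b" "b \<noteq> c" "a \<noteq> c" "t = {a, b, c}" "{a, b} \<in> E" "{b, c} \<in> E" "{a, c} \<in> E"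
    using assms unfolding triangle_def by (elim exE conjE)
  have "{e\<in>E. e \<subseteq> t} = {{a, b}, {b, c}, {a, c}}"
  proof (intro equalityI subsetI)
    fix e assume "e \<in> {e\<in>E. e \<subseteq> t}"
    then have e: "e \<in> E" "e \<subseteq> t" by auto
    obtain u v where uv: "u \<noteq> v" "e = {u, v}" using e(1) by (rule edge_pair)
    then have "u \<in> {a, b, c}" "v \<in> {a, b, c}" using e(2) abc(4) by auto
    then show "e \<in> {{a, b}, {b, c}, {a, c}}" unfolding uv(2) using uv(1) by (auto simp: insert_commute)
  qed (use abc in auto)
  then show ?thesis using abc(1-3) by (auto simp: card_3_iff doubleton_eq_iff)
qed

lemma card_cliques_of:
  assumes T: "packing T" and P: "finite P"
  shows "card (cliques_of T P) + 2 * card T \<le> card E + card P"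
proof -
  have finT: "finite T" and tri: "\<And>t. t \<in> T \<Longrightarrow> triangle E t"
    and uniq: "\<And>t t' e. \<lbrakk>t \<in> T; t' \<in> T; e \<in> E; e \<subseteq> t; e \<subseteq> t'\<rbrakk> \<Longrightarrow> t = t'"
    using T unfolding packing_def by auto
  let ?C = "\<Union>t\<in>T. {e\<in>E. e \<subseteq> t}" and ?R = "{e\<in>E. \<forall>t\<in>T. \<not> e \<subseteq> t}"
  have "card ?C = (\<Sum>t\<in>T. card {e\<in>E. e \<subseteq> t})"
    using finT finite_E uniq by (intro card_UN_disjoint) auto
  also have "\<dots> = 3 * card T" using edges_of_triangle tri by simp
  finally have C: "card ?C = 3 * card T" .
  have "E = ?C \<union> ?R" by auto
  then have "card E = card (?C \<union> ?R)" by simp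
  also have "\<dots> = card ?C + card ?R" using finT finite_E by (intro card_Un_disjoint) auto
  finally have E: "card E = 3 * card T + card ?R" using C by simp
  have "card (cliques_of T P) \<le> card (T \<union> ?R) + card ((\<lambda>v. {v}) ` P)"
    unfolding cliques_of_def by (rule card_Un_le)
  moreover have "card (T \<union> ?R) \<le> card T + card ?R" by (rule card_Un_le)
  moreover have "card ((\<lambda>v. {v}) ` P) \<le> card P" using P by (rule card_image_le)
  ultimately show ?thesis using E by linarith
qed

lemma nbrs_other:
  assumes "card (nbrs E V v) > card S" "finite S"
  obtains w where "{w, v} \<in> E" "w \<notin> S"
proof -
  have "\<not> nbrs E V v \<subseteq> S" using assms card_mono[of S "nbrs E V v"] by auto
  then show thesis using that by (auto simp: nbrs_def)
qed

lemma clique_system_cliques_of: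
  assumes T: "packing T" and P: "P \<subseteq> V"
    and deg: "\<And>v. v \<in> V \<Longrightarrow> card (nbrs E V v) \<ge> 3 \<or> card (nbrs E V v) = 2 \<and> v \<notin> \<Union>T
      \<or> nbrs E V v \<noteq> {} \<and> v \<in> P"
  shows "clique_system (cliques_of T P)"
proof (rule clique_systemI)
  let ?Q = "cliques_of T P"
  have finT: "finite T" and tri: "\<And>t. t \<in> T \<Longrightarrow> triangle E t"
    and uniq: "\<And>t t' e. \<lbrakk>t \<in> T; t' \<in> T; e \<in> E; e \<subseteq> t; e \<subseteq> t'\<rbrakk> \<Longrightarrow> t = t'"
    using T unfolding packing_def by auto
  show "finite ?Q" using finT finite_E finite_subset[OF P finite_V] by (simp add: cliques_of_def)
  have tV: "t \<noteq> {} \<and> t \<subseteq> V \<and> card t = 3" if "t \<in> T" for t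
    using tri[OF that] edgeD unfolding triangle_def by (elim exE conjE) auto
  show "q \<noteq> {} \<and> q \<subseteq> V" if "q \<in> ?Q" for q
  proof -
    have "q \<noteq> {} \<and> q \<subseteq> V" if "q \<in> E" using that by (rule edge_cases) auto
    then show ?thesis using that tV P by (auto simp: cliques_of_def)
  qed
  show cl: "{u, v} \<in> E" if q: "q \<in> ?Q" and uv: "u \<in> q" "v \<in> q" "u \<noteq> v" for q u v
    using q unfolding cliques_of_def
  proof (elim UnE)
    assume "q \<in> T"
    then show ?thesis using triangle_clique[OF tri _ _ uv(3)] uv by blast
  next
    assume "q \<in> {e\<in>E. \<forall>t\<in>T. \<not> e \<subseteq> t}"
    then show ?thesis using edge_of_subset[of q u v] uv by auto
  qed (use uv in auto)
  show cov: "\<exists>q\<in>?Q. u \<in> q \<and> v \<in> q" if e: "{u, v} \<in> E" for u v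
  proof (cases "\<exists>t\<in>T. {u, v} \<subseteq> t")
    case False
    then have "{u, v} \<in> ?Q" using e by (simp add: cliques_of_def)
    then show ?thesis by blast
  qed (auto simp: cliques_of_def)
  show "q = q'" if q: "q \<in> ?Q" "q' \<in> ?Q" "u \<in> q" "v \<in> q" "u \<in> q'" "v \<in> q'" "u \<noteq> v" for q q' u v
  proof -
    have e: "{u, v} \<in> E" using cl q by metis
    have *: "r \<in> T \<or> r = {u, v} \<and> (\<forall>t\<in>T. \<not> {u, v} \<subseteq> t)" if r: "r \<in> ?Q" "u \<in> r" "v \<in> r" for r
      using r(1) unfolding cliques_of_def
    proof (elim UnE)
      assume "r \<in> {e\<in>E. \<forall>t\<in>T. \<not> e \<subseteq> t}"
      then show ?thesis using edge_of_subset[of r u v] r q(7) by auto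
    qed (use r q(7) in auto)
    from *[of q] *[of q'] q uniq[of q q' "{u, v}"] e show ?thesis by auto
  qed
  show "\<exists>q\<in>?Q. \<exists>q'\<in>?Q. v \<in> q \<and> v \<in> q' \<and> q \<noteq> q'" if v: "v \<in> V" for v
  proof -
    consider (three) "card (nbrs E V v) \<ge> 3" | (two) "card (nbrs E V v) = 2" "v \<notin> \<Union>T"
      | (priv) "nbrs E V v \<noteq> {}" "v \<in> P" using deg[OF v] by blast
    then show ?thesis
    proof cases
      case three
      obtain u where u: "{u, v} \<in> E" using nbrs_other[of "{}" v] three by auto
      obtain q where q: "q \<in> ?Q" "u \<in> q" "v \<in> q" using cov[OF u] by blast
      have "card q \<le> 3 \<and> finite q"
      proof -
        have "card q = 3 \<or> card q = 2 \<or> card q = 1" using q(1) tV card_edge by (auto simp: cliques_of_def)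
        then show ?thesis using card_ge_0_finite[of q] by auto
      qed
      then have "finite (q - {v})" "card (q - {v}) < card (nbrs E V v)" using q three by auto
      then obtain w where w: "{w, v} \<in> E" "w \<notin> q - {v}" using nbrs_other by metis
      obtain q' where q': "q' \<in> ?Q" "w \<in> q'" "v \<in> q'" using cov[OF w(1)] by blast
      have "w \<notin> q" using w edgeD[OF w(1)] by auto
      then show ?thesis using q q' by metis
    next
      case two
      obtain u where u: "{u, v} \<in> E" using nbrs_other[of "{}" v] two by auto
      obtain w where w: "{w, v} \<in> E" "w \<noteq> u" using nbrs_other[of "{u}" v] two by auto
      have "{u, v} \<in> ?Q" "{w, v} \<in> ?Q" using u w two(2) by (auto simp: cliques_of_def)
      moreover have "{u, v} \<noteq> {w, v}" using w(2) by (auto simp: doubleton_eq_iff)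
      ultimately show ?thesis by (intro bexI[of _ "{u, v}"] bexI[of _ "{w, v}"]) simp_all
    next
      case priv
      obtain u where u: "{u, v} \<in> E" using priv(1) by (auto simp: nbrs_def)
      obtain q where q: "q \<in> ?Q" "u \<in> q" "v \<in> q" using cov[OF u] by blast
      have "{v} \<in> ?Q" using priv(2) by (auto simp: cliques_of_def)
      moreover have "q \<noteq> {v}" using q(2) edgeD[OF u] by auto
      ultimately show ?thesis using q(1,3) by (intro bexI[of _ q] bexI[of _ "{v}"]) simp_all
    qed
  qed
qed

text \<open>
  Three edge cliques become one triangle; \<open>z\<close>, which may lose its second clique, gets a
  private singleton.
\<close>
lemma merge_triangle:
  assumes Q: "clique_system Q" and ne: "x \<noteq> y" "x \<noteq> z" "y \<noteq> z"
    and edges: "{x, y} \<in> Q" "{x, z} \<in> Q" "{y, z} \<in> Q"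
    and other: "\<exists>q\<in>Q. x \<in> q \<and> q \<noteq> {x, y} \<and> q \<noteq> {x, z}" "\<exists>q\<in>Q. y \<in> q \<and> q \<noteq> {x, y} \<and> q \<noteq> {y, z}"
  obtains Q' where "clique_system Q'" "card Q' < card Q"
proof -
  note D = clique_systemD[OF Q]
  let ?S = "{{x, y}, {x, z}, {y, z}}" and ?T = "{x, y, z}"
  define Q' where "Q' = (Q - ?S) \<union> {?T, {z}}"
  have S: "?S \<subseteq> Q" "card ?S = 3" using edges ne by (auto simp: card_3_iff doubleton_eq_iff)
  have "card Q' \<le> card (Q - ?S) + card {?T, {z}}" unfolding Q'_def by (rule card_Un_le)
  also have "\<dots> \<le> (card Q - 3) + 2" using S D(1) by (simp add: card_Diff_subset card_insert_if)
  also have "\<dots> < card Q" using S D(1) card_mono[of Q ?S] by auto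
  finally have card: "card Q' < card Q" .
  have E: "{x, y} \<in> E" "{x, z} \<in> E" "{y, z} \<in> E"
    using D(3)[OF edges(1), of x y] D(3)[OF edges(2), of x z] D(3)[OF edges(3), of y z] ne by auto
  have inS: "q \<in> ?S" if "q \<in> Q" "u \<in> q" "v \<in> q" "u \<noteq> v" "u \<in> ?T" "v \<in> ?T" for q u v
  proof -
    have "q = {x, y}" if "x \<in> q" "y \<in> q" using D(5)[OF \<open>q \<in> Q\<close> edges(1) that] ne by auto
    moreover have "q = {x, z}" if "x \<in> q" "z \<in> q" using D(5)[OF \<open>q \<in> Q\<close> edges(2) that] ne by auto
    moreover have "q = {y, z}" if "y \<in> q" "z \<in> q" using D(5)[OF \<open>q \<in> Q\<close> edges(3) that] ne by auto
    ultimately show ?thesis using that by auto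
  qed
  have "clique_system Q'"
  proof (rule clique_systemI)
    show "finite Q'" using D(1) by (simp add: Q'_def)
    show "q \<noteq> {} \<and> q \<subseteq> V" if "q \<in> Q'" for q
      using that D(2)[of q] edgeD[OF E(1)] edgeD[OF E(2)] by (auto simp: Q'_def)
    show "{u, v} \<in> E" if "q \<in> Q'" "u \<in> q" "v \<in> q" "u \<noteq> v" for q u v
      using that D(3)[of q u v] E by (auto simp: Q'_def insert_commute)
    show "\<exists>q\<in>Q'. u \<in> q \<and> v \<in> q" if e: "{u, v} \<in> E" for u v
    proof -
      obtain q where "q \<in> Q" "u \<in> q" "v \<in> q" using D(4)[OF e] by blast
      then show ?thesis by (cases "q \<in> ?S") (auto simp: Q'_def)
    qed
    show "q = q'" if q: "q \<in> Q'" "q' \<in> Q'" "u \<in> q" "v \<in> q" "u \<in> q'" "v \<in> q'" "u \<noteq> v" for q q' u v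
    proof -
      have *: "r \<in> Q - ?S \<or> r = ?T" if "r \<in> Q'" "u \<in> r" "v \<in> r" for r
        using that q(7) by (auto simp: Q'_def)
      have no: "r \<notin> Q - ?S" if "u \<in> ?T" "v \<in> ?T" "u \<in> r" "v \<in> r" for r
      proof
        assume "r \<in> Q - ?S"
        then have r: "r \<in> Q \<and> r \<notin> ?S" by (rule iffD1[OF Diff_iff])
        show False by (rule notE[OF conjunct2[OF r] inS[OF conjunct1[OF r] that(3,4) q(7) that(1,2)]])
      qed
      show ?thesis
      proof (cases "u \<in> ?T \<and> v \<in> ?T")
        case True
        have "q = ?T" using *[OF q(1,3,4)] no[OF conjunct1[OF True] conjunct2[OF True] q(3,4)] by argo
        moreover have "q' = ?T" using *[OF q(2,5,6)] no[OF conjunct1[OF True] conjunct2[OF True] q(5,6)] by argo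
        ultimately show ?thesis by simp
      next
        case False
        have "q \<in> Q" using *[OF q(1,3,4)] False q(3,4) by blast
        moreover have "q' \<in> Q" using *[OF q(2,5,6)] False q(5,6) by blast
        ultimately show ?thesis using D(5) q(3-7) by metis
      qed
    qed
    show "\<exists>q\<in>Q'. \<exists>q'\<in>Q'. v \<in> q \<and> v \<in> q' \<and> q \<noteq> q'" if v: "v \<in> V" for v
    proof -
      have T: "?T \<in> Q'" "{z} \<in> Q'" "?T \<noteq> {z}" using ne by (auto simp: Q'_def)
      have big: "?T \<notin> Q"
      proof
        assume "?T \<in> Q"
        then have "?T = {x, y}" using D(5)[OF _ edges(1), of ?T x y] ne by auto
        then show False using ne by auto
      qed
      consider "v = x" | "v = y" | "v = z" | "v \<notin> ?T" by auto
      then show ?thesis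
      proof cases
        case 1
        obtain q where q: "q \<in> Q" "x \<in> q" "q \<noteq> {x, y}" "q \<noteq> {x, z}" using other(1) by blast
        then have "q \<in> Q'" "q \<noteq> ?T" using ne big by (auto simp: Q'_def)
        then show ?thesis using q(2) T(1) 1 by (intro bexI[of _ q] bexI[of _ ?T]) simp_all
      next
        case 2
        obtain q where q: "q \<in> Q" "y \<in> q" "q \<noteq> {x, y}" "q \<noteq> {y, z}" using other(2) by blast
        then have "q \<in> Q'" "q \<noteq> ?T" using ne big by (auto simp: Q'_def)
        then show ?thesis using q(2) T(1) 2 by (intro bexI[of _ q] bexI[of _ ?T]) simp_all
      next
        case 3
        then show ?thesis using T by (intro bexI[of _ "{z}"] bexI[of _ ?T]) simp_all
      next
        case 4
        obtain q q' where q: "q \<in> Q" "q' \<in> Q" "v \<in> q" "v \<in> q'" "q \<noteq> q'" using D(6)[OF v] by blast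
        then have "q \<in> Q'" "q' \<in> Q'" using 4 by (auto simp: Q'_def)
        then show ?thesis using q by (intro bexI[of _ q] bexI[of _ q']) simp_all
      qed
    qed
  qed
  then show thesis using that card by blast
qed

end

section \<open>Saving one element\<close>

lemma card_image_collapse:
  assumes Z: "finite Z" and A: "z \<in> Z" "z' \<in> Z" "z' \<noteq> z" "g z' = g z"
  shows "card (g ` Z) + 1 \<le> card Z"
proof -
  have "\<not> inj_on g Z" using A by (auto simp: inj_on_def)
  then show ?thesis using card_less_of_surj_not_inj[OF Z refl, of g] by simp
qed

text \<open>
  All fibres of \<open>g\<close> have at least two elements, and there are at least three elements in all, so two
  of them can be removed without losing a value.
\<close>
lemma card_image_collapse_all:
  assumes Z: "finite Z" "card Z \<ge> 3" and twin: "\<And>z. z \<in> Z \<Longrightarrow> \<exists>z'\<in>Z. z' \<noteq> z \<and> g z' = g z"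
  shows "card (g ` Z) + 2 \<le> card Z"
proof -
  obtain z where z: "z \<in> Z" using Z by fastforce
  obtain z' where z': "z' \<in> Z" "z' \<noteq> z" "g z' = g z" using twin[OF z] by blast
  have "\<not> Z \<subseteq> {z, z'}" using Z card_mono[of "{z, z'}" Z] z'(2) by auto
  then obtain w where w: "w \<in> Z" "w \<noteq> z" "w \<noteq> z'" by auto
  obtain w' where w': "w' \<in> Z" "w' \<noteq> w" "g w' = g w" using twin[OF w(1)] by blast
  have "g z \<in> g ` (Z - {z, w})" using z' w by (metis DiffI imageI insertE singletonD)
  moreover have "g w \<in> g ` (Z - {z, w})"
  proof (cases "w' = z")
    case True
    then show ?thesis using w'(3) \<open>g z \<in> _\<close> by simp
  next
    case False
    then show ?thesis using w' by (metis DiffI imageI insertE singletonD)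
  qed
  ultimately have "g ` Z \<subseteq> g ` (Z - {z, w})" by auto
  then have "card (g ` Z) \<le> card (Z - {z, w})"
    using Z surj_card_le[of "Z - {z, w}" "g ` Z" g] by simp
  also have "\<dots> = card Z - 2" using z w Z by (simp add: card_Diff_subset)
  finally show ?thesis using Z by linarith
qed

context sgraph begin

lemma drop_private:
  assumes Q: "clique_system Q" and x: "{x} \<in> Q"
    and two: "q \<in> Q" "q' \<in> Q" "x \<in> q" "x \<in> q'" "q \<noteq> q'" "q \<noteq> {x}" "q' \<noteq> {x}"
  shows "\<exists>Q'. clique_system Q' \<and> card Q' < card Q"
proof -
  note D = clique_systemD[OF Q]
  have "clique_system (Q - {{x}})"
  proof (rule clique_systemI)
    show "\<exists>q\<in>Q - {{x}}. u \<in> q \<and> v \<in> q" if e: "{u, v} \<in> E" for u v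
    proof -
      obtain q where q: "q \<in> Q" "u \<in> q" "v \<in> q" using D(4)[OF e] by blast
      then have "q \<noteq> {x}" using edgeD[OF e] by auto
      then show ?thesis using q by (intro bexI[of _ q]) simp_all
    qed
    show "\<exists>q\<in>Q - {{x}}. \<exists>q'\<in>Q - {{x}}. v \<in> q \<and> v \<in> q' \<and> q \<noteq> q'" if v: "v \<in> V" for v
    proof (cases "v = x")
      case True
      then show ?thesis using two by (intro bexI[of _ q] bexI[of _ q']) simp_all
    next
      case False
      obtain r r' where r: "r \<in> Q" "r' \<in> Q" "v \<in> r" "v \<in> r'" "r \<noteq> r'" using D(6)[OF v] by blast
      then have "r \<noteq> {x}" "r' \<noteq> {x}" using False by auto
      then show ?thesis using r by (intro bexI[of _ r] bexI[of _ r']) simp_all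
    qed
  qed (use D in auto)
  moreover have "card (Q - {{x}}) < card Q" using D(1) x by (meson card_Diff1_less)
  ultimately show ?thesis by blast
qed

text \<open>
  If the edge \<open>xy\<close> meets every member of \<open>Q\<close>, then each further vertex \<open>z\<close> lies in exactly two
  members, one with \<open>x\<close> and one with \<open>y\<close>, so the graph consists of \<open>xy\<close>, all edges from \<open>x\<close>
  and \<open>y\<close>, and the edges that lie in triangles of \<open>Q\<close>. A private singleton of \<open>x\<close> or \<open>y\<close> is superfluous. If
  some \<open>z\<close> is in two edge cliques, they merge with \<open>xy\<close> into a triangle. Otherwise every \<open>z\<close> shares
  a clique with another such vertex, which makes \<open>Q\<close> too small.
\<close>
lemma improve_if_dominating_edge:
  assumes Q: "clique_system Q" and n: "card V \<ge> 5" and big: "card Q + 4 \<ge> 2 * card V"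
    and xy: "{x, y} \<in> E" and dom: "\<And>q. q \<in> Q \<Longrightarrow> x \<in> q \<or> y \<in> q"
  shows "\<exists>Q'. clique_system Q' \<and> card Q' < card Q"
proof -
  note D = clique_systemD[OF Q]
  have xyV: "x \<in> V" "y \<in> V" "x \<noteq> y" using edgeD[OF xy] by auto
  define Z where "Z = V - {x, y}"
  have finZ: "finite Z" using finite_V by (simp add: Z_def)
  have cardZ: "card Z = card V - 2" using xyV finite_V by (simp add: Z_def card_Diff_subset)
  have Z3: "card Z \<ge> 3" using cardZ n by linarith
  have zne: "z \<noteq> x" "z \<noteq> y" "z \<in> V" if "z \<in> Z" for z using that by (auto simp: Z_def)
  have ex: "(\<exists>q\<in>Q. x \<in> q \<and> z \<in> q) \<and> (\<exists>q\<in>Q. y \<in> q \<and> z \<in> q) \<and>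
     (\<forall>q\<in>Q. \<forall>q'\<in>Q. x \<in> q \<longrightarrow> z \<in> q \<longrightarrow> y \<in> q' \<longrightarrow> z \<in> q' \<longrightarrow> q \<noteq> q')" if z: "z \<in> Z" for z
  proof -
    note zn = zne[OF z]
    obtain q q' where q: "q \<in> Q" "q' \<in> Q" "z \<in> q" "z \<in> q'" "q \<noteq> q'" using D(6)[OF zn(3)] by blast
    have nx: "\<not> (x \<in> q \<and> x \<in> q')" using D(5)[OF q(1,2), of x z] q zn by auto
    have ny: "\<not> (y \<in> q \<and> y \<in> q')" using D(5)[OF q(1,2), of y z] q zn by auto
    have "x \<in> q \<and> y \<in> q' \<or> y \<in> q \<and> x \<in> q'" using dom[OF q(1)] dom[OF q(2)] nx ny by argo
    moreover have "r \<noteq> r'" if r: "r \<in> Q" "r' \<in> Q" "x \<in> r" "z \<in> r" "y \<in> r'" "z \<in> r'" for r r'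
    proof
      assume rr: "r = r'"
      have "s = r" if s: "s \<in> Q" "z \<in> s" for s
        using dom[OF s(1)]
      proof
        assume "x \<in> s"
        then show ?thesis using D(5)[of s r x z] s r zn by auto
      next
        assume "y \<in> s"
        then show ?thesis using D(5)[of s r y z] s r rr zn by auto
      qed
      then show False using q by metis
    qed
    ultimately show ?thesis using q by metis
  qed
  (* The unique cliques that z shares with x and with y. *)
  obtain qx where qx: "\<And>z. z \<in> Z \<Longrightarrow> qx z \<in> Q \<and> x \<in> qx z \<and> z \<in> qx z"
    using ex by metis
  obtain qy where qy: "\<And>z. z \<in> Z \<Longrightarrow> qy z \<in> Q \<and> y \<in> qy z \<and> z \<in> qy z"
    using ex by metis
  have qx_eq: "q = qx z" if "q \<in> Q" "z \<in> Z" "x \<in> q" "z \<in> q" for q z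
    using D(5)[of q "qx z" x z] qx[OF that(2)] that zne by auto
  have qy_eq: "q = qy z" if "q \<in> Q" "z \<in> Z" "y \<in> q" "z \<in> q" for q z
    using D(5)[of q "qy z" y z] qy[OF that(2)] that zne by auto
  have ne: "qx z \<noteq> qy z" if "z \<in> Z" for z using ex[OF that] qx[OF that] qy[OF that] by metis
  have y_qx: "y \<notin> qx z" if "z \<in> Z" for z using qy_eq[of "qx z" z] qx[OF that] ne[OF that] that by auto
  have x_qy: "x \<notin> qy z" if "z \<in> Z" for z using qx_eq[of "qy z" z] qy[OF that] ne[OF that] that by auto
  have xyQ: "{x, y} \<in> Q"
  proof -
    obtain q where q: "q \<in> Q" "x \<in> q" "y \<in> q" using D(4)[OF xy] by blast
    have "z \<notin> q" if "z \<in> Z" for z using qx_eq[of q z] q that y_qx[OF that] by auto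
    then have "q = {x, y}" using D(2)[OF q(1)] q(2,3) by (auto simp: Z_def)
    then show ?thesis using q(1) by simp
  qed
  have qne: "qx z \<noteq> {x, y}" "qy z \<noteq> {x, y}" "qx z \<noteq> {x}" "qy z \<noteq> {y}" if "z \<in> Z" for z
    using qx[OF that] qy[OF that] zne[OF that] by auto
  obtain z0 where z0: "z0 \<in> Z" using Z3 by fastforce
  show ?thesis
  proof (cases "{x} \<in> Q \<or> {y} \<in> Q")
    case True
    then show ?thesis
    proof
      assume "{x} \<in> Q"
      then show ?thesis
        using drop_private[OF Q _ xyQ, of x "qx z0"] qx[OF z0] qne[OF z0] xyV(3) by (metis insertI1 doubleton_eq_iff insert_absorb2)
    next
      assume "{y} \<in> Q"
      then show ?thesis
        using drop_private[OF Q _ xyQ, of y "qy z0"] qy[OF z0] qne[OF z0] xyV(3) by (metis insertI1 insertI2 doubleton_eq_iff insert_absorb2)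
    qed
  next
    case False
    have "Q \<subseteq> insert {x, y} (qx ` Z \<union> qy ` Z)"
    proof
      fix q assume q: "q \<in> Q"
      show "q \<in> insert {x, y} (qx ` Z \<union> qy ` Z)"
      proof (cases "\<exists>z\<in>Z. z \<in> q")
        case True
        then obtain z where z: "z \<in> Z" "z \<in> q" by blast
        then have "q = qx z \<or> q = qy z" using dom[OF q] qx_eq[OF q] qy_eq[OF q] by blast
        then show ?thesis using z(1) by blast
      next
        case out: False
        then have "q \<subseteq> {x, y}" using D(2)[OF q] by (auto simp: Z_def)
        moreover have "q \<noteq> {}" "q \<noteq> {x}" "q \<noteq> {y}" using D(2)[OF q] False q by metis+
        ultimately have "x \<in> q" "y \<in> q" by (metis subset_insert subset_singletonD, metis insert_commute subset_insert subset_singletonD)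
        then have "q = {x, y}" using \<open>q \<subseteq> {x, y}\<close> by blast
        then show ?thesis by simp
      qed
    qed
    then have "card Q \<le> card (insert {x, y} (qx ` Z \<union> qy ` Z))" using finZ by (intro card_mono) auto
    also have "\<dots> \<le> Suc (card (qx ` Z \<union> qy ` Z))" using finZ by (simp add: card_insert_if)
    also have "\<dots> \<le> Suc (card (qx ` Z) + card (qy ` Z))" using card_Un_le by auto
    finally have cardQ: "card Q \<le> card (qx ` Z) + card (qy ` Z) + 1" by simp
    show ?thesis
    proof (cases "\<exists>z\<in>Z. qx z = {x, z} \<and> qy z = {y, z}")
      case True
      then obtain z where z: "z \<in> Z" "qx z = {x, z}" "qy z = {y, z}" by blast
      have "\<not> Z \<subseteq> {z}" using Z3 card_mono[of "{z}" Z] by auto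
      then obtain w where w: "w \<in> Z" "w \<noteq> z" by auto
      have Q3: "{x, z} \<in> Q" "{y, z} \<in> Q" using qx[OF z(1)] qy[OF z(1)] z by auto
      have "qx w \<noteq> {x, y}" "qx w \<noteq> {x, z}" "qy w \<noteq> {x, y}" "qy w \<noteq> {y, z}"
        using qx[OF w(1)] qy[OF w(1)] zne[OF w(1)] w(2) by auto
      then show ?thesis
        using merge_triangle[OF Q xyV(3) _ _ xyQ Q3] zne[OF z(1)] qx[OF w(1)] qy[OF w(1)] by metis
    next
      case nosplit: False
      (* A clique that contains x and z but is not the edge xz contains another vertex of Z. *)
      have twx: "\<exists>z'\<in>Z. z' \<noteq> z \<and> qx z' = qx z" if z: "z \<in> Z" "qx z \<noteq> {x, z}" for z
      proof -
        have "\<not> qx z \<subseteq> {x, z}" using qx[OF z(1)] z(2) by blast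
        then obtain w where w: "w \<in> qx z" "w \<noteq> x" "w \<noteq> z" by blast
        have "w \<in> V" using w(1) D(2)[of "qx z"] qx[OF z(1)] by blast
        then have "w \<in> Z" using w y_qx[OF z(1)] by (auto simp: Z_def)
        then show ?thesis using qx_eq[of "qx z" w] qx[OF z(1)] w by (intro bexI[of _ w]) auto
      qed
      have twy: "\<exists>z'\<in>Z. z' \<noteq> z \<and> qy z' = qy z" if z: "z \<in> Z" "qy z \<noteq> {y, z}" for z
      proof -
        have "\<not> qy z \<subseteq> {y, z}" using qy[OF z(1)] z(2) by blast
        then obtain w where w: "w \<in> qy z" "w \<noteq> y" "w \<noteq> z" by blast
        have "w \<in> V" using w(1) D(2)[of "qy z"] qy[OF z(1)] by blast
        then have "w \<in> Z" using w x_qy[OF z(1)] by (auto simp: Z_def)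
        then show ?thesis using qy_eq[of "qy z" w] qy[OF z(1)] w by (intro bexI[of _ w]) auto
      qed
      have le: "card (qx ` Z) \<le> card Z" "card (qy ` Z) \<le> card Z" using card_image_le[OF finZ] by auto
      have "card (qx ` Z) + card (qy ` Z) + 2 \<le> 2 * card Z"
      proof -
        consider "\<forall>z\<in>Z. qx z = {x, z}" | "\<forall>z\<in>Z. qy z = {y, z}"
          | z w where "z \<in> Z" "qx z \<noteq> {x, z}" "w \<in> Z" "qy w \<noteq> {y, w}" by blast
        then show ?thesis
        proof cases
          case 1
          have "card (qy ` Z) + 2 \<le> card Z"
            using 1 nosplit twy by (intro card_image_collapse_all[OF finZ Z3]) blast
          then show ?thesis using le by linarith
        next
          case 2
          have "card (qx ` Z) + 2 \<le> card Z"
            using 2 nosplit twx by (intro card_image_collapse_all[OF finZ Z3]) blast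
          then show ?thesis using le by linarith
        next
          case 3
          obtain z' where "z' \<in> Z" "z' \<noteq> z" "qx z' = qx z" using twx[OF 3(1,2)] by blast
          then have "card (qx ` Z) + 1 \<le> card Z" using card_image_collapse[OF finZ 3(1)] by blast
          moreover obtain w' where "w' \<in> Z" "w' \<noteq> w" "qy w' = qy w" using twy[OF 3(3,4)] by blast
          then have "card (qy ` Z) + 1 \<le> card Z" using card_image_collapse[OF finZ 3(3)] by blast
          ultimately show ?thesis by linarith
        qed
      qed
      then show ?thesis using cardQ cardZ n big by linarith
    qed
  qed
qed

lemma represented_saving_one:
  assumes Q: "clique_system Q" and n: "card V \<ge> 5" and le: "card Q \<le> 2 * card V - 4"
  shows "represented V E (2 * card V - 5)"
proof (cases "card Q \<le> 2 * card V - 5")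
  case True
  then show ?thesis using represented_mono[OF represented_by_clique_system[OF Q]] by blast
next
  case big: False
  show ?thesis
  proof (cases "\<exists>q0\<in>Q. \<forall>x y. x \<in> q0 \<longrightarrow> {x, y} \<in> E \<longrightarrow> (\<exists>q\<in>Q. x \<notin> q \<and> y \<notin> q)")
    case True
    then obtain q0 where "q0 \<in> Q" "\<And>x y. x \<in> q0 \<Longrightarrow> {x, y} \<in> E \<Longrightarrow> \<exists>q\<in>Q. x \<notin> q \<and> y \<notin> q" by blast
    then have "represented V E (card Q - 1)" by (rule represented_by_complements[OF Q])
    then show ?thesis by (rule represented_mono) (use le in linarith)
  next
    case False
    have "Q \<noteq> {}" using big n by auto
    then obtain x y where "{x, y} \<in> E" "\<And>q. q \<in> Q \<Longrightarrow> x \<in> q \<or> y \<in> q" using False by blast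
    then obtain Q' where Q': "clique_system Q'" "card Q' < card Q"
      using improve_if_dominating_edge[OF Q n _ \<open>{x, y} \<in> E\<close>] big by fastforce
    show ?thesis
      by (rule represented_mono[OF represented_by_clique_system[OF Q'(1)]]) (use Q' le in linarith)
  qed
qed

end

section \<open>Clique systems of sparse graphs\<close>

text \<open>
  This is all that planarity contributes to the upper bound. Demanding it for all vertex sets makes it
  hereditary.
\<close>
definition packed :: "'a set \<Rightarrow> 'a set set \<Rightarrow> bool" where
  "packed V E \<longleftrightarrow> (\<forall>W\<subseteq>V. 3 \<le> card W \<longrightarrow> (\<exists>T. finite T \<and> (\<forall>t\<in>T. triangle (induced E W) t) \<and>
     (\<forall>t\<in>T. \<forall>t'\<in>T. \<forall>e\<in>induced E W. e \<subseteq> t \<longrightarrow> e \<subseteq> t' \<longrightarrow> t = t') \<and>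
     card (induced E W) + 4 \<le> 2 * card W + 2 * card T))"

lemma induced_induced: "W' \<subseteq> W \<Longrightarrow> induced (induced E W) W' = induced E W'"
  by (auto simp: induced_def)

lemma packed_induced: "packed V E \<Longrightarrow> W \<subseteq> V \<Longrightarrow> packed W (induced E W)"
  unfolding packed_def by (auto simp: induced_induced)

lemma represented_induced: "represented W (induced E W) k \<longleftrightarrow> represented W E k"
  unfolding represented_def induced_def by auto

context sgraph begin

text \<open>
  Vertices are removed from \<open>S\<close> one at a time, always one of degree at most two in what remains. Its
  remaining edges number at most two, and at most one if it is in \<open>L\<close>, which leaves room for a
  private singleton.
\<close>
lemma peeling_count:
  assumes core: "\<And>S. H \<subset> S \<Longrightarrow> S \<subseteq> V \<Longrightarrow> \<exists>v\<in>S - H. card (nbrs E S v) \<le> 2"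
    and L: "\<And>v. v \<in> L \<Longrightarrow> card (nbrs E V v) \<le> 1" "L \<subseteq> V"
  shows "H \<subseteq> S \<Longrightarrow> S \<subseteq> V \<Longrightarrow>
    card (induced E S) + card (L \<inter> (S - H)) \<le> card (induced E H) + 2 * card (S - H)"
proof (induction "card (S - H)" arbitrary: S rule: less_induct)
  case less
  have finS: "finite S" using less.prems(2) finite_V finite_subset by metis
  show ?case
  proof (cases "S = H")
    case False
    then obtain v where v: "v \<in> S" "v \<notin> H" "card (nbrs E S v) \<le> 2" using core less.prems by blast
    let ?S = "S - {v}"
    have SH: "S - H = insert v (?S - H)" "v \<notin> ?S - H" using v by auto
    then have c: "card (S - H) = card (?S - H) + 1" using finS by simp
    have IH: "card (induced E ?S) + card (L \<inter> (?S - H)) \<le> card (induced E H) + 2 * card (?S - H)"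
      using less.hyps[of ?S] c less.prems v by auto
    have rem: "card (induced E S) = card (induced E ?S) + card (nbrs E S v)"
      using card_induced_remove less.prems(2) v(1) by blast
    have "card (nbrs E S v) + card (L \<inter> (S - H)) \<le> 2 + card (L \<inter> (?S - H))"
    proof (cases "v \<in> L")
      case True
      then have "card (nbrs E S v) \<le> 1"
        using L(1) card_nbrs_mono[OF less.prems(2) order_refl] order_trans by blast
      moreover have "card (L \<inter> (S - H)) \<le> Suc (card (L \<inter> (?S - H)))"
        using SH finS by (subst SH(1)) (simp add: Int_insert_right card_insert_if)
      ultimately show ?thesis by linarith
    next
      case False
      then have "L \<inter> (S - H) = L \<inter> (?S - H)" by auto
      then show ?thesis using v(3) by simp
    qed
    then show ?thesis using IH rem c by linarith
  qed simp
qed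

text \<open>
  The union of all vertex sets inducing minimum degree at least three induces it as well.
\<close>
lemma core_exists:
  obtains H where "H \<subseteq> V" "\<And>v. v \<in> H \<Longrightarrow> card (nbrs E H v) \<ge> 3"
    "\<And>S. H \<subset> S \<Longrightarrow> S \<subseteq> V \<Longrightarrow> \<exists>v\<in>S - H. card (nbrs E S v) \<le> 2"
proof -
  define F where "F = {S. S \<subseteq> V \<and> (\<forall>v\<in>S. card (nbrs E S v) \<ge> 3)}"
  define H where "H = \<Union>F"
  have HV: "H \<subseteq> V" by (auto simp: H_def F_def)
  have H3: "card (nbrs E H v) \<ge> 3" if v: "v \<in> H" for v
  proof -
    obtain S where S: "S \<in> F" "v \<in> S" using v by (auto simp: H_def)
    then have "S \<subseteq> H" "3 \<le> card (nbrs E S v)" by (auto simp: H_def F_def)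
    then show ?thesis using card_nbrs_mono[OF _ HV] order_trans by blast
  qed
  have "\<exists>v\<in>S - H. card (nbrs E S v) \<le> 2" if S: "H \<subset> S" "S \<subseteq> V" for S
  proof (rule ccontr)
    assume no: "\<not> (\<exists>v\<in>S - H. card (nbrs E S v) \<le> 2)"
    have "card (nbrs E S v) \<ge> 3" if "v \<in> S" for v
    proof (cases "v \<in> H")
      case True
      then show ?thesis using H3[OF True] card_nbrs_mono[of H S v] S by auto
    qed (use that no in force)
    then have "S \<in> F" using S by (auto simp: F_def)
    then show False using S(1) by (auto simp: H_def)
  qed
  then show thesis using that[OF HV H3] by blast
qed

lemma degenerate_card:
  assumes deg: "\<And>S. \<lbrakk>S \<subseteq> V; S \<noteq> {}\<rbrakk> \<Longrightarrow> \<exists>v\<in>S. card (nbrs E S v) \<le> 2"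
  shows "W \<subseteq> V \<Longrightarrow> card W \<ge> 2 \<Longrightarrow> card (induced E W) + 3 \<le> 2 * card W"
proof (induction "card W" arbitrary: W rule: less_induct)
  case less
  have finW: "finite W" using less.prems(1) finite_V finite_subset by metis
  show ?case
  proof (cases "card W = 2")
    case True
    then obtain a b where ab: "W = {a, b}" "a \<noteq> b" by (auto simp: card_2_iff)
    have "induced E W \<subseteq> {{a, b}}"
    proof
      fix e assume "e \<in> induced E W"
      then have e: "e \<in> E" "e \<subseteq> {a, b}" using ab by (auto simp: induced_def)
      obtain u v where "u \<noteq> v" "e = {u, v}" using e(1) by (rule edge_pair)
      then show "e \<in> {{a, b}}" using e(2) by auto
    qed
    then have "card (induced E W) \<le> 1" using card_mono[of "{{a, b}}"] by fastforce
    then show ?thesis using True by simp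
  next
    case False
    obtain v where v: "v \<in> W" "card (nbrs E W v) \<le> 2"
      using deg[OF less.prems(1)] less.prems(2) by fastforce
    have c: "card (W - {v}) = card W - 1" using v(1) finW by simp
    have "card (induced E (W - {v})) + 3 \<le> 2 * card (W - {v})"
    proof (rule less.hyps)
      show "card (W - {v}) < card W" "2 \<le> card (W - {v})" using c False less.prems(2) by linarith+
      show "W - {v} \<subseteq> V" using less.prems(1) by auto
    qed
    then show ?thesis using card_induced_remove[OF less.prems(1) v(1)] v(2) c less.prems(2) by linarith
  qed
qed

text \<open>
  If equality holds in \<open>degenerate_card\<close>, every vertex in the peeling order is removed with exactly
  two edges, down to a triangle on three vertices. The fourth vertex from the end is joined to two
  vertices of that triangle and raises their degrees to three.
\<close>
lemma degenerate_tight_triangle: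
  assumes deg: "\<And>S. \<lbrakk>S \<subseteq> V; S \<noteq> {}\<rbrakk> \<Longrightarrow> \<exists>v\<in>S. card (nbrs E S v) \<le> 2"
  shows "W \<subseteq> V \<Longrightarrow> card W \<ge> 3 \<Longrightarrow> card (induced E W) + 3 = 2 * card W \<Longrightarrow>
    \<exists>a b c. a \<noteq> b \<and> b \<noteq> c \<and> a \<noteq> c \<and> {a, b, c} \<subseteq> W \<and> {a, b} \<in> E \<and> {b, c} \<in> E \<and> {a, c} \<in> E \<and>
      (card W = 3 \<or> card (nbrs E W a) \<ge> 3 \<and> card (nbrs E W b) \<ge> 3)"
proof (induction "card W" arbitrary: W rule: less_induct)
  case less
  have finW: "finite W" using less.prems(1) finite_V finite_subset by metis
  obtain v where v: "v \<in> W" "card (nbrs E W v) \<le> 2"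
    using deg[OF less.prems(1)] less.prems(2) by fastforce
  let ?W = "W - {v}"
  have WV: "?W \<subseteq> V" using less.prems(1) by auto
  have c: "card ?W = card W - 1" using v(1) finW by simp
  have le: "card (induced E ?W) + 3 \<le> 2 * card ?W"
    using degenerate_card[OF deg WV] c less.prems(2) by simp
  have rem: "card (induced E W) = card (induced E ?W) + card (nbrs E W v)"
    by (rule card_induced_remove[OF less.prems(1) v(1)])
  have tight: "card (induced E ?W) + 3 = 2 * card ?W" and two: "card (nbrs E W v) = 2"
    using le rem v(2) c less.prems(2,3) by linarith+
  obtain s t where st: "nbrs E W v = {s, t}" "s \<noteq> t" using two by (auto simp: card_2_iff)
  have e: "{s, v} \<in> E" "{t, v} \<in> E" "s \<in> W" "t \<in> W" using st(1) by (auto simp: nbrs_def)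
  then have ne: "s \<noteq> v" "t \<noteq> v" using edgeD by blast+
  show ?case
  proof (cases "card W = 3")
    case True
    then have "card ?W = 2" using c by simp
    moreover have "{s, t} \<subseteq> ?W" using e ne by auto
    ultimately have W: "?W = {s, t}" using st(2) finW card_seteq[of ?W "{s, t}"] by auto
    have "card (induced E ?W) = 1" using tight \<open>card ?W = 2\<close> by simp
    then obtain f where f: "f \<in> E" "f \<subseteq> {s, t}" unfolding W by (auto simp: induced_def card_1_singleton_iff)
    obtain x y where "x \<noteq> y" "f = {x, y}" using f(1) by (rule edge_pair)
    then have "{s, t} \<in> E" using f by (auto simp: insert_commute)
    then show ?thesis
      using e ne st(2) v(1) True by (intro exI[of _ s] exI[of _ t] exI[of _ v]) (simp add: insert_commute)
  next
    case False
    then have W3: "card ?W \<ge> 3" using c less.prems(2) by simp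
    obtain a b d where abd: "a \<noteq> b" "b \<noteq> d" "a \<noteq> d" "{a, b, d} \<subseteq> ?W" "{a, b} \<in> E" "{b, d} \<in> E" "{a, d} \<in> E"
      and big: "card ?W = 3 \<or> card (nbrs E ?W a) \<ge> 3 \<and> card (nbrs E ?W b) \<ge> 3"
      using less.hyps[OF _ WV W3 tight] c less.prems(2) by auto
    show ?thesis
    proof (cases "card ?W = 3")
      case True
      have W: "?W = {a, b, d}" using abd True finW card_seteq[of ?W "{a, b, d}"] by auto
      have all: "{x, y} \<in> E" if "x \<in> {a, b, d}" "y \<in> {a, b, d}" "x \<noteq> y" for x y
        using that abd(5-7) by (auto simp: insert_commute)
      have st': "s \<in> {a, b, d}" "t \<in> {a, b, d}" using e ne W by auto
      have "\<not> {a, b, d} \<subseteq> {s, t}" using st(2) abd(1-3) by auto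
      then obtain r where r: "r \<in> {a, b, d}" "r \<noteq> s" "r \<noteq> t" by blast
      have rW: "r \<in> W" "r \<noteq> v" using r(1) W by auto
      have deg3: "card (nbrs E W x) \<ge> 3"
        if x: "x \<in> {a, b, d}" "y \<in> {a, b, d}" "x \<noteq> y" "r \<noteq> x" "r \<noteq> y" "{v, x} \<in> E" "y \<in> W" "y \<noteq> v" for x y
      proof -
        have "{r, y, v} \<subseteq> nbrs E W x" using all[of r x] all[of y x] x r rW v(1) by (auto simp: nbrs_def)
        moreover have "card {r, y, v} = 3" using x rW by (auto simp: card_3_iff)
        ultimately show ?thesis using card_mono[OF finite_nbrs[OF less.prems(1)]] by metis
      qed
      have "card (nbrs E W s) \<ge> 3" "card (nbrs E W t) \<ge> 3"
        using deg3[of s t] deg3[of t s] st' st(2) r e ne by (auto simp: insert_commute)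
      then show ?thesis
        using all[of s t] all[of t r] all[of s r] st' st(2) r e rW
        by (intro exI[of _ s] exI[of _ t] exI[of _ r]) simp
    next
      case False
      then have "card (nbrs E ?W a) \<ge> 3" "card (nbrs E ?W b) \<ge> 3" using big by auto
      then have "card (nbrs E W a) \<ge> 3" "card (nbrs E W b) \<ge> 3"
        using card_nbrs_mono[of ?W W] less.prems(1) by (meson Diff_subset order_trans)+
      then show ?thesis using abd by (intro exI[of _ a] exI[of _ b] exI[of _ d]) simp
    qed
  qed
qed

text \<open>
  Triangles are used only inside the core \<open>H\<close>, where all degrees are at least three, so they
  deprive no vertex of its second clique. Outside of \<open>H\<close> every edge is a clique, and leaves get
  private singletons.
\<close>
lemma clique_system_with_core:
  assumes packed: "packed V E" and nz: "\<And>v. v \<in> V \<Longrightarrow> nbrs E V v \<noteq> {}"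
    and H: "H \<subseteq> V" "H \<noteq> {}" "\<And>v. v \<in> H \<Longrightarrow> card (nbrs E H v) \<ge> 3"
      "\<And>S. H \<subset> S \<Longrightarrow> S \<subseteq> V \<Longrightarrow> \<exists>v\<in>S - H. card (nbrs E S v) \<le> 2"
  obtains Q where "clique_system Q" "card Q + 4 \<le> 2 * card V"
proof -
  have finH: "finite H" using H(1) finite_V finite_subset by metis
  obtain v where v: "v \<in> H" using H(2) by blast
  have "card (nbrs E H v) \<le> card H" using finH by (intro card_mono) (auto simp: nbrs_def)
  then have "card H \<ge> 3" using H(3)[OF v] by linarith
  then obtain T where T: "finite T" "\<And>t. t \<in> T \<Longrightarrow> triangle (induced E H) t"
    "\<And>t t' e. \<lbrakk>t \<in> T; t' \<in> T; e \<in> induced E H; e \<subseteq> t; e \<subseteq> t'\<rbrakk> \<Longrightarrow> t = t'"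
    "card (induced E H) + 4 \<le> 2 * card H + 2 * card T"
    using packed H(1) unfolding packed_def by metis
  have tri: "triangle E t \<and> t \<subseteq> H" if "t \<in> T" for t
    using T(2)[OF that] unfolding triangle_def by (auto simp: induced_def)
  have pack: "packing T"
    unfolding packing_def
  proof (intro conjI ballI impI)
    fix t t' e assume "t \<in> T" "t' \<in> T" "e \<in> E" "e \<subseteq> t" "e \<subseteq> t'"
    moreover then have "e \<in> induced E H" using tri by (auto simp: induced_def)
    ultimately show "t = t'" using T(3) by metis
  qed (use T(1) tri in auto)
  define L where "L = {v\<in>V. card (nbrs E V v) = 1}"
  have LV: "L \<subseteq> V" by (auto simp: L_def)
  have finL: "finite L" using finite_subset[OF LV finite_V] .
  have LH: "L \<inter> (V - H) = L"
  proof -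
    have "v \<notin> H" if "v \<in> L" for v
    proof
      assume "v \<in> H"
      then have "3 \<le> card (nbrs E V v)" using H(3)[of v] card_nbrs_mono[OF H(1) order_refl, of v] by linarith
      then show False using that by (simp add: L_def)
    qed
    then show ?thesis using LV by auto
  qed
  have "card (induced E V) + card (L \<inter> (V - H)) \<le> card (induced E H) + 2 * card (V - H)"
    by (rule peeling_count[OF H(4)]) (use H LV in \<open>auto simp: L_def\<close>)
  then have cnt: "card E + card L \<le> card (induced E H) + 2 * card (V - H)"
    by (simp add: LH induced_V)
  have VH: "card (V - H) = card V - card H" "card H \<le> card V"
    using H(1) finH finite_V by (auto simp: card_Diff_subset card_mono)
  have "clique_system (cliques_of T L)"
  proof (rule clique_system_cliques_of[OF pack LV])
    fix v assume v: "v \<in> V"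
    show "3 \<le> card (nbrs E V v) \<or> card (nbrs E V v) = 2 \<and> v \<notin> \<Union> T \<or> nbrs E V v \<noteq> {} \<and> v \<in> L"
    proof (cases "v \<in> H")
      case True
      then show ?thesis using H(3)[OF True] card_nbrs_mono[OF H(1) order_refl, of v] by linarith
    next
      case False
      then have "v \<notin> \<Union>T" using tri by auto
      moreover have "card (nbrs E V v) \<noteq> 0" using nz[OF v] finite_nbrs[OF order_refl] by simp
      ultimately show ?thesis using nz[OF v] v by (auto simp: L_def)
    qed
  qed
  moreover have "card (cliques_of T L) + 4 \<le> 2 * card V"
    using card_cliques_of[OF pack finL] cnt VH T(4) by linarith
  ultimately show thesis by (rule that)
qed

text \<open>
  Let \<open>L\<close> be the set of leaves and \<open>R\<close> its complement. Leaves are attached to distinct vertices of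
  \<open>R\<close>, and \<open>R\<close> induces at most \<open>2|R| - 3\<close> edges, so all edges and a singleton for each leaf make
  at most \<open>2|R| - 3 + 2|L| = 2n - 3\<close> cliques. If this bound is attained and \<open>n \<ge> 5\<close>, \<open>R\<close> contains a triangle in
  which at most one vertex has degree two in the whole graph. Using it as a clique saves two
  and costs at most one further singleton.
\<close>
lemma clique_system_degenerate:
  assumes deg: "\<And>S. \<lbrakk>S \<subseteq> V; S \<noteq> {}\<rbrakk> \<Longrightarrow> \<exists>v\<in>S. card (nbrs E S v) \<le> 2"
    and nz: "\<And>v. v \<in> V \<Longrightarrow> nbrs E V v \<noteq> {}"
    and noK2: "\<And>u v. \<lbrakk>nbrs E V u = {v}; nbrs E V v = {u}\<rbrakk> \<Longrightarrow> False"
    and notwin: "\<And>u v w. \<lbrakk>u \<in> V; v \<in> V; u \<noteq> v; nbrs E V u = {w}; nbrs E V v = {w}\<rbrakk> \<Longrightarrow> False"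
    and n: "card V \<ge> 3"
  obtains Q where "clique_system Q" "card Q + 3 \<le> 2 * card V" "card V \<ge> 5 \<Longrightarrow> card Q + 4 \<le> 2 * card V"
proof -
  define L where "L = {v\<in>V. card (nbrs E V v) = 1}"
  define R where "R = V - L"
  have LV: "L \<subseteq> V" and RV: "R \<subseteq> V" by (auto simp: L_def R_def)
  have finL: "finite L" using finite_subset[OF LV finite_V] .
  have finR: "finite R" using finite_subset[OF RV finite_V] .
  have VLR: "card V = card L + card R"
    using card_Diff_subset[OF finL LV] card_mono[OF finite_V LV] by (simp add: R_def)
  have "\<exists>w. nbrs E V v = {w}" if "v \<in> L" for v using that by (auto simp: L_def card_1_singleton_iff)
  then obtain \<phi> where \<phi>: "\<And>v. v \<in> L \<Longrightarrow> nbrs E V v = {\<phi> v}" by metis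
  have \<phi>E: "{\<phi> v, v} \<in> E" if "v \<in> L" for v using \<phi>[OF that] by (auto simp: nbrs_def)
  have \<phi>R: "\<phi> v \<in> R" if "v \<in> L" for v
  proof -
    have "\<phi> v \<in> V" using edgeD[OF \<phi>E[OF that]] by blast
    moreover have "\<phi> v \<notin> L"
    proof
      assume "\<phi> v \<in> L"
      then have "nbrs E V (\<phi> v) = {\<phi> (\<phi> v)}" by (rule \<phi>)
      moreover have "v \<in> nbrs E V (\<phi> v)" using \<phi>E[OF that] that LV by (auto simp: nbrs_def insert_commute)
      ultimately have "nbrs E V (\<phi> v) = {v}" by auto
      then show False using noK2[OF \<phi>[OF that]] by blast
    qed
    ultimately show ?thesis by (simp add: R_def)
  qed
  have inj: "inj_on \<phi> L"
  proof (rule inj_onI, rule ccontr)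
    fix u v assume uv: "u \<in> L" "v \<in> L" "\<phi> u = \<phi> v" "u \<noteq> v"
    show False by (rule notwin[of u v "\<phi> v"]) (use uv \<phi>[OF uv(1)] \<phi>[OF uv(2)] LV in auto)
  qed
  have LR: "card L \<le> card R" using \<phi>R by (intro card_inj_on_le[OF inj _ finR]) auto
  have Ecov: "E \<subseteq> induced E R \<union> (\<lambda>v. {\<phi> v, v}) ` L"
  proof
    fix e assume e: "e \<in> E"
    show "e \<in> induced E R \<union> (\<lambda>v. {\<phi> v, v}) ` L"
    proof (cases "e \<subseteq> R")
      case False
      have "e \<subseteq> V" using edge[OF e] by auto
      then obtain v where v: "v \<in> e" "v \<in> L" using False by (auto simp: R_def)
      obtain x y where xy: "x \<noteq> y" "e = {x, y}" using e by (rule edge_pair)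
      define w where "w = (if v = x then y else x)"
      have w: "e = {w, v}" using v(1) xy by (auto simp: w_def)
      then have "w \<in> nbrs E V v" using e edgeD[of w v] by (auto simp: nbrs_def)
      then have "w = \<phi> v" using \<phi>[OF v(2)] by simp
      then show ?thesis using w v(2) by auto
    qed (use e in \<open>auto simp: induced_def\<close>)
  qed
  have "card E \<le> card (induced E R \<union> (\<lambda>v. {\<phi> v, v}) ` L)"
    using Ecov finL finite_induced by (intro card_mono) auto
  also have "\<dots> \<le> card (induced E R) + card ((\<lambda>v. {\<phi> v, v}) ` L)" by (rule card_Un_le)
  also have "card ((\<lambda>v. {\<phi> v, v}) ` L) \<le> card L" using finL by (rule card_image_le)
  finally have cardE: "card E \<le> card (induced E R) + card L" by simp
  have R2: "card R \<ge> 2" using LR VLR n by linarith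
  have Rle: "card (induced E R) + 3 \<le> 2 * card R" by (rule degenerate_card[OF deg RV R2])
  have deg1: "nbrs E V v \<noteq> {} \<and> v \<in> L \<or> card (nbrs E V v) = 2 \<or> card (nbrs E V v) \<ge> 3" if "v \<in> V" for v
  proof -
    have "card (nbrs E V v) \<noteq> 0" using nz[OF that] finite_nbrs[OF order_refl] by simp
    then show ?thesis using nz[OF that] that by (auto simp: L_def)
  qed
  have pack0: "packing {}" by (simp add: packing_def)
  have Q0: "clique_system (cliques_of {} L)"
    using deg1 by (intro clique_system_cliques_of[OF pack0 LV]) auto
  have card0: "card (cliques_of {} L) \<le> card E + card L" using card_cliques_of[OF pack0 finL] by simp
  show thesis
  proof (cases "card V \<ge> 5 \<and> card (induced E R) + 3 = 2 * card R")
    case False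
    then show thesis using that[OF Q0] card0 cardE Rle VLR by linarith
  next
    case True
    have R3: "card R \<ge> 3" using True VLR LR by linarith
    obtain a b c where abc: "a \<noteq> b" "b \<noteq> c" "a \<noteq> c" "{a, b, c} \<subseteq> R" "{a, b} \<in> E" "{b, c} \<in> E" "{a, c} \<in> E"
      and big: "card R = 3 \<or> card (nbrs E R a) \<ge> 3 \<and> card (nbrs E R b) \<ge> 3"
      using degenerate_tight_triangle[OF deg RV R3] True by auto
    have "\<exists>d\<in>{a, b, c}. \<forall>x\<in>{a, b, c}. x \<noteq> d \<longrightarrow> card (nbrs E V x) \<ge> 3"
    proof (cases "card R = 3")
      case False
      then have "card (nbrs E V a) \<ge> 3" "card (nbrs E V b) \<ge> 3"
        using big card_nbrs_mono[OF RV order_refl] order_trans by blast+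
      then show ?thesis by auto
    next
      case R3: True
      have R: "R = {a, b, c}" using abc R3 finR card_seteq[of R "{a, b, c}"] by auto
      have all: "{x, y} \<in> E" if "x \<in> R" "y \<in> R" "x \<noteq> y" for x y
        using that abc(5-7) unfolding R by (auto simp: insert_commute)
      have leaf3: "card (nbrs E V (\<phi> l)) \<ge> 3" if l: "l \<in> L" for l
      proof -
        have "nbrs E V (\<phi> l) \<supseteq> insert l (R - {\<phi> l})"
          using all[of _ "\<phi> l"] \<phi>R[OF l] \<phi>E[OF l] l LV RV by (auto simp: nbrs_def insert_commute)
        moreover have "card (insert l (R - {\<phi> l})) = 3"
          using \<phi>R[OF l] R3 finR l by (simp add: R_def)
        ultimately show ?thesis using card_mono[OF finite_nbrs[OF order_refl]] by metis
      qed
      have sub: "\<phi> ` L \<subseteq> R" using \<phi>R by auto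
      have "card (R - \<phi> ` L) = card R - card L"
        using card_Diff_subset[OF finite_imageI[OF finL] sub] card_image[OF inj] by simp
      then have "card (R - \<phi> ` L) \<le> Suc 0" using True VLR R3 by linarith
      then have same: "x = y" if "x \<in> R - \<phi> ` L" "y \<in> R - \<phi> ` L" for x y
        using card_le_Suc0_iff_eq[of "R - \<phi> ` L"] finR that by auto
      obtain d where d: "d \<in> R" "\<And>x. \<lbrakk>x \<in> R; x \<noteq> d\<rbrakk> \<Longrightarrow> x \<in> \<phi> ` L"
      proof (cases "R - \<phi> ` L = {}")
        case True
        show thesis by (rule that[of a]) (use R True in auto)
      next
        case False
        then obtain x where x: "x \<in> R - \<phi> ` L" by blast
        show thesis
        proof (rule that[of x])
          show "x \<in> R" using x by (rule DiffD1)
          show "y \<in> \<phi> ` L" if "y \<in> R" "y \<noteq> x" for y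
          proof (rule ccontr)
            assume "y \<notin> \<phi> ` L"
            then have "y \<in> R - \<phi> ` L" using that(1) by (rule DiffI[rotated])
            then show False using same[OF x] that(2) by metis
          qed
        qed
      qed
      have "card (nbrs E V x) \<ge> 3" if "x \<in> R" "x \<noteq> d" for x
        using d(2)[OF that] leaf3 by (elim imageE) simp
      then show ?thesis using d(1) unfolding R[symmetric] by (intro bexI[of _ d] ballI impI)
    qed
    then obtain d where d: "d \<in> {a, b, c}" "\<And>x. \<lbrakk>x \<in> {a, b, c}; x \<noteq> d\<rbrakk> \<Longrightarrow> card (nbrs E V x) \<ge> 3" by blast
    have "triangle E {a, b, c}" unfolding triangle_def using abc by blast
    then have pack: "packing {{a, b, c}}" by (simp add: packing_def)
    have dV: "insert d L \<subseteq> V" using d(1) abc(4) RV LV by auto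
    have "clique_system (cliques_of {{a, b, c}} (insert d L))"
    proof (rule clique_system_cliques_of[OF pack dV])
      fix v assume v: "v \<in> V"
      show "3 \<le> card (nbrs E V v) \<or> card (nbrs E V v) = 2 \<and> v \<notin> \<Union> {{a, b, c}} \<or> nbrs E V v \<noteq> {} \<and> v \<in> insert d L"
        using deg1[OF v] d(2)[of v] nz[OF v] by auto
    qed
    moreover have "card (cliques_of {{a, b, c}} (insert d L)) + 2 \<le> card E + (card L + 1)"
      using card_cliques_of[OF pack, of "insert d L"] finL card_insert_le_m1[of "Suc (card L)" L d]
      by (simp add: card_insert_if split: if_splits)
    ultimately show thesis using that[of "cliques_of {{a, b, c}} (insert d L)"] cardE Rle VLR by linarith
  qed
qed

end

section \<open>The upper bound\<close>

lemma represented_add_isolated: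
  assumes "represented (V - {v}) E k" "\<And>u. u \<in> V \<Longrightarrow> {u, v} \<notin> E"
  shows "represented V E k"
proof -
  obtain f :: "'a \<Rightarrow> nat set" where f: "\<forall>u\<in>V - {v}. finite (f u)"
    "\<forall>u\<in>V - {v}. \<forall>w\<in>V - {v}. u \<noteq> w \<longrightarrow> ({u, w} \<in> E \<longleftrightarrow> overlap (f u) (f w))"
    "card (\<Union>u\<in>V - {v}. f u) \<le> k"
    using assms(1) unfolding represented_def by (elim exE conjE)
  let ?f = "f(v := {})"
  have "(\<Union>u\<in>V. ?f u) = (\<Union>u\<in>V - {v}. f u)" by auto
  moreover have "\<forall>u\<in>V. \<forall>w\<in>V. u \<noteq> w \<longrightarrow> ({u, w} \<in> E \<longleftrightarrow> overlap (?f u) (?f w))"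
    using f(2) assms(2) by (auto simp: overlap_def insert_commute)
  ultimately show ?thesis unfolding represented_def using f(1,3) by (intro exI[of _ ?f]) auto
qed

lemma represented_add_twin:
  assumes "represented (V - {v}) E k" "u \<in> V" "u \<noteq> v" "{u, v} \<notin> E"
    and twin: "\<And>w. w \<in> V \<Longrightarrow> {u, w} \<in> E \<longleftrightarrow> {v, w} \<in> E"
  shows "represented V E k"
proof -
  obtain f :: "'a \<Rightarrow> nat set" where f: "\<forall>u\<in>V - {v}. finite (f u)"
    "\<forall>u\<in>V - {v}. \<forall>w\<in>V - {v}. u \<noteq> w \<longrightarrow> ({u, w} \<in> E \<longleftrightarrow> overlap (f u) (f w))"
    "card (\<Union>u\<in>V - {v}. f u) \<le> k"
    using assms(1) unfolding represented_def by (elim exE conjE)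
  let ?f = "f(v := f u)"
  have "(\<Union>u\<in>V. ?f u) = (\<Union>u\<in>V - {v}. f u)" using assms(2,3) by auto
  moreover have "{x, w} \<in> E \<longleftrightarrow> overlap (?f x) (?f w)" if xw: "x \<in> V" "w \<in> V" "x \<noteq> w" for x w
  proof -
    have sym: "overlap A B \<longleftrightarrow> overlap B A" for A B :: "nat set" by (auto simp: overlap_def)
    have v: "{v, w} \<in> E \<longleftrightarrow> overlap (f u) (f w)" if "w \<in> V" "w \<noteq> v" for w
    proof (cases "w = u")
      case True
      then show ?thesis using assms(4) by (auto simp: overlap_def insert_commute)
    next
      case False
      then show ?thesis using f(2) twin[of w] that assms(2,3) by auto
    qed
    consider "x = v" "w \<noteq> v" | "w = v" "x \<noteq> v" | "x \<noteq> v" "w \<noteq> v" using xw(3) by metis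
    then show ?thesis
    proof cases
      case 1
      then show ?thesis using v[OF xw(2)] by simp
    next
      case 2
      then show ?thesis using v[OF xw(1)] sym[of "f u" "f x"] by (simp add: insert_commute)
    next
      case 3
      then show ?thesis using f(2) xw by simp
    qed
  qed
  ultimately show ?thesis unfolding represented_def using f(1,3) assms(2,3) by (intro exI[of _ ?f]) auto
qed

text \<open>
  The two new sets are the union of all others, each with one new element. They contain all other
  sets; the condition \<open>k \<ge> 1\<close> leaves room for a common element if there are no others.
\<close>
lemma represented_add_K2:
  assumes rep: "represented (V - {a, b}) E k" and k: "k \<ge> 1" and ab: "a \<noteq> b" "{a, b} \<in> E"
    and fin: "finite V"
    and iso: "\<And>w. w \<in> V - {a, b} \<Longrightarrow> {a, w} \<notin> E \<and> {b, w} \<notin> E"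
  shows "represented V E (k + 2)"
proof -
  let ?W = "V - {a, b}"
  obtain f :: "'a \<Rightarrow> nat set" where f: "\<forall>u\<in>?W. finite (f u)"
    "\<forall>u\<in>?W. \<forall>w\<in>?W. u \<noteq> w \<longrightarrow> ({u, w} \<in> E \<longleftrightarrow> overlap (f u) (f w))"
    "card (\<Union>u\<in>?W. f u) \<le> k"
    using rep unfolding represented_def by (elim exE conjE)
  define U where "U = (if (\<Union>u\<in>?W. f u) = {} then {0} else \<Union>u\<in>?W. f u)"
  have U: "finite U" "U \<noteq> {}" "card U \<le> k" "\<And>w. w \<in> ?W \<Longrightarrow> f w \<subseteq> U"
    using f(1,3) k fin unfolding U_def by auto
  obtain x where x: "x \<notin> U" using ex_new_if_finite[OF _ U(1)] by auto
  obtain y where y: "y \<notin> insert x U" using ex_new_if_finite[of "insert x U"] U(1) by auto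
  define g where "g v = (if v = a then insert x U else if v = b then insert y U else f v)" for v
  have oab: "overlap (g a) (g b)" "overlap (g b) (g a)" "{b, a} \<in> E"
    using x y U(2) ab by (auto simp: overlap_def g_def insert_commute)
  have off: "\<not> overlap (g a) (g w)" "\<not> overlap (g b) (g w)" "\<not> overlap (g w) (g a)" "\<not> overlap (g w) (g b)"
    "{a, w} \<notin> E" "{b, w} \<notin> E" "{w, a} \<notin> E" "{w, b} \<notin> E" if "w \<in> V" "w \<noteq> a" "w \<noteq> b" for w
    using U(4)[of w] iso[of w] that ab(1) by (auto simp: overlap_def g_def insert_commute)
  have rest: "{u, w} \<in> E \<longleftrightarrow> overlap (g u) (g w)"
    if "u \<in> V" "u \<noteq> a" "u \<noteq> b" "w \<in> V" "w \<noteq> a" "w \<noteq> b" "u \<noteq> w" for u w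
    using f(2) that by (auto simp: g_def)
  have main: "{u, w} \<in> E \<longleftrightarrow> overlap (g u) (g w)" if "u \<in> V" "w \<in> V" "u \<noteq> w" for u w
    using that ab(2) oab off[of u] off[of w] rest[of u w]
    by (cases "u = a"; cases "u = b"; cases "w = a"; cases "w = b") simp_all
  show ?thesis
  proof (rule representedI[of "insert x (insert y U)" V g])
    show "card (insert x (insert y U)) \<le> k + 2" using U(1,3) x y by simp
    show "g v \<subseteq> insert x (insert y U)" if "v \<in> V" for v using U(4)[of v] that by (auto simp: g_def)
  qed (use U(1) main in auto)
qed

text \<open>
  The induction needs a nondecreasing bound that grows by at least two from \<open>n - 2\<close> to \<open>n\<close>. The value
  \<open>2n - 5\<close> is too small for the complete graphs on two, three and four vertices.
\<close>
definition overlap_bound :: "nat \<Rightarrow> nat" where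
  "overlap_bound n = (if n \<le> 1 then 0 else if n = 2 then 3 else if n \<le> 4 then 2 * n - 3 else 2 * n - 5)"

text \<open>
  An isolated vertex is represented by the empty set and the second of two leaves at the same vertex by
  a copy of the first, at no cost. An isolated edge costs two elements for two vertices. When none of
  these occurs, the clique systems constructed above apply.
\<close>
lemma represented_if_packed:
  "sgraph V E \<Longrightarrow> packed V E \<Longrightarrow> represented V E (overlap_bound (card V))"
proof (induction "card V" arbitrary: V E rule: less_induct)
  case less
  interpret sgraph V E by fact
  have sub: "represented W E (overlap_bound (card W))" if "W \<subset> V" for W
  proof -
    have "card W < card V" using that finite_V by (simp add: psubset_card_mono)
    then have "represented W (induced E W) (overlap_bound (card W))"
      using less.hyps sgraph_induced packed_induced[OF less.prems(2)] that by blast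
    then show ?thesis by (simp add: represented_induced)
  qed
  have minus1: "represented (V - {v}) E (overlap_bound (card V))" if "v \<in> V" for v
  proof -
    have "card (V - {v}) = card V - 1" using that finite_V by simp
    moreover have "overlap_bound (card V - 1) \<le> overlap_bound (card V)" by (auto simp: overlap_bound_def)
    ultimately show ?thesis using represented_mono[OF sub[of "V - {v}"]] that by auto
  qed
  consider (isolated) v where "v \<in> V" "nbrs E V v = {}"
    | (twins) u v w where "u \<in> V" "v \<in> V" "u \<noteq> v" "nbrs E V u = {w}" "nbrs E V v = {w}"
    | (K2) u v where "nbrs E V u = {v}" "nbrs E V v = {u}"
    | (small) "V = {}"
    | (other) "\<And>v. v \<in> V \<Longrightarrow> nbrs E V v \<noteq> {}" "V \<noteq> {}"
       "\<And>u v w. \<lbrakk>u \<in> V; v \<in> V; u \<noteq> v; nbrs E V u = {w}; nbrs E V v = {w}\<rbrakk> \<Longrightarrow> False"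
       "\<And>u v. \<lbrakk>nbrs E V u = {v}; nbrs E V v = {u}\<rbrakk> \<Longrightarrow> False"
    by metis
  then show ?case
  proof cases
    case isolated
    then show ?thesis using represented_add_isolated[OF minus1] by (auto simp: nbrs_def)
  next
    case twins
    have iff: "{x, v'} \<in> E \<longleftrightarrow> x = w" if "x \<in> V" "nbrs E V v' = {w}" for x v'
      using that by (auto simp: nbrs_def)
    have w: "w \<in> V" "w \<noteq> u" using twins(4) edgeD[of w u] by (auto simp: nbrs_def)
    show ?thesis
    proof (rule represented_add_twin[OF minus1[OF twins(2)] twins(1,3)])
      show "{u, v} \<notin> E" using iff[OF twins(1,5)] w(2) by simp
      show "{u, x} \<in> E \<longleftrightarrow> {v, x} \<in> E" if "x \<in> V" for x
        using iff[OF that twins(4)] iff[OF that twins(5)] by (simp add: insert_commute)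
    qed
  next
    case K2
    have uv: "{u, v} \<in> E" "u \<in> V" "v \<in> V" "u \<noteq> v"
      using K2 edgeD[of u v] by (auto simp: nbrs_def)
    have c: "card (V - {u, v}) = card V - 2" using uv finite_V by (simp add: card_Diff_subset)
    have V2: "card V \<ge> 2" using uv card_mono[OF finite_V, of "{u, v}"] by simp
    let ?k = "max (overlap_bound (card V - 2)) 1"
    have "V - {u, v} \<subset> V" using uv by auto
    then have "represented (V - {u, v}) E ?k"
      using represented_mono[OF sub, of "V - {u, v}" ?k] c by simp
    then have "represented V E (?k + 2)"
    proof (rule represented_add_K2[OF _ _ uv(4,1) finite_V])
      show "{u, w} \<notin> E \<and> {v, w} \<notin> E" if "w \<in> V - {u, v}" for w
        using K2 that by (auto simp: nbrs_def insert_commute)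
    qed simp
    moreover have "?k + 2 \<le> overlap_bound (card V)" using V2 by (auto simp: overlap_bound_def)
    ultimately show ?thesis by (rule represented_mono)
  next
    case small
    then show ?thesis by (simp add: represented_def)
  next
    case other
    have n: "card V \<ge> 3"
    proof (rule ccontr)
      assume "\<not> card V \<ge> 3"
      obtain v where v: "v \<in> V" using other(2) by blast
      obtain u where u: "u \<in> V" "{u, v} \<in> E" using other(1)[OF v] by (auto simp: nbrs_def)
      have ne: "u \<noteq> v" using edgeD[OF u(2)] by blast
      have V: "V = {u, v}" using u v ne \<open>\<not> card V \<ge> 3\<close> finite_V card_seteq[of V "{u, v}"] by auto
      have "nbrs E V u = {v}" "nbrs E V v = {u}"
        using u(2) edgeD[of u u] edgeD[of v v] unfolding V nbrs_def by (auto simp: insert_commute)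
      then show False by (rule other(4))
    qed
    obtain H where H: "H \<subseteq> V" "\<And>v. v \<in> H \<Longrightarrow> card (nbrs E H v) \<ge> 3"
      "\<And>S. H \<subset> S \<Longrightarrow> S \<subseteq> V \<Longrightarrow> \<exists>v\<in>S - H. card (nbrs E S v) \<le> 2"
      using core_exists by metis
    obtain Q where Q: "clique_system Q" "card Q + 3 \<le> 2 * card V" "card V \<ge> 5 \<Longrightarrow> card Q + 4 \<le> 2 * card V"
    proof (cases "H = {}")
      case True
      have deg: "\<exists>v\<in>S. card (nbrs E S v) \<le> 2" if "S \<subseteq> V" "S \<noteq> {}" for S using H(3)[of S] that True by auto
      show thesis
      proof (rule clique_system_degenerate)
        show "\<And>S. \<lbrakk>S \<subseteq> V; S \<noteq> {}\<rbrakk> \<Longrightarrow> \<exists>v\<in>S. card (nbrs E S v) \<le> 2" by (rule deg)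
        show "\<And>v. v \<in> V \<Longrightarrow> nbrs E V v \<noteq> {}" by (rule other(1))
        show "\<And>u v. \<lbrakk>nbrs E V u = {v}; nbrs E V v = {u}\<rbrakk> \<Longrightarrow> False" by (rule other(4))
        show "\<And>u v w. \<lbrakk>u \<in> V; v \<in> V; u \<noteq> v; nbrs E V u = {w}; nbrs E V v = {w}\<rbrakk> \<Longrightarrow> False"
          by (rule other(3))
        show "card V \<ge> 3" by (rule n)
      qed (rule that)
    next
      case False
      obtain Q where "clique_system Q" "card Q + 4 \<le> 2 * card V"
        by (rule clique_system_with_core[OF less.prems(2) other(1) H(1) False H(2,3)])
      then show thesis using that[of Q] by simp
    qed
    show ?thesis
    proof (cases "card V \<ge> 5")
      case True
      then have "represented V E (2 * card V - 5)" using represented_saving_one[OF Q(1) True] Q(3) by simp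
      then show ?thesis using True by (simp add: overlap_bound_def)
    next
      case False
      then have "card Q \<le> overlap_bound (card V)" using Q(2) n by (auto simp: overlap_bound_def)
      then show ?thesis by (rule represented_mono[OF represented_by_clique_system[OF Q(1)]])
    qed
  qed
qed

lemma edge_iff_arc:
  assumes "pair_graph G"
  shows "{u, v} \<in> edges G \<longleftrightarrow> (u, v) \<in> parcs G"
proof -
  interpret pair_graph G by fact
  have "(v, u) \<in> parcs G \<longleftrightarrow> (u, v) \<in> parcs G" using arcs_symmetric by auto
  then show ?thesis by (auto simp: edges_def doubleton_eq_iff)
qed

lemma sgraph_of_pair_graph:
  assumes "pair_graph G"
  shows "sgraph (pverts G) (edges G)"
proof -
  interpret pair_graph G by fact
  show ?thesis
  proof
    show "finite (pverts G)" by simp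
    fix e assume "e \<in> edges G"
    then obtain u v where uv: "(u, v) \<in> parcs G" "e = {u, v}" by (auto simp: edges_def)
    have "u \<in> pverts G" "v \<in> pverts G" "u \<noteq> v"
      using in_arcsD1[OF uv(1)] in_arcsD2[OF uv(1)] pair_no_loops[OF uv(1)] by auto
    then show "\<exists>u\<in>pverts G. \<exists>v\<in>pverts G. u \<noteq> v \<and> e = {u, v}" using uv(2) by blast
  qed
qed

lemma overlap_number_le:
  assumes G: "pair_graph G" and rep: "represented (pverts G) (edges G) k"
  shows "overlap_number G \<le> k"
proof -
  obtain f :: "'a \<Rightarrow> nat set" where f: "\<forall>v\<in>pverts G. finite (f v)"
    "\<forall>u\<in>pverts G. \<forall>v\<in>pverts G. u \<noteq> v \<longrightarrow> ({u, v} \<in> edges G \<longleftrightarrow> overlap (f u) (f v))"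
    "card (\<Union>v\<in>pverts G. f v) \<le> k"
    using rep unfolding represented_def by (elim exE conjE)
  have "overlap_representation G f"
    using f(2) by (simp add: overlap_representation_def edge_iff_arc[OF G])
  then have "overlap_number G \<le> representation_size G f"
    unfolding overlap_number_def using f(1) by (intro Least_le exI[of _ f]) simp
  then show ?thesis using f(3) by (simp add: representation_size_def)
qed

lemma overlap_number_attained:
  assumes G: "pair_graph G"
  obtains f :: "'a \<Rightarrow> nat set" where "overlap_representation G f" "\<forall>v\<in>pverts G. finite (f v)"
    "representation_size G f = overlap_number G"
proof -
  let ?P = "\<lambda>k. \<exists>f :: 'a \<Rightarrow> nat set.
     overlap_representation G f \<and> (\<forall>v \<in> pverts G. finite (f v)) \<and> representation_size G f = k"
  have "\<exists>k. ?P k" using finite_overlap_representation_exists[OF G] by blast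
  then have "?P (overlap_number G)" unfolding overlap_number_def by (rule LeastI_ex)
  then show thesis using that by blast
qed

text \<open>
  The arcs of the edges inside \<open>W\<close> are a drawing of the subgraph induced by \<open>W\<close>.
\<close>
lemma planar_packed:
  assumes G: "pair_graph G" and "planar G"
  shows "packed (pverts G) (edges G)"
proof -
  interpret sgraph "pverts G" "edges G" by (rule sgraph_of_pair_graph[OF G])
  obtain p \<gamma> where D: "plane_drawing G p \<gamma>" using assms(2) by (auto simp: planar_def)
  have D1: "inj_on p (pverts G)"
    and D2: "\<And>e. e \<in> edges G \<Longrightarrow> arc (\<gamma> e) \<and> {pathstart (\<gamma> e), pathfinish (\<gamma> e)} = p ` e \<and>
      (path_image (\<gamma> e) - p ` e) \<inter> p ` pverts G = {}"
    and D3: "\<And>e e'. \<lbrakk>e \<in> edges G; e' \<in> edges G; e \<noteq> e'\<rbrakk> \<Longrightarrow> (path_image (\<gamma> e) - p ` e) \<inter> path_image (\<gamma> e') = {}"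
    using D unfolding plane_drawing_def by simp_all
  have "\<exists>T. finite T \<and> (\<forall>t\<in>T. triangle (induced (edges G) W) t) \<and>
     (\<forall>t\<in>T. \<forall>t'\<in>T. \<forall>e\<in>induced (edges G) W. e \<subseteq> t \<longrightarrow> e \<subseteq> t' \<longrightarrow> t = t') \<and>
     card (induced (edges G) W) + 4 \<le> 2 * card W + 2 * card T"
    if W: "W \<subseteq> pverts G" "3 \<le> card W" for W
  proof -
    interpret W: sgraph W "induced (edges G) W" by (rule sgraph_induced[OF W(1)])
    have sub: "induced (edges G) W \<subseteq> edges G" by (auto simp: induced_def)
    interpret drawing p \<gamma> W "induced (edges G) W"
    proof
      show "finite W" by (rule W.finite_V)
      show "inj_on p W" by (rule inj_on_subset[OF D1 W(1)])
      show "\<And>e. e \<in> induced (edges G) W \<Longrightarrow> \<exists>u\<in>W. \<exists>v\<in>W. u \<noteq> v \<and> e = {u, v}" by (rule W.edge)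
      fix e assume e: "e \<in> induced (edges G) W"
      then have eG: "e \<in> edges G" using sub by blast
      show "arc (\<gamma> e)" "{pathstart (\<gamma> e), pathfinish (\<gamma> e)} = p ` e"
        using D2[OF eG] by simp_all
      have "(path_image (\<gamma> e) - p ` e) \<inter> p ` pverts G = {}" using D2[OF eG] by simp
      then show "(path_image (\<gamma> e) - p ` e) \<inter> p ` W = {}" using W(1) by blast
      fix e' assume e': "e' \<in> induced (edges G) W" "e \<noteq> e'"
      then have "e' \<in> edges G" using sub by blast
      then show "(path_image (\<gamma> e) - p ` e) \<inter> path_image (\<gamma> e') = {}"
        using D3[OF eG _ e'(2)] by simp
    qed
    show ?thesis by (rule triangle_packing[OF W(2)])
  qed
  then show ?thesis unfolding packed_def by (intro allI impI)
qed

lemma planar_overlap_number_le: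
  assumes G: "pair_graph G" "planar G" and n: "card (pverts G) \<ge> 5"
  shows "overlap_number G \<le> 2 * card (pverts G) - 5"
proof -
  have "represented (pverts G) (edges G) (overlap_bound (card (pverts G)))"
    by (rule represented_if_packed[OF sgraph_of_pair_graph planar_packed]) (use G in simp_all)
  then show ?thesis using overlap_number_le[OF G(1)] n by (simp add: overlap_bound_def)
qed

context sgraph begin

section \<open>Graphs in which closed neighbourhoods do not separate\<close>

definition nonnbrs :: "'a \<Rightarrow> 'a set" where
  "nonnbrs v = {w\<in>V. w \<noteq> v \<and> {v, w} \<notin> E}"

text \<open>
  Call \<open>v\<close> a container if \<open>f v\<close> includes the set of some non-neighbour \<open>w\<close>. A neighbour of \<open>w\<close>
  that is not adjacent to \<open>v\<close> overlaps \<open>f w\<close> but not \<open>f v\<close>, so its set is included as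
  well; by connectedness \<open>f v\<close> includes the sets of all its non-neighbours. Two
  non-adjacent containers would have equal sets and hence be twins, so containers are pairwise adjacent.

  An edge that is not between containers gets an element that is in the sets of its ends outside the
  containers, but not in the set of an end that is a container. If two edges got the same element,
  any two of their ends would be adjacent: non-adjacent vertices that are not containers have
  disjoint sets, and a container includes the sets of its non-neighbours. Absence of
  triangles makes the two edges equal. By the same argument there is at most one edge between
  containers.
\<close>
lemma card_edges_le_representation:
  fixes f :: "'a \<Rightarrow> 'b set"
  assumes rep: "\<And>u v. \<lbrakk>u \<in> V; v \<in> V; u \<noteq> v\<rbrakk> \<Longrightarrow> {u, v} \<in> E \<longleftrightarrow> overlap (f u) (f v)"
    and fin: "\<And>v. v \<in> V \<Longrightarrow> finite (f v)"
    and tfree: "\<And>a b c. \<lbrakk>{a, b} \<in> E; {b, c} \<in> E; {a, c} \<in> E\<rbrakk> \<Longrightarrow> False"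
    and nocut: "\<And>v S. \<lbrakk>v \<in> V; S \<subseteq> nonnbrs v; S \<noteq> {};
       \<And>x y. \<lbrakk>x \<in> S; y \<in> nonnbrs v; {x, y} \<in> E\<rbrakk> \<Longrightarrow> y \<in> S\<rbrakk> \<Longrightarrow> S = nonnbrs v"
    and notwin: "\<And>u v. \<lbrakk>u \<in> V; v \<in> V; u \<noteq> v\<rbrakk> \<Longrightarrow> nbrs E V u \<noteq> nbrs E V v"
  shows "card E \<le> card (\<Union>v\<in>V. f v) + 1"
proof -
  define K where "K = {v\<in>V. \<exists>w\<in>nonnbrs v. f w \<subseteq> f v}"
  let ?U = "\<Union>v\<in>V. f v"
  have KV: "K \<subseteq> V" by (auto simp: K_def)
  have contains: "f w \<subseteq> f v" if v: "v \<in> K" and w: "w \<in> nonnbrs v" for v w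
  proof -
    define S where "S = {w\<in>nonnbrs v. f w \<subseteq> f v}"
    have vV: "v \<in> V" using v KV by auto
    have "S = nonnbrs v"
    proof (rule nocut[OF vV])
      show "S \<subseteq> nonnbrs v" "S \<noteq> {}" using v by (auto simp: S_def K_def)
      fix x y assume x: "x \<in> S" and y: "y \<in> nonnbrs v" and xy: "{x, y} \<in> E"
      have V: "x \<in> V" "y \<in> V" "x \<noteq> y" using edgeD[OF xy] by auto
      have ov: "overlap (f x) (f y)" using rep[OF V] xy by simp
      have "\<not> overlap (f v) (f y)" using rep[of v y] y vV by (auto simp: nonnbrs_def)
      then have "f y \<subseteq> f v" using ov x unfolding overlap_def S_def by blast
      then show "y \<in> S" using y by (simp add: S_def)
    qed
    then show ?thesis using w by (auto simp: S_def)
  qed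
  have KK: "{u, v} \<in> E" if uv: "u \<in> K" "v \<in> K" "u \<noteq> v" for u v
  proof (rule ccontr)
    assume no: "{u, v} \<notin> E"
    have V: "u \<in> V" "v \<in> V" using uv KV by auto
    have "v \<in> nonnbrs u" "u \<in> nonnbrs v" using no V uv(3) by (auto simp: nonnbrs_def insert_commute)
    then have eq: "f u = f v" using contains[OF uv(1)] contains[OF uv(2)] by blast
    have "{w, u} \<in> E \<longleftrightarrow> {w, v} \<in> E" if w: "w \<in> V" for w
    proof -
      consider "w = u" | "w = v" | "w \<noteq> u" "w \<noteq> v" by blast
      then show ?thesis
      proof cases
        case 1
        then show ?thesis using no edgeD[of u u] by auto
      next
        case 2
        then show ?thesis using no edgeD[of v v] by (auto simp: insert_commute)
      next
        case 3
        then show ?thesis using rep[OF w V(1)] rep[OF w V(2)] eq by simp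
      qed
    qed
    then have "nbrs E V u = nbrs E V v" unfolding nbrs_def by blast
    then show False using notwin[OF V uv(3)] by simp
  qed
  have no_clique: "e = e'" if S: "\<And>x y. \<lbrakk>x \<in> e \<union> e'; y \<in> e \<union> e'; x \<noteq> y\<rbrakk> \<Longrightarrow> {x, y} \<in> E"
    and e: "e \<in> E" "e' \<in> E" for e e'
  proof (rule ccontr)
    assume ne: "e \<noteq> e'"
    obtain x y where xy: "x \<noteq> y" "e = {x, y}" using e(1) by (rule edge_pair)
    have "\<not> e' \<subseteq> e" using ne card_edge[OF e(1)] card_edge[OF e(2)] card_seteq[of e e'] card_ge_0_finite[of e] by auto
    then obtain z where z: "z \<in> e'" "z \<notin> e" by blast
    then show False using tfree[of x y z] S[of x y] S[of y z] S[of x z] xy by auto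
  qed
  have label: "\<exists>c\<in>?U. (\<forall>u\<in>e - K. c \<in> f u) \<and> (\<forall>u\<in>e \<inter> K. c \<notin> f u)" if e: "e \<in> E - induced E K" for e
  proof -
    obtain a b where ab: "a \<noteq> b" "e = {a, b}" using e edge_pair[of e] by auto
    have "\<not> e \<subseteq> K" using e by (auto simp: induced_def)
    then obtain u v where uv: "e = {u, v}" "u \<noteq> v" "u \<notin> K"
      using ab by (cases "a \<in> K") auto
    have V: "u \<in> V" "v \<in> V" using edgeD[of u v] e uv(1) by auto
    have ov: "overlap (f u) (f v)" using rep[OF V uv(2)] e uv(1) by simp
    show ?thesis
    proof (cases "v \<in> K")
      case True
      obtain c where "c \<in> f u" "c \<notin> f v" using ov by (auto simp: overlap_def)
      then show ?thesis using uv True V by (intro bexI[of _ c]) auto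
    next
      case False
      obtain c where "c \<in> f u" "c \<in> f v" using ov by (auto simp: overlap_def)
      then show ?thesis using uv False V by (intro bexI[of _ c]) auto
    qed
  qed
  then obtain c where c: "\<And>e. e \<in> E - induced E K \<Longrightarrow> c e \<in> ?U \<and> (\<forall>u\<in>e - K. c e \<in> f u) \<and> (\<forall>u\<in>e \<inter> K. c e \<notin> f u)"
    by metis
  have "inj_on c (E - induced E K)"
  proof (rule inj_onI)
    fix e e' assume e: "e \<in> E - induced E K" "e' \<in> E - induced E K" "c e = c e'"
    have out: "c e \<in> f x" if "x \<in> e \<union> e'" "x \<notin> K" for x using c[OF e(1)] c[OF e(2)] e(3) that by auto
    have inK: "c e \<notin> f x" if "x \<in> e \<union> e'" "x \<in> K" for x using c[OF e(1)] c[OF e(2)] e(3) that by auto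
    have eV: "e \<union> e' \<subseteq> V" using e edge by blast
    show "e = e'"
    proof (rule no_clique)
      fix x y assume xy: "x \<in> e \<union> e'" "y \<in> e \<union> e'" "x \<noteq> y"
      have V: "x \<in> V" "y \<in> V" using xy eV by auto
      show "{x, y} \<in> E"
      proof (rule ccontr)
        assume no: "{x, y} \<notin> E"
        then have nn: "x \<in> nonnbrs y" "y \<in> nonnbrs x" using V xy(3) by (auto simp: nonnbrs_def insert_commute)
        consider "x \<in> K" "y \<in> K" | "x \<in> K" "y \<notin> K" | "x \<notin> K" "y \<in> K" | "x \<notin> K" "y \<notin> K" by blast
        then show False
        proof cases
          case 1
          then show False using KK xy(3) no by blast
        next
          case 2
          then show False using contains[OF 2(1) nn(2)] out[OF xy(2)] inK[OF xy(1)] by blast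
        next
          case 3
          then show False using contains[OF 3(2) nn(1)] out[OF xy(1)] inK[OF xy(2)] by blast
        next
          case 4
          have "f x \<inter> f y \<noteq> {}" using out[OF xy(1)] out[OF xy(2)] 4 by blast
          moreover have "\<not> f x \<subseteq> f y" "\<not> f y \<subseteq> f x" using 4 nn V by (auto simp: K_def)
          ultimately show False using rep[OF V xy(3)] no by (simp add: overlap_def)
        qed
      qed
    qed (use e in auto)
  qed
  moreover have "c ` (E - induced E K) \<subseteq> ?U" using c by blast
  moreover have "finite ?U" using fin finite_V by blast
  ultimately have le: "card (E - induced E K) \<le> card ?U" by (rule card_inj_on_le)
  have "e = e'" if "e \<in> induced E K" "e' \<in> induced E K" for e e'
    using that KK by (intro no_clique) (auto simp: induced_def)
  then have "card (induced E K) \<le> 1" using card_le_Suc0_iff_eq[OF finite_induced, of K] by auto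
  moreover have "card E = card (E - induced E K) + card (induced E K)"
    using card_Diff_subset[OF finite_induced, of K E] card_mono[OF finite_E, of "induced E K"]
    by (auto simp: induced_def)
  ultimately show ?thesis using le by linarith
qed

end

section \<open>Pseudo-double wheels and their splittings\<close>

text \<open>
  The rim is the cycle \<open>0, ..., 2k - 1\<close>. The outer hub \<open>2k\<close> is joined to the odd vertices. For
  \<open>d = 0\<close> the inner hub \<open>2k + 1\<close> is joined to all even vertices. For \<open>d = 1\<close> it is split: the hub
  \<open>2k + 2\<close> is joined to \<open>0\<close>, \<open>2\<close> and \<open>4\<close>, and the hub \<open>2k + 1\<close> to all even vertices except \<open>2\<close>.
  The hubs share the neighbours \<open>0\<close> and \<open>4\<close>, so the split opens a new quadrangle between them.
  The condition \<open>k \<ge> 4\<close> gives the hub \<open>2k + 1\<close> degree at least three as well.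

  The parameter \<open>d\<close> is a number so that there are \<open>2k + 2 + d\<close> vertices.
\<close>
locale split_wheel =
  fixes k :: nat and d :: nat
  assumes k3: "k \<ge> 3" and k4: "d > 0 \<Longrightarrow> k \<ge> 4" and d1: "d \<le> 1"
begin

definition verts :: "nat set" where
  "verts = {..<2 * k + 2 + d}"

text \<open>
  Rim vertices \<open>0\<close> and \<open>4\<close> have a second hub if \<open>d = 1\<close>.
\<close>
definition hub :: "nat \<Rightarrow> nat" where
  "hub x = (if odd x then 2 * k else if d > 0 \<and> x = 2 then 2 * k + 2 else 2 * k + 1)"

definition wheel_edges :: "nat set set" where
  "wheel_edges = (\<lambda>x. {x, Suc x}) ` {..<2 * k - 1} \<union> {{0, 2 * k - 1}} \<union> (\<lambda>x. {x, hub x}) ` {..<2 * k} \<union>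
     (if d > 0 then {{0, 2 * k + 2}, {4, 2 * k + 2}} else {})"

lemma rim_adj:
  assumes "u < 2 * k" "v < 2 * k"
  shows "{u, v} \<in> wheel_edges \<longleftrightarrow> v = Suc u \<or> u = Suc v \<or> u = 0 \<and> v = 2 * k - 1 \<or> v = 0 \<and> u = 2 * k - 1"
  using assms k3 unfolding wheel_edges_def hub_def
  by (auto simp: doubleton_eq_iff image_iff)

lemma b_adj: "{2 * k, v} \<in> wheel_edges \<longleftrightarrow> v < 2 * k \<and> odd v"
  using k3 unfolding wheel_edges_def hub_def
  by (auto simp: doubleton_eq_iff image_iff)

lemma a_adj: "{2 * k + 1, v} \<in> wheel_edges \<longleftrightarrow> v < 2 * k \<and> even v \<and> \<not> (d > 0 \<and> v = 2)"
  using k3 unfolding wheel_edges_def hub_def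
  by (auto simp: doubleton_eq_iff image_iff)

lemma a'_adj: "{2 * k + 2, v} \<in> wheel_edges \<longleftrightarrow> d > 0 \<and> (v = 0 \<or> v = 2 \<or> v = 4)"
  using k3 unfolding wheel_edges_def hub_def
  by (auto simp: doubleton_eq_iff image_iff)

lemma adj_sym: "{u, v} \<in> wheel_edges \<longleftrightarrow> {v, u} \<in> wheel_edges"
  by (simp add: insert_commute)

lemma adj_rev:
  "{v, 2 * k} \<in> wheel_edges \<longleftrightarrow> v < 2 * k \<and> odd v"
  "{v, 2 * k + 1} \<in> wheel_edges \<longleftrightarrow> v < 2 * k \<and> even v \<and> \<not> (d > 0 \<and> v = 2)"
  "{v, 2 * k + 2} \<in> wheel_edges \<longleftrightarrow> d > 0 \<and> (v = 0 \<or> v = 2 \<or> v = 4)"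
  using b_adj a_adj a'_adj by (simp_all only: adj_sym[of v])

lemmas adj = b_adj a_adj a'_adj adj_rev a_adj[simplified] a'_adj[simplified] adj_rev[simplified]

lemma hub_adj: "x < 2 * k \<Longrightarrow> {x, hub x} \<in> wheel_edges"
  by (auto simp: wheel_edges_def)

lemma in_verts: "x \<in> verts \<longleftrightarrow> x < 2 * k \<or> x = 2 * k \<or> x = 2 * k + 1 \<or> d > 0 \<and> x = 2 * k + 2"
  unfolding verts_def using d1 by auto

text \<open>
  The bipartition that excludes triangles.
\<close>
definition colour :: "nat \<Rightarrow> bool" where
  "colour x \<longleftrightarrow> even x \<and> x \<le> 2 * k"

lemma edge_form:
  assumes "e \<in> wheel_edges"
  shows "\<exists>u\<in>verts. \<exists>v\<in>verts. u \<noteq> v \<and> e = {u, v} \<and> colour u \<and> \<not> colour v"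
proof -
  have *: ?thesis if "e = {u, v}" "u \<in> verts" "v \<in> verts" "colour u \<noteq> colour v" for u v
  proof (cases "colour u")
    case True
    then show ?thesis using that by (intro bexI[of _ u] bexI[of _ v]) auto
  next
    case False
    then show ?thesis using that by (intro bexI[of _ v] bexI[of _ u]) auto
  qed
  from assms consider (path) x where "x < 2 * k - 1" "e = {x, Suc x}" | (close) "e = {0, 2 * k - 1}"
    | (hub) x where "x < 2 * k" "e = {x, hub x}" | (extra) x where "d > 0" "x = 0 \<or> x = 4" "e = {x, 2 * k + 2}"
    unfolding wheel_edges_def by (auto split: if_splits)
  then show ?thesis
  proof cases
    case path
    then show ?thesis by (intro *[of x "Suc x"]) (auto simp: in_verts colour_def)
  next
    case close
    then show ?thesis using k3 by (intro *[of 0 "2 * k - 1"]) (auto simp: in_verts colour_def)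
  next
    case hub
    then show ?thesis by (intro *[of x "hub x"]) (auto simp: in_verts colour_def hub_def)
  next
    case extra
    then show ?thesis using k4 by (intro *[of x "2 * k + 2"]) (auto simp: in_verts colour_def)
  qed
qed

sublocale sgraph verts wheel_edges
proof
  show "finite verts" by (simp add: verts_def)
  show "\<exists>u\<in>verts. \<exists>v\<in>verts. u \<noteq> v \<and> e = {u, v}" if "e \<in> wheel_edges" for e
    using edge_form[OF that] by blast
qed

lemma colour_adj: "{u, v} \<in> wheel_edges \<Longrightarrow> colour u \<noteq> colour v"
  using edge_form[of "{u, v}"] by (auto simp: doubleton_eq_iff)

lemma no_triangle: "\<lbrakk>{x, y} \<in> wheel_edges; {y, z} \<in> wheel_edges; {x, z} \<in> wheel_edges\<rbrakk> \<Longrightarrow> False"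
  using colour_adj by blast

lemma card_verts: "card verts = 2 * k + 2 + d"
  by (simp add: verts_def)

lemma card_wheel_edges: "card wheel_edges \<ge> 2 * card verts - 4"
proof -
  let ?A = "(\<lambda>x. {x, Suc x}) ` {..<2 * k - 1}" and ?B = "{{0, 2 * k - 1}}"
    and ?C = "(\<lambda>x. {x, hub x}) ` {..<2 * k}"
  have "inj_on (\<lambda>x. {x, Suc x}) {..<2 * k - 1}" by (auto simp: inj_on_def doubleton_eq_iff)
  then have A: "card ?A = 2 * k - 1" by (simp add: card_image)
  have "inj_on (\<lambda>x. {x, hub x}) {..<2 * k}" by (auto simp: inj_on_def doubleton_eq_iff hub_def split: if_splits)
  then have C: "card ?C = 2 * k" by (simp add: card_image)
  have "?A \<inter> ?B = {}" using k3 by (auto simp: doubleton_eq_iff)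
  then have "card (?A \<union> ?B) = 2 * k" using A k3 by (subst card_Un_disjoint) auto
  moreover have "(?A \<union> ?B) \<inter> ?C = {}" using k3 by (auto simp: doubleton_eq_iff hub_def split: if_splits)
  ultimately have "card (?A \<union> ?B \<union> ?C) = 4 * k" using C by (subst card_Un_disjoint) auto
  moreover define X where "X = ?A \<union> ?B \<union> ?C"
  ultimately have X: "card X = 4 * k" "finite X" by simp_all
  have out: "{z, 2 * k + 2} \<notin> X" if z: "z = 0 \<or> z = 4" for z
  proof -
    have "{z, 2 * k + 2} \<notin> ?A" "{z, 2 * k + 2} \<notin> ?B" "{z, 2 * k + 2} \<notin> ?C"
      using z by (auto simp: doubleton_eq_iff image_iff hub_def)
    then show ?thesis by (simp only: X_def Un_iff simp_thms)
  qed
  show ?thesis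
  proof (cases "d > 0")
    case True
    have "wheel_edges = insert {0, 2 * k + 2} (insert {4, 2 * k + 2} X)"
      using True by (simp add: wheel_edges_def X_def insert_commute)
    moreover have "{0, 2 * k + 2} \<noteq> {4, 2 * k + 2}" by (simp add: doubleton_eq_iff)
    ultimately have "card wheel_edges = 4 * k + 2" using X out[of 0] out[of 4] by simp
    then show ?thesis using d1 by (simp add: card_verts)
  next
    case False
    have eq: "wheel_edges = X" by (simp only: wheel_edges_def X_def False if_False Un_empty_right)
    have "card wheel_edges = 4 * k" unfolding eq by (rule X(1))
    moreover have "2 * card verts - 4 = 4 * k" unfolding card_verts using False by simp
    ultimately show ?thesis by (simp only: order_refl)
  qed
qed

text \<open>
  One of the two neighbours of \<open>x\<close> on the rim is not a neighbour of \<open>v\<close>, since otherwise the rim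
  would be a cycle of length four.
\<close>
lemma rim_escape:
  assumes "v < 2 * k" "x < 2 * k" "x \<noteq> v" "even x = even v"
  obtains y where "y < 2 * k" "{x, y} \<in> wheel_edges" "y \<noteq> v" "{v, y} \<notin> wheel_edges" "even y \<noteq> even x"
proof -
  define y1 where "y1 = (if x = 2 * k - 1 then 0 else Suc x)"
  define y2 where "y2 = (if x = 0 then 2 * k - 1 else x - 1)"
  have y: "y1 < 2 * k" "y2 < 2 * k" "even y1 \<noteq> even x" "even y2 \<noteq> even x"
    using assms k3 by (auto simp: y1_def y2_def)
  have e: "{x, y1} \<in> wheel_edges" "{x, y2} \<in> wheel_edges"
    using assms(2) y(1,2) by (auto simp: rim_adj y1_def y2_def)
  have "{v, y1} \<notin> wheel_edges \<or> {v, y2} \<notin> wheel_edges"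
  proof (rule ccontr)
    assume "\<not> ?thesis"
    then have a: "y1 = Suc v \<or> v = Suc y1 \<or> v = 0 \<and> y1 = 2 * k - 1 \<or> y1 = 0 \<and> v = 2 * k - 1"
      "y2 = Suc v \<or> v = Suc y2 \<or> v = 0 \<and> y2 = 2 * k - 1 \<or> y2 = 0 \<and> v = 2 * k - 1"
      using rim_adj[OF assms(1) y(1)] rim_adj[OF assms(1) y(2)] by blast+
    consider "x = 0" | "x = 2 * k - 1" | "x \<noteq> 0" "x \<noteq> 2 * k - 1" by blast
    then show False
    proof cases
      case 1
      then have "y1 = 1" "y2 = 2 * k - 1" using k3 by (auto simp: y1_def y2_def)
      then show False using a assms(1,3) 1 k3 by (elim disjE conjE) linarith+
    next
      case 2
      then have "y1 = 0" "y2 = 2 * k - 2" using k3 by (auto simp: y1_def y2_def)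
      then show False using a assms(1,3) 2 k3 by (elim disjE conjE) linarith+
    next
      case 3
      then have "y1 = Suc x" "y2 = x - 1" by (auto simp: y1_def y2_def)
      then show False using a assms(1,3) 3 k3 by (elim disjE conjE) linarith+
    qed
  qed
  then show thesis
  proof
    assume n: "{v, y1} \<notin> wheel_edges"
    have "y1 \<noteq> v" using y(3) assms(4) by auto
    then show thesis by (rule that[OF y(1) e(1) _ n y(3)])
  next
    assume n: "{v, y2} \<notin> wheel_edges"
    have "y2 \<noteq> v" using y(4) assms(4) by auto
    then show thesis by (rule that[OF y(2) e(2) _ n y(4)])
  qed
qed

text \<open>
  All non-neighbours of \<open>v\<close> are linked to one of them, called \<open>r\<close>, by paths that avoid \<open>v\<close> and
  its neighbours, so a set closed under adjacency contains all or none. If \<open>v\<close> is an even rim vertex or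
  an inner hub, \<open>r\<close> is the outer hub, which is adjacent to all odd rim vertices. If \<open>v\<close> is an odd rim vertex, \<open>r\<close> is
  the inner hub \<open>2k + 1\<close>; the other inner hub is linked to it through \<open>0\<close> or \<open>4\<close>, as no odd rim
  vertex has both as neighbours. If \<open>v\<close> is the outer hub, the inner hubs are linked through
  \<open>r = 0\<close>.
\<close>
lemma no_star_cut:
  assumes v: "v \<in> verts" and S: "S \<subseteq> nonnbrs v" "S \<noteq> {}"
    and closed: "\<And>x y. \<lbrakk>x \<in> S; y \<in> nonnbrs v; {x, y} \<in> wheel_edges\<rbrakk> \<Longrightarrow> y \<in> S"
  shows "S = nonnbrs v"
proof -
  have step: "x \<in> S \<longleftrightarrow> y \<in> S" if "{x, y} \<in> wheel_edges" "x \<in> nonnbrs v" "y \<in> nonnbrs v" for x y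
    using closed[of x y] closed[of y x] that by (auto simp: insert_commute)
  have "\<exists>r. \<forall>x\<in>nonnbrs v. x \<in> S \<longleftrightarrow> r \<in> S"
  proof -
    consider (odd) "v < 2 * k" "odd v" | (even) "v < 2 * k" "even v" | (b) "v = 2 * k" | (a) "v = 2 * k + 1"
      | (a') "d > 0" "v = 2 * k + 2" using v by (auto simp: in_verts)
    then show ?thesis
    proof cases
      case odd
      have hubs: "2 * k + 1 \<in> nonnbrs v" "d > 0 \<Longrightarrow> 2 * k + 2 \<in> nonnbrs v"
        using odd odd_pos[OF odd(2)] by (auto simp: nonnbrs_def in_verts adj)
      have hub2: "2 * k + 2 \<in> S \<longleftrightarrow> 2 * k + 1 \<in> S" if "d > 0"
      proof -
        have "0 \<in> nonnbrs v \<or> 4 \<in> nonnbrs v"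
        proof -
          have "v \<noteq> 0" "v \<noteq> 4" using odd(2) by (metis even_zero, metis even_numeral)
          then show ?thesis
            using odd k4[OF that] rim_adj[of v 0] rim_adj[of v 4] by (auto simp: nonnbrs_def in_verts)
        qed
        then obtain z where z: "z \<in> nonnbrs v" "z = 0 \<or> z = 4" by blast
        have "{2 * k + 2, z} \<in> wheel_edges" "{2 * k + 1, z} \<in> wheel_edges"
          using z(2) that k4 by (auto simp: adj)
        then show ?thesis using step z(1) hubs that by metis
      qed
      have ev: "x \<in> S \<longleftrightarrow> 2 * k + 1 \<in> S" if x: "x \<in> nonnbrs v" "x < 2 * k" "even x" for x
      proof -
        have "hub x \<in> nonnbrs v" using hubs x(3) by (auto simp: hub_def)
        then have "x \<in> S \<longleftrightarrow> hub x \<in> S" using step[OF hub_adj] x by blast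
        then show ?thesis using hub2 x(3) by (auto simp: hub_def split: if_splits)
      qed
      have "x \<in> S \<longleftrightarrow> 2 * k + 1 \<in> S" if x: "x \<in> nonnbrs v" for x
      proof -
        consider "x < 2 * k" "even x" | "x < 2 * k" "odd x" | "x = 2 * k + 1" | "d > 0" "x = 2 * k + 2"
          using x odd by (auto simp: nonnbrs_def in_verts adj)
        then show ?thesis
        proof cases
          case 2
          have xv: "x \<noteq> v" using x by (simp add: nonnbrs_def)
          obtain y where y: "y < 2 * k" "{x, y} \<in> wheel_edges" "y \<noteq> v" "{v, y} \<notin> wheel_edges" "even y \<noteq> even x"
            by (rule rim_escape[OF odd(1) 2(1) xv]) (use odd(2) 2(2) in auto)
          then have "y \<in> nonnbrs v" "even y" using 2(2) by (auto simp: nonnbrs_def in_verts)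
          then show ?thesis using step[OF y(2) x] ev y(1) by blast
        qed (use ev[OF x] hub2 in auto)
      qed
      then show ?thesis by blast
    next
      case even
      have b: "2 * k \<in> nonnbrs v" using even by (auto simp: nonnbrs_def in_verts adj)
      have od: "x \<in> S \<longleftrightarrow> 2 * k \<in> S" if "x \<in> nonnbrs v" "x < 2 * k" "odd x" for x
        using step[of x "2 * k"] that b by (auto simp: adj)
      have ev: "x \<in> S \<longleftrightarrow> 2 * k \<in> S" if x: "x \<in> nonnbrs v" "x < 2 * k" "even x" for x
      proof -
        have xv: "x \<noteq> v" using x by (simp add: nonnbrs_def)
        obtain y where y: "y < 2 * k" "{x, y} \<in> wheel_edges" "y \<noteq> v" "{v, y} \<notin> wheel_edges" "even y \<noteq> even x"
          by (rule rim_escape[OF even(1) x(2) xv]) (use even(2) x(3) in auto)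
        then have "y \<in> nonnbrs v" "odd y" using x(3) by (auto simp: nonnbrs_def in_verts)
        then show ?thesis using step[OF y(2) x(1)] od y(1) by blast
      qed
      have "x \<in> S \<longleftrightarrow> 2 * k \<in> S" if x: "x \<in> nonnbrs v" for x
      proof -
        consider "x < 2 * k" "even x" | "x < 2 * k" "odd x" | "x = 2 * k" | "x = 2 * k + 1 \<or> d > 0 \<and> x = 2 * k + 2"
          using x by (auto simp: nonnbrs_def in_verts)
        then show ?thesis
        proof cases
          case 4
          have x0: "{x, 0} \<in> wheel_edges" using 4 k3 by (auto simp: adj)
          then have "{0, x} \<in> wheel_edges" by (simp only: adj_sym[of 0 x])
          moreover have "{v, x} \<notin> wheel_edges" using x by (simp add: nonnbrs_def)
          ultimately have "v \<noteq> 0" by metis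
          then have "0 \<in> nonnbrs v" using even k3 rim_adj[of v 0] by (auto simp: nonnbrs_def in_verts)
          then show ?thesis using step[OF x0 x] ev[of 0] k3 by simp
        qed (use ev[OF x] od[OF x] in auto)
      qed
      then show ?thesis by blast
    next
      case b
      have z: "0 \<in> nonnbrs v" using b k3 by (auto simp: nonnbrs_def in_verts adj)
      have hubs: "2 * k + 1 \<in> nonnbrs v" "d > 0 \<Longrightarrow> 2 * k + 2 \<in> nonnbrs v"
        using b by (auto simp: nonnbrs_def in_verts adj)
      have hb: "x \<in> S \<longleftrightarrow> 0 \<in> S" if "x = 2 * k + 1 \<or> d > 0 \<and> x = 2 * k + 2" for x
        using that step[of x 0] hubs z k3 by (auto simp: adj)
      have "x \<in> S \<longleftrightarrow> 0 \<in> S" if x: "x \<in> nonnbrs v" for x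
      proof -
        consider "x < 2 * k" "even x" | "x = 2 * k + 1 \<or> d > 0 \<and> x = 2 * k + 2"
          using x b by (auto simp: nonnbrs_def in_verts adj)
        then show ?thesis
        proof cases
          case 1
          have h: "hub x = 2 * k + 1 \<or> d > 0 \<and> hub x = 2 * k + 2" using 1(2) by (auto simp: hub_def)
          then have "hub x \<in> nonnbrs v" using hubs by auto
          then show ?thesis using step[OF hub_adj[OF 1(1)] x] hb[OF h] by blast
        qed (use hb in blast)
      qed
      then show ?thesis by blast
    next
      case a
      have b: "2 * k \<in> nonnbrs v" using a k3 by (auto simp: nonnbrs_def in_verts adj)
      have od: "x \<in> S \<longleftrightarrow> 2 * k \<in> S" if "x < 2 * k" "odd x" for x
        using step[of x "2 * k"] that b a by (auto simp: adj nonnbrs_def in_verts)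
      have two: "2 \<in> S \<longleftrightarrow> 2 * k \<in> S" if "d > 0"
        using step[of 2 1] od[of 1] that a k3 rim_adj[of 2 1] by (auto simp: adj nonnbrs_def in_verts)
      have "x \<in> S \<longleftrightarrow> 2 * k \<in> S" if x: "x \<in> nonnbrs v" for x
      proof -
        consider "x < 2 * k" "odd x" | "x = 2 * k" | "d > 0" "x = 2" | "d > 0" "x = 2 * k + 2"
          using x a by (auto simp: nonnbrs_def in_verts adj)
        then show ?thesis
        proof cases
          case 4
          have "2 \<in> nonnbrs v" using 4 a k3 by (auto simp: nonnbrs_def in_verts adj)
          then show ?thesis using step[of x 2] x two 4 by (auto simp: adj)
        qed (use od two in auto)
      qed
      then show ?thesis by blast
    next
      case a'
      have b: "2 * k \<in> nonnbrs v" using a' k4 by (auto simp: nonnbrs_def in_verts adj)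
      have od: "x \<in> S \<longleftrightarrow> 2 * k \<in> S" if "x < 2 * k" "odd x" for x
      proof -
        have "x \<noteq> 0 \<and> x \<noteq> 2 \<and> x \<noteq> 4" using that(2) by (metis even_zero even_numeral)
        then show ?thesis using step[of x "2 * k"] that b a' by (auto simp: adj nonnbrs_def in_verts)
      qed
      have ev: "x \<in> S \<longleftrightarrow> 2 * k \<in> S" if x: "x \<in> nonnbrs v" "x < 2 * k" "even x" for x
      proof -
        have "Suc x < 2 * k" using x(2,3) by presburger
        then have "{x, Suc x} \<in> wheel_edges" "Suc x \<in> nonnbrs v"
          using x a' rim_adj[of x "Suc x"] by (auto simp: nonnbrs_def in_verts adj)
        then show ?thesis using step[of x "Suc x"] od[of "Suc x"] x \<open>Suc x < 2 * k\<close> by simp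
      qed
      have six: "6 \<in> nonnbrs v" using a' k4 by (auto simp: nonnbrs_def in_verts adj)
      have "x \<in> S \<longleftrightarrow> 2 * k \<in> S" if x: "x \<in> nonnbrs v" for x
      proof -
        consider "x < 2 * k" "odd x" | "x < 2 * k" "even x" | "x = 2 * k" | "x = 2 * k + 1"
          using x a' by (auto simp: nonnbrs_def in_verts)
        then show ?thesis
        proof cases
          case 4
          have k: "6 < 2 * k" using k4[OF a'(1)] by linarith
          then have "{2 * k + 1, 6} \<in> wheel_edges" by (simp add: adj)
          then have "x \<in> S \<longleftrightarrow> 6 \<in> S" using step[of x 6] x six unfolding 4 by blast
          moreover have "6 \<in> S \<longleftrightarrow> 2 * k \<in> S" using ev[OF six k] by simp
          ultimately show ?thesis by blast
        next
          case 1
          then show ?thesis by (rule od)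
        next
          case 2
          then show ?thesis by (rule ev[OF x])
        next
          case 3
          then show ?thesis by simp
        qed
      qed
      then show ?thesis by blast
    qed
  qed
  then obtain r where r: "\<And>x. x \<in> nonnbrs v \<Longrightarrow> x \<in> S \<longleftrightarrow> r \<in> S" by blast
  obtain s where "s \<in> S" using S(2) by blast
  then have "r \<in> S" using r S(1) by blast
  then show ?thesis using r S(1) by blast
qed

text \<open>
  If \<open>u\<close> and \<open>v\<close> had the same neighbours, \<open>v\<close> would be isolated among the non-neighbours of \<open>u\<close>, and
  hence the only one. But there are two non-neighbours in the colour class of \<open>u\<close>.
\<close>
lemma no_twins:
  assumes uv: "u \<in> verts" "v \<in> verts" "u \<noteq> v"
  shows "nbrs wheel_edges verts u \<noteq> nbrs wheel_edges verts v"
proof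
  assume eq: "nbrs wheel_edges verts u = nbrs wheel_edges verts v"
  have iff: "{x, u} \<in> wheel_edges \<longleftrightarrow> {x, v} \<in> wheel_edges" if "x \<in> verts" for x
    using eq that by (auto simp: nbrs_def)
  have nv: "v \<in> nonnbrs u"
    using iff[OF uv(2)] edgeD[of v v] uv by (auto simp: nonnbrs_def insert_commute)
  have "{v} = nonnbrs u"
  proof (rule no_star_cut[OF uv(1)])
    show "{v} \<subseteq> nonnbrs u" "{v} \<noteq> {}" using nv by auto
    fix x y assume "x \<in> {v}" "y \<in> nonnbrs u" "{x, y} \<in> wheel_edges"
    then show "y \<in> {v}" using iff[of y] by (auto simp: nonnbrs_def insert_commute)
  qed
  moreover have "\<exists>s t. s \<noteq> t \<and> s \<in> nonnbrs u \<and> t \<in> nonnbrs u"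
  proof -
    have same: "x \<in> nonnbrs u" if "x \<in> verts" "x \<noteq> u" "colour x = colour u" for x
      using that colour_adj[of u x] by (auto simp: nonnbrs_def)
    have pick: ?thesis if xyz: "x \<in> verts" "y \<in> verts" "z \<in> verts" "colour x = colour u" "colour y = colour u"
      "colour z = colour u" "x \<noteq> y" "y \<noteq> z" "x \<noteq> z" for x y z
    proof -
      consider "u = x" | "u = y" | "u \<noteq> x" "u \<noteq> y" by blast
      then show ?thesis
      proof cases
        case 1
        have "y \<noteq> u" "z \<noteq> u" using 1 xyz(7-9) by metis+
        then have "y \<in> nonnbrs u" "z \<in> nonnbrs u" using same xyz(1-6) by metis+
        then show ?thesis using xyz(7-9) by metis
      next
        case 2
        have "x \<noteq> u" "z \<noteq> u" using 2 xyz(7-9) by metis+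
        then have "x \<in> nonnbrs u" "z \<in> nonnbrs u" using same xyz(1-6) by metis+
        then show ?thesis using xyz(7-9) by metis
      next
        case 3
        have "x \<noteq> u" "y \<noteq> u" using 3 xyz(7-9) by metis+
        then have "x \<in> nonnbrs u" "y \<in> nonnbrs u" using same xyz(1-6) by metis+
        then show ?thesis using xyz(7-9) by metis
      qed
    qed
    show ?thesis
    proof (cases "colour u")
      case True
      have "colour 0" "colour 2" "colour 4" "0 \<in> verts" "2 \<in> verts" "4 \<in> verts"
        using k3 by (auto simp: colour_def in_verts)
      then show ?thesis using True by (intro pick[of 0 2 4]) simp_all
    next
      case False
      have "\<not> colour 1" "\<not> colour 3" "\<not> colour 5" "1 \<in> verts" "3 \<in> verts" "5 \<in> verts"
        using k3 by (auto simp: colour_def in_verts)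
      then show ?thesis using False by (intro pick[of 1 3 5]) simp_all
    qed
  qed
  ultimately show False by (metis singletonD)
qed

definition wheel_graph :: "nat pair_pre_digraph" where
  "wheel_graph = \<lparr>pverts = verts, parcs = {(u, v). {u, v} \<in> wheel_edges}\<rparr>"

lemma pair_graph_wheel: "pair_graph wheel_graph"
proof
  have wf: "u \<in> verts \<and> v \<in> verts \<and> u \<noteq> v" if "{u, v} \<in> wheel_edges" for u v using edgeD[OF that] .
  show "\<And>e. e \<in> parcs wheel_graph \<Longrightarrow> fst e \<in> pverts wheel_graph"
    "\<And>e. e \<in> parcs wheel_graph \<Longrightarrow> snd e \<in> pverts wheel_graph"
    "\<And>e. e \<in> parcs wheel_graph \<Longrightarrow> fst e \<noteq> snd e"
    using wf by (auto simp: wheel_graph_def)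
  show "finite (pverts wheel_graph)" using finite_V by (simp add: wheel_graph_def)
  have "parcs wheel_graph \<subseteq> verts \<times> verts" using wf by (auto simp: wheel_graph_def)
  then show "finite (parcs wheel_graph)" using finite_V finite_subset by blast
  have "sym (parcs wheel_graph)" by (auto simp: wheel_graph_def sym_def insert_commute)
  then show "symmetric (with_proj wheel_graph)" by (simp add: symmetric_def)
qed

lemma edges_wheel: "edges wheel_graph = wheel_edges"
  using edge by (fastforce simp: edges_def wheel_graph_def)

lemma overlap_number_wheel_ge: "overlap_number wheel_graph \<ge> 2 * card verts - 5"
proof -
  obtain f :: "nat \<Rightarrow> nat set" where f: "overlap_representation wheel_graph f" "\<forall>v\<in>pverts wheel_graph. finite (f v)"
    "representation_size wheel_graph f = overlap_number wheel_graph"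
    by (rule overlap_number_attained[OF pair_graph_wheel])
  have "card wheel_edges \<le> card (\<Union>v\<in>verts. f v) + 1"
  proof (rule card_edges_le_representation)
    show "\<And>u v. \<lbrakk>u \<in> verts; v \<in> verts; u \<noteq> v\<rbrakk> \<Longrightarrow> {u, v} \<in> wheel_edges \<longleftrightarrow> overlap (f u) (f v)"
      using f(1) by (simp add: overlap_representation_def wheel_graph_def)
    show "\<And>v. v \<in> verts \<Longrightarrow> finite (f v)" using f(2) by (simp add: wheel_graph_def)
  qed (fact no_triangle no_star_cut no_twins)+
  then show ?thesis using card_wheel_edges f(3) by (simp add: representation_size_def wheel_graph_def)
qed

end

section \<open>Straight-line drawings\<close>

text \<open>
  That no vertex lies inside another edge follows from the crossing condition, applied to that edge
  and an edge at the vertex.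
\<close>
lemma planar_if_straight_drawing:
  fixes p :: "'a \<Rightarrow> complex"
  assumes G: "pair_graph G" and inj: "inj_on p (pverts G)"
    and cross: "\<And>e e' z. \<lbrakk>e \<in> edges G; e' \<in> edges G; e \<noteq> e';
       z \<in> convex hull (p ` e); z \<in> convex hull (p ` e')\<rbrakk> \<Longrightarrow> z \<in> p ` (e \<inter> e')"
    and covered: "\<And>v. v \<in> pverts G \<Longrightarrow> \<exists>e\<in>edges G. v \<in> e"
  shows "planar G"
proof -
  interpret sgraph "pverts G" "edges G" by (rule sgraph_of_pair_graph[OF G])
  have "\<exists>a b. a \<noteq> b \<and> e = {a, b}" if "e \<in> edges G" for e
    using that by (rule edge_pair) blast
  then obtain a b where ab: "\<And>e. e \<in> edges G \<Longrightarrow> a e \<noteq> b e \<and> e = {a e, b e}" by metis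
  define \<gamma> where "\<gamma> e = linepath (p (a e)) (p (b e))" for e
  have im: "path_image (\<gamma> e) = convex hull (p ` e)" if "e \<in> edges G" for e
  proof -
    have "p ` e = {p (a e), p (b e)}" using ab[OF that] by (metis image_empty image_insert)
    then show ?thesis by (simp add: \<gamma>_def segment_convex_hull)
  qed
  have "plane_drawing G p \<gamma>"
    unfolding plane_drawing_def
  proof (intro conjI ballI impI)
    show "inj_on p (pverts G)" by fact
    fix e assume e: "e \<in> edges G"
    have V: "a e \<in> pverts G" "b e \<in> pverts G" using edgeD[of "a e" "b e"] ab[OF e] e by simp_all
    have "p (a e) \<noteq> p (b e)" using inj_onD[OF inj _ V] ab[OF e] by blast
    then show "arc (\<gamma> e)" by (simp add: \<gamma>_def arc_linepath)
    have "p ` e = {p (a e), p (b e)}" using ab[OF e] by (metis image_empty image_insert)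
    then show "{pathstart (\<gamma> e), pathfinish (\<gamma> e)} = p ` e" by (simp add: \<gamma>_def)
    show "(path_image (\<gamma> e) - p ` e) \<inter> path_image (\<gamma> e') = {}" if e': "e' \<in> edges G" "e \<noteq> e'" for e'
      using cross[OF e e'] unfolding im[OF e] im[OF e'(1)] by blast
    show "(path_image (\<gamma> e) - p ` e) \<inter> p ` pverts G = {}"
    proof -
      have "p v \<notin> path_image (\<gamma> e) - p ` e" if v: "v \<in> pverts G" for v
      proof
        assume z: "p v \<in> path_image (\<gamma> e) - p ` e"
        obtain e' where e': "e' \<in> edges G" "v \<in> e'" using covered[OF v] by blast
        then have "e \<noteq> e'" using z by blast
        moreover have "p v \<in> convex hull (p ` e')" using e'(2) by (intro hull_inc) simp
        moreover have "p v \<in> convex hull (p ` e)" using z im[OF e] by blast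
        ultimately have "p v \<in> p ` (e \<inter> e')" using cross[OF e e'(1)] by blast
        then show False using z by blast
      qed
      then show ?thesis by blast
    qed
  qed
  then show ?thesis by (auto simp: planar_def)
qed

context split_wheel begin

text \<open>
  The rim vertices other than \<open>0\<close> are on the real axis, with the outer hub below it. The inner hubs are at
  height one and the vertex \<open>0\<close> is above them at height two. The inner hubs must be placed between
  the points \<open>2\<close> and \<open>k + 1\<close> where the edges from \<open>0\<close> to \<open>1\<close> and to \<open>2k - 1\<close> pass through height
  one, and the hub of \<open>0\<close>, \<open>2\<close>, \<open>4\<close> to the left of the other one; \<open>3\<close> and \<open>7/2\<close> do for all \<open>k \<ge> 3\<close>.
\<close>
definition pos :: "nat \<Rightarrow> complex" where
  "pos v = (if v = 0 then Complex 3 2 else if v < 2 * k then Complex (real v) 0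
     else if v = 2 * k then Complex 3 (-1) else if v = 2 * k + 1 then Complex (7/2) 1 else Complex 3 1)"

lemma pos_simps:
  "pos 0 = Complex 3 2" "0 < v \<Longrightarrow> v < 2 * k \<Longrightarrow> pos v = Complex (real v) 0"
  "pos (2 * k) = Complex 3 (-1)" "pos (2 * k + 1) = Complex (7/2) 1" "pos (2 * k + 2) = Complex 3 1"
  using k3 by (auto simp: pos_def)

text \<open>
  The segments of the drawing by kind, with the real part as an affine function of the imaginary
  part except on the axis. The number of the kind only serves to consider each pair of kinds once.
\<close>
inductive lies_on :: "nat \<Rightarrow> nat set \<Rightarrow> complex \<Rightarrow> bool" where
  path: "\<lbrakk>0 < x; Suc x < 2 * k; Im z = 0; real x \<le> Re z; Re z \<le> real x + 1\<rbrakk> \<Longrightarrow> lies_on 0 {x, Suc x} z"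
| left: "\<lbrakk>0 \<le> Im z; Im z \<le> 2; Re z = 1 + Im z\<rbrakk> \<Longrightarrow> lies_on 1 {0, 1} z"
| right: "\<lbrakk>0 \<le> Im z; Im z \<le> 2; Re z = (2 * real k - 1) - (real k - 2) * Im z\<rbrakk> \<Longrightarrow> lies_on 2 {0, 2 * k - 1} z"
| low: "\<lbrakk>x < 2 * k; odd x; - 1 \<le> Im z; Im z \<le> 0; Re z = real x + (real x - 3) * Im z\<rbrakk> \<Longrightarrow> lies_on 3 {x, 2 * k} z"
| fan: "\<lbrakk>0 < x; x < 2 * k - 1; even x; d > 0 \<longrightarrow> x \<noteq> 2; 0 \<le> Im z; Im z \<le> 1;
     Re z = real x * (1 - Im z) + 7 / 2 * Im z\<rbrakk> \<Longrightarrow> lies_on 4 {x, 2 * k + 1} z"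
| fan': "\<lbrakk>d > 0; x = 2 \<or> x = 4; 0 \<le> Im z; Im z \<le> 1;
     Re z = real x * (1 - Im z) + 3 * Im z\<rbrakk> \<Longrightarrow> lies_on 5 {x, 2 * k + 2} z"
| top: "\<lbrakk>1 \<le> Im z; Im z \<le> 2; Re z = 4 - Im z / 2\<rbrakk> \<Longrightarrow> lies_on 6 {0, 2 * k + 1} z"
| top': "\<lbrakk>d > 0; 1 \<le> Im z; Im z \<le> 2; Re z = 3\<rbrakk> \<Longrightarrow> lies_on 7 {0, 2 * k + 2} z"

lemma hull_pairE:
  fixes a b :: complex
  assumes "z \<in> convex hull {a, b}"
  obtains t where "0 \<le> t" "t \<le> 1" "Re z = (1 - t) * Re a + t * Re b" "Im z = (1 - t) * Im a + t * Im b"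
  using assms unfolding segment_convex_hull[symmetric] closed_segment_def by auto

lemma lies_on_edge:
  assumes e: "e \<in> wheel_edges" and z: "z \<in> convex hull (pos ` e)"
  shows "\<exists>i. lies_on i e z"
proof -
  from e consider (path) x where "0 < x" "Suc x < 2 * k" "e = {x, Suc x}" | (left) "e = {0, 1}" | (close) "e = {0, 2 * k - 1}"
    | (low) x where "x < 2 * k" "odd x" "e = {x, 2 * k}"
    | (fan) x where "0 < x" "x < 2 * k - 1" "even x" "d > 0 \<longrightarrow> x \<noteq> 2" "e = {x, 2 * k + 1}"
    | (fan') x where "d > 0" "x = 2 \<or> x = 4" "e = {x, 2 * k + 2}"
    | (top) "e = {0, 2 * k + 1}" | (top') "d > 0" "e = {0, 2 * k + 2}"
  proof -
    from e consider (p) x where "x < 2 * k - 1" "e = {x, Suc x}" | (c) "e = {0, 2 * k - 1}"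
      | (h) x where "x < 2 * k" "e = {x, hub x}" | (x) x where "d > 0" "x = 0 \<or> x = 4" "e = {x, 2 * k + 2}"
      unfolding wheel_edges_def by (auto split: if_splits)
    then show thesis
    proof cases
      case p
      then show thesis using that(1)[of x] that(2) by (cases "x = 0") auto
    next
      case c
      then show thesis by (rule that(3))
    next
      case h
      consider "odd x" | "x = 0" | "even x" "0 < x" "d > 0" "x = 2" | "even x" "0 < x" "\<not> (d > 0 \<and> x = 2)" by blast
      then show thesis
      proof cases
        case 1
        then have "e = {x, 2 * k}" using h(2) by (simp add: hub_def)
        then show thesis by (rule that(4)[OF h(1) 1])
      next
        case 2
        then have "e = {0, 2 * k + 1}" using h(2) by (simp add: hub_def)
        then show thesis by (rule that(7))
      next
        case 3
        then have "e = {x, 2 * k + 2}" using h(2) by (simp add: hub_def)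
        then show thesis using that(6)[of x] 3 by blast
      next
        case 4
        then have "e = {x, 2 * k + 1}" using h(2) by (auto simp: hub_def)
        moreover have "x < 2 * k - 1" using h(1) 4(1) k3 by presburger
        ultimately show thesis using that(5)[of x] 4 by blast
      qed
    next
      case x
      then show thesis using that(6)[of 4] that(8) by blast
    qed
  qed
  then show ?thesis
  proof cases
    case path
    from z obtain t where t: "0 \<le> t" "t \<le> 1" "Re z = real x + t" "Im z = 0"
      unfolding path(3) using path(1,2) by (auto elim!: hull_pairE simp: pos_simps algebra_simps)
    then show ?thesis unfolding path(3) using path(1,2) by (intro exI[of _ 0] lies_on.path) auto
  next
    case left
    from z obtain t where t: "0 \<le> t" "t \<le> 1" "Re z = (1 - t) * 3 + t" "Im z = (1 - t) * 2"
      unfolding left using k3 by (auto elim!: hull_pairE simp: pos_simps)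
    then show ?thesis unfolding left by (intro exI[of _ 1] lies_on.left) auto
  next
    case close
    have "pos (2 * k - 1) = Complex (2 * real k - 1) 0" using k3 by (subst pos_simps) (auto simp: of_nat_diff)
    with z obtain t where t: "0 \<le> t" "t \<le> 1" "Re z = (1 - t) * 3 + t * (2 * real k - 1)" "Im z = (1 - t) * 2"
      unfolding close by (auto elim!: hull_pairE simp: pos_simps(1))
    have "Re z = (2 * real k - 1) - (real k - 2) * Im z" unfolding t(3,4) by (simp add: algebra_simps)
    then show ?thesis unfolding close using t by (intro exI[of _ 2] lies_on.right) auto
  next
    case low
    have "0 < x" using low(2) by (rule odd_pos)
    with z low(1) obtain t where t: "0 \<le> t" "t \<le> 1" "Re z = (1 - t) * real x + t * 3" "Im z = - t"
      unfolding low(3) by (auto elim!: hull_pairE simp: pos_simps)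
    have "Re z = real x + (real x - 3) * Im z" unfolding t(3,4) by (simp add: algebra_simps)
    then show ?thesis unfolding low(3) using t low(1,2) by (intro exI[of _ 3] lies_on.low) auto
  next
    case fan
    from z fan(1,2) obtain t where t: "0 \<le> t" "t \<le> 1" "Re z = (1 - t) * real x + t * (7 / 2)" "Im z = t"
      unfolding fan(5) by (auto elim!: hull_pairE simp: pos_simps[simplified] pos_simps)
    have "Re z = real x * (1 - Im z) + 7 / 2 * Im z" unfolding t(3,4) by (simp add: algebra_simps)
    then show ?thesis unfolding fan(5) using t fan(1-4) by (intro exI[of _ 4] lies_on.fan) auto
  next
    case fan'
    have "0 < x" "x < 2 * k" using fan'(2) k4[OF fan'(1)] by auto
    with z obtain t where t: "0 \<le> t" "t \<le> 1" "Re z = (1 - t) * real x + t * 3" "Im z = t"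
      unfolding fan'(3) by (auto elim!: hull_pairE simp: pos_simps[simplified] pos_simps)
    have "Re z = real x * (1 - Im z) + 3 * Im z" unfolding t(3,4) by (simp add: algebra_simps)
    then show ?thesis unfolding fan'(3) using t fan'(1,2) by (intro exI[of _ 5] lies_on.fan') auto
  next
    case top
    from z obtain t where t: "0 \<le> t" "t \<le> 1" "Re z = (1 - t) * 3 + t * (7 / 2)" "Im z = (1 - t) * 2 + t"
      unfolding top by (auto elim!: hull_pairE simp: pos_simps[simplified] pos_simps)
    have "Re z = 4 - Im z / 2" unfolding t(3,4) by (simp add: field_simps)
    then show ?thesis unfolding top using t by (intro exI[of _ 6] lies_on.top) auto
  next
    case top'
    from z obtain t where t: "0 \<le> t" "t \<le> 1" "Re z = 3" "Im z = (1 - t) * 2 + t"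
      unfolding top'(2) by (auto elim!: hull_pairE simp: pos_simps[simplified] pos_simps)
    then show ?thesis unfolding top'(2) using top'(1) by (intro exI[of _ 7] lies_on.top') auto
  qed
qed

lemma lies_on_pos:
  "\<lbrakk>Im z = 0; Re z = real v; 0 < v; v < 2 * k\<rbrakk> \<Longrightarrow> z = pos v"
  "\<lbrakk>Im z = 2; Re z = 3\<rbrakk> \<Longrightarrow> z = pos 0"
  "\<lbrakk>Im z = - 1; Re z = 3\<rbrakk> \<Longrightarrow> z = pos (2 * k)"
  "\<lbrakk>Im z = 1; Re z = 7 / 2\<rbrakk> \<Longrightarrow> z = pos (2 * k + 1)"
  "\<lbrakk>Im z = 1; Re z = 3\<rbrakk> \<Longrightarrow> z = pos (2 * k + 2)"
  unfolding complex_eq_iff using pos_simps by simp_all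

text \<open>
  Two segments leaving the same point with different slopes meet nowhere else. In each horizontal
  strip the other pairs keep their order from left to right, because they have it on both border
  lines: if \<open>a \<le> b\<close> and \<open>y \<le> 1\<close> then \<open>a(1 - y) \<le> b(1 - y)\<close>, and similarly at the top.
\<close>
lemma meet_at_common_vertex:
  assumes "lies_on i e z" "lies_on j e' z" "i \<le> j" "e \<noteq> e'"
  shows "\<exists>v\<in>e \<inter> e'. z = pos v"
proof -
  have K: "real k \<ge> 3" using k3 by simp
  have axis: ?thesis if "Im z = 0" "Re z = real v" "0 < v" "v < 2 * k" "v \<in> e" "v \<in> e'" for v
    using lies_on_pos(1)[OF that(1-4)] that(5,6) by blast
  have at: ?thesis if "z = pos v" "v \<in> e" "v \<in> e'" for v
    using that by blast
  (* Two different lines through the same point at height one meet nowhere else. *)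
  have strip: "y = 1" if "a * (1 - y) + h * y = b * (1 - y) + h * y" "a \<noteq> b" for a b h y :: real
  proof -
    have "(a - b) * (1 - y) = 0" using that(1) by (simp add: algebra_simps)
    then show ?thesis using that(2) by simp
  qed
  have mono: "a - a * y \<le> b - b * y" if "a \<le> b" "y \<le> 1" for a b y :: real
    using mult_right_mono[of a b "1 - y"] that by (simp add: algebra_simps)
  from assms(1) show ?thesis
  proof cases
    case (path x)
    note o = path
    from assms(2) show ?thesis
    proof cases
      case (path x')
      have "x \<noteq> x'" using assms(4) path(2) o(2) by blast
      then consider "Suc x \<le> x'" | "Suc x' \<le> x" by linarith
      then show ?thesis
      proof cases
        case 1
        then have "real x' = real x + 1" using path(6) o(7) by linarith
        then have "x' = Suc x" by linarith
        then show ?thesis using path o by (intro axis[of x']) auto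
      next
        case 2
        then have "real x = real x' + 1" using path(7) o(6) by linarith
        then have "x = Suc x'" by linarith
        then show ?thesis using path o by (intro axis[of x]) auto
      qed
    next
      case left
      then show ?thesis using path k3 by (intro axis[of 1]) auto
    next
      case right
      then have "real x + 1 \<ge> 2 * real k - 1" using path by auto
      then have "Suc x = 2 * k - 1" using path(4) by linarith
      then show ?thesis using right path k3 by (intro axis[of "2 * k - 1"]) (auto simp: of_nat_diff)
    next
      case (low x')
      then have "x' = x \<or> x' = Suc x" using path by auto
      then show ?thesis using low path by (intro axis[of x']) auto
    next
      case (fan x')
      then have "x' = x \<or> x' = Suc x" using path by auto
      then show ?thesis using fan path by (intro axis[of x']) auto
    next
      case (fan' x')
      then have "x' = x \<or> x' = Suc x" using path by auto
      then show ?thesis using fan' path by (intro axis[of x']) auto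
    qed (use path in auto)
  next
    case left
    note o = left
    from assms(2) show ?thesis
    proof cases
      case right
      then have "(real k - 1) * (Im z - 2) = 0" using left by (simp add: algebra_simps)
      then have "Im z = 2" using K by simp
      then show ?thesis using left right by (intro at[OF lies_on_pos(2)]) auto
    next
      case (low x')
      then show ?thesis using left k3 by (intro axis[of 1]) auto
    next
      case (fan x')
      have "2 \<le> x'" using fan(3,5) by presburger
      then have "real x' \<ge> 2" by simp
      then have "2 - 2 * Im z \<le> real x' - real x' * Im z" using fan(8) by (intro mono) auto
      moreover have "Re z = real x' - real x' * Im z + 7 / 2 * Im z" using fan(9) by (simp add: algebra_simps)
      ultimately have False using fan(7) left(5) by linarith
      then show ?thesis ..
    next
      case (fan' x')
      then have "2 - 2 * Im z \<le> real x' - real x' * Im z" by (intro mono) auto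
      moreover have "Re z = real x' - real x' * Im z + 3 * Im z" using fan'(7) by (simp add: algebra_simps)
      ultimately have False using fan'(5) left(5) by linarith
      then show ?thesis ..
    next
      case top
      then have "Im z = 2" using left by linarith
      then show ?thesis using left top by (intro at[OF lies_on_pos(2)]) auto
    next
      case top'
      then have "Im z = 2" using left by linarith
      then show ?thesis using left top' by (intro at[OF lies_on_pos(2)]) auto
    qed (use assms(3,4) left in auto)
  next
    case right
    note o = right
    have R: "Re z = (2 * real k - 1) * (1 - Im z) + (real k + 1) * Im z"
      unfolding right(5) by (simp add: algebra_simps)
    from assms(2) show ?thesis
    proof cases
      case (low x')
      then have "x' = 2 * k - 1" using right by auto
      then show ?thesis using low right k3 by (intro axis[of x']) (auto simp: of_nat_diff)
    next
      case (fan x')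
      have "real x' + 1 \<le> 2 * real k - 1" using fan(4) by linarith
      then have "(real x' + 1) - (real x' + 1) * Im z \<le> (2 * real k - 1) - (2 * real k - 1) * Im z"
        using fan by (intro mono) auto
      moreover have "4 * Im z \<le> (real k + 1) * Im z" using K right by (intro mult_right_mono) auto
      moreover have "Re z = (real x' + 1) - (real x' + 1) * Im z - (1 - Im z) + 7 / 2 * Im z"
        using fan(9) by (simp add: algebra_simps)
      moreover have "Re z = (2 * real k - 1) - (2 * real k - 1) * Im z + (real k + 1) * Im z"
        using R by (simp add: algebra_simps)
      ultimately have False using fan(7,8) by linarith
      then show ?thesis ..
    next
      case (fan' x')
      have "real x' + 1 \<le> 2 * real k - 1" using fan'(4) k4[OF fan'(3)] by auto
      then have "(real x' + 1) - (real x' + 1) * Im z \<le> (2 * real k - 1) - (2 * real k - 1) * Im z"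
        using fan' by (intro mono) auto
      moreover have "4 * Im z \<le> (real k + 1) * Im z" using K right by (intro mult_right_mono) auto
      moreover have "Re z = (real x' + 1) - (real x' + 1) * Im z - (1 - Im z) + 3 * Im z"
        using fan'(7) by (simp add: algebra_simps)
      moreover have "Re z = (2 * real k - 1) - (2 * real k - 1) * Im z + (real k + 1) * Im z"
        using R by (simp add: algebra_simps)
      ultimately have False using fan'(5,6) by linarith
      then show ?thesis ..
    next
      case top
      have "2 * real k - 1 - (real k - 2) * Im z = 4 - Im z / 2" using right(5) top(5) by simp
      then have "(2 * real k - 5) * (2 - Im z) = 0" by (simp add: field_simps)
      then have "Im z = 2" using K by simp
      then show ?thesis using right top by (intro at[OF lies_on_pos(2)]) auto
    next
      case top'
      then have "(real k - 2) * (2 - Im z) = 0" using right by (simp add: algebra_simps)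
      then have "Im z = 2" using K by simp
      then show ?thesis using right top' by (intro at[OF lies_on_pos(2)]) auto
    qed (use assms(3,4) right in auto)
  next
    case (low x)
    note o = low
    from assms(2) show ?thesis
    proof cases
      case (low x')
      have "x \<noteq> x'" using assms(4) low(2) o(2) by blast
      moreover have "(real x - real x') * (1 + Im z) = 0"
        using low(7) o(7) by (simp add: algebra_simps)
      ultimately have "Im z = - 1" by simp
      then show ?thesis using low o by (intro at[OF lies_on_pos(3)]) auto
    next
      case (fan x')
      then have "Im z = 0" using low by linarith
      then have "x = x'" using fan low by simp
      then show ?thesis using fan low by simp
    next
      case (fan' x')
      then have "Im z = 0" using low by linarith
      then have "x = x'" using fan' low by simp
      then show ?thesis using fan' low by auto
    qed (use assms(3,4) low in auto)
  next
    case (fan x)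
    note o = fan
    from assms(2) show ?thesis
    proof cases
      case (fan x')
      have "x \<noteq> x'" using assms(4) fan(2) o(2) by blast
      then have "Im z = 1"
        using strip[of "real x" "Im z" "7 / 2" "real x'"] fan(9) o(9) by simp
      then show ?thesis using fan o by (intro at[OF lies_on_pos(4)]) auto
    next
      case (fan' x')
      have "x \<ge> 4" using fan(3,5,6) fan'(3) by presburger
      then have "real x' \<le> real x" using fan'(4) by auto
      then have "real x' - real x' * Im z \<le> real x - real x * Im z" using fan by (intro mono) auto
      moreover have "real x - real x * Im z + 7 / 2 * Im z = real x' - real x' * Im z + 3 * Im z"
        using fan(9) fan'(7) by (simp add: algebra_simps)
      ultimately have y: "Im z = 0" using fan(7) by linarith
      then have "x = x'" using fan fan' by simp
      then show ?thesis using y fan fan' by (intro axis[of x]) auto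
    next
      case top
      then have y: "Im z = 1" using fan by linarith
      then show ?thesis using fan top by (intro at[OF lies_on_pos(4)]) auto
    next
      case top'
      then have y: "Im z = 1" using fan by linarith
      then show ?thesis using fan top' by simp
    qed (use assms(3,4) fan in auto)
  next
    case (fan' x)
    note o = fan'
    from assms(2) show ?thesis
    proof cases
      case (fan' x')
      have "x \<noteq> x'" using assms(4) fan'(2) o(2) by blast
      then have "Im z = 1"
        using strip[of "real x" "Im z" 3 "real x'"] fan'(7) o(7) by simp
      then show ?thesis using fan' o by (intro at[OF lies_on_pos(5)]) auto
    next
      case top
      then have y: "Im z = 1" using fan' by linarith
      then show ?thesis using fan' top by simp
    next
      case top'
      then have y: "Im z = 1" using fan' by linarith
      then show ?thesis using fan' top' by (intro at[OF lies_on_pos(5)]) auto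
    qed (use assms(3,4) fan' in auto)
  next
    case top
    note o = top
    from assms(2) show ?thesis
    proof cases
      case top'
      then have "Im z = 2" using top by linarith
      then show ?thesis using top top' by (intro at[OF lies_on_pos(2)]) auto
    qed (use assms(3,4) top in auto)
  next
    case top'
    note o = top'
    from assms(2) show ?thesis
      by cases (use assms(3,4) top' in auto)
  qed
qed

lemma planar_wheel: "planar wheel_graph"
proof (rule planar_if_straight_drawing[OF pair_graph_wheel])
  show "inj_on pos (pverts wheel_graph)"
    by (auto simp: inj_on_def wheel_graph_def in_verts pos_def split: if_splits)
  fix e e' z assume e: "e \<in> edges wheel_graph" "e' \<in> edges wheel_graph" "e \<noteq> e'"
    and z: "z \<in> convex hull (pos ` e)" "z \<in> convex hull (pos ` e')"
  obtain i where i: "lies_on i e z" using lies_on_edge[of e z] e(1) z(1) by (auto simp: edges_wheel)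
  obtain j where j: "lies_on j e' z" using lies_on_edge[of e' z] e(2) z(2) by (auto simp: edges_wheel)
  have "\<exists>v\<in>e \<inter> e'. z = pos v"
  proof (cases "i \<le> j")
    case True
    then show ?thesis using meet_at_common_vertex[OF i j] e(3) by blast
  next
    case False
    then show ?thesis using meet_at_common_vertex[OF j i] e(3) by auto
  qed
  then show "z \<in> pos ` (e \<inter> e')" by blast
next
  fix v assume "v \<in> pverts wheel_graph"
  then consider "v < 2 * k" | "v = 2 * k" | "v = 2 * k + 1" | "d > 0" "v = 2 * k + 2"
    by (auto simp: wheel_graph_def in_verts)
  then have "\<exists>u. {v, u} \<in> wheel_edges"
  proof cases
    case 1
    then show ?thesis using hub_adj by blast
  next
    case 2
    then show ?thesis using b_adj[of 1] k3 by auto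
  next
    case 3
    then show ?thesis using a_adj[of 0] k3 by auto
  next
    case 4
    then show ?thesis using a'_adj[of 0] by auto
  qed
  then show "\<exists>e\<in>edges wheel_graph. v \<in> e" unfolding edges_wheel by blast
qed

end

section \<open>The bound is attained\<close>

lemma sharp_planar_graph_exists:
  assumes n: "n = 8 \<or> n \<ge> 10"
  shows "\<exists>G :: nat pair_pre_digraph. pair_graph G \<and> planar G \<and> card (pverts G) = n \<and> overlap_number G = 2 * n - 5"
proof -
  (* For odd n the wheel with 2k + 2 = n - 1 vertices is split. *)
  define k where "k = (n - 2) div 2"
  define d where "d = n mod 2"
  have n_eq: "n = 2 * k + 2 + d" using n unfolding k_def d_def by presburger
  interpret split_wheel k d
  proof
    show "k \<ge> 3" "d > 0 \<Longrightarrow> k \<ge> 4" "d \<le> 1" using n unfolding k_def d_def by presburger+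
  qed
  have c: "card (pverts wheel_graph) = n" by (simp add: wheel_graph_def card_verts n_eq)
  have "overlap_number wheel_graph \<le> 2 * n - 5"
    using planar_overlap_number_le[OF pair_graph_wheel planar_wheel] c n by auto
  moreover have "overlap_number wheel_graph \<ge> 2 * n - 5"
    using overlap_number_wheel_ge card_verts n_eq by simp
  ultimately show ?thesis using pair_graph_wheel planar_wheel c by (intro exI[of _ wheel_graph]) simp
qed

theorem theorem4p8:
  shows "(\<forall>(G :: 'a pair_pre_digraph) (n :: nat).
            pair_graph G \<longrightarrow> planar G \<longrightarrow> card (pverts G) = n \<longrightarrow> n \<ge> 5 \<longrightarrow>
            overlap_number G \<le> 2 * n - 5) \<and>
         (\<forall>n :: nat. n = 8 \<or> n \<ge> 10 \<longrightarrow>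
            (\<exists>G :: nat pair_pre_digraph.
               pair_graph G \<and> planar G \<and> card (pverts G) = n \<and>
               overlap_number G = 2 * n - 5))"
proof (intro conjI allI impI)
  fix G :: "'a pair_pre_digraph" and n :: nat
  assume "pair_graph G" "planar G" "card (pverts G) = n" "n \<ge> 5"
  then show "overlap_number G \<le> 2 * n - 5" using planar_overlap_number_le by blast
next
  fix n :: nat
  assume "n = 8 \<or> n \<ge> 10"
  then show "\<exists>G :: nat pair_pre_digraph. pair_graph G \<and> planar G \<and> card (pverts G) = n \<and>
    overlap_number G = 2 * n - 5"
    by (rule sharp_planar_graph_exists)
qed

end
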